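(* For all $t\in[0,T_\delta]$ the upper boundary $c^{(2)}$ is finite, i.e. $$\sup_{t\in[0,T_\delta]}c^{(2)}(t)<+\infty.$$
   Context: Fix constants $r>0$, $\sigma>0$, $K>0$, $\delta>0$ and $T\ge\delta$, and set $T_\delta:=T-\delta$. On a complete probability space let $B$ be a standard Brownian motion with its natural filtration $(\mathcal F_s)_{s\ge0}$ completed with the null sets; for $x>0$ let $X^x_s=x\exp(\sigma B_s+(r-\tfrac12\sigma^2)s)$, $s\ge0$. Stopping times are with respect to $(\mathcal F_s)$. American put value: $V^{(1)}(t,x):=\sup_{0\le\tau\le T-t}\mathsf E[e^{-r\tau}(K-X^x_\tau)^+]$ for $(t,x)\in[0,T]\times(0,\infty)$. Swing option with two rights: for $(t,x)\in[0,T_\delta]\times(0,\infty)$, $$G(t,x):=(K-x)^++R(t,x),\quad R(t,x):=e^{-r\delta}\,\mathsf E\,V^{(1)}(t+\delta,X^x_\delta),\quad V^{(2)}(t,x):=\sup_{0\le\tau\le T_\delta-t}\mathsf E\,e^{-r\tau}G(t+\tau,X^x_\tau).$$ Let $C^{(2)}_t:=\{x\in(0,\infty):V^{(2)}(t,x)>G(t,x)\}$. For each $t\in[0,T_\delta)$ this set is a nonempty open interval containing $K$, and one writes $C^{(2)}_t=(b^{(2)}(t),c^{(2)}(t))$ with $0<b^{(2)}(t)<K<c^{(2)}(t)\le\infty$, i.e. $b^{(2)}(t)=\inf C^{(2)}_t$ and $c^{(2)}(t)=\sup C^{(2)}_t$; at the terminal time $b^{(2)}(T_\delta)=c^{(2)}(T_\delta)=K$.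 *)

theory Defs
  imports "HOL-Probability.Probability"
begin

definition raw_filtration :: "'a measure \<Rightarrow> (real \<Rightarrow> 'a \<Rightarrow> real) \<Rightarrow> real \<Rightarrow> 'a measure" where
  "raw_filtration M B s =
     sigma (space M) (\<Union>u\<in>{0..s}. {B u -` A \<inter> space M | A. A \<in> sets borel})"

(* Only times s \<ge> 0 matter. The index type is real so that the library's stopping_time applies; at
   negative times the \<sigma>-algebra is generated by the null sets, which places no constraint on a
   nonnegative stopping time. *)
definition completed_filtration :: "'a measure \<Rightarrow> (real \<Rightarrow> 'a \<Rightarrow> real) \<Rightarrow> real \<Rightarrow> 'a measure" where
  "completed_filtration M B s =
     sigma (space M) (sets (raw_filtration M B s) \<union> null_sets M)"

definition standard_brownian_motion :: "'a measure \<Rightarrow> (real \<Rightarrow> 'a \<Rightarrow> real) \<Rightarrow> bool" where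
  "standard_brownian_motion M B \<longleftrightarrow>
     (\<forall>s\<ge>0. B s \<in> borel_measurable M) \<and>
     (AE \<omega> in M. B 0 \<omega> = 0) \<and>
     (AE \<omega> in M. continuous_on {0..} (\<lambda>s. B s \<omega>)) \<and>
     (\<forall>s t. 0 \<le> s \<and> s < t \<longrightarrow>
        distributed M lborel (\<lambda>\<omega>. B t \<omega> - B s \<omega>) (normal_density 0 (sqrt (t - s))) \<and>
        prob_space.indep_set M (sets (raw_filtration M B s))
          {(\<lambda>\<omega>. B t \<omega> - B s \<omega>) -` A \<inter> space M | A. A \<in> sets borel})"

definition gbm :: "(real \<Rightarrow> 'a \<Rightarrow> real) \<Rightarrow> real \<Rightarrow> real \<Rightarrow> real \<Rightarrow> real \<Rightarrow> 'a \<Rightarrow> real" where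
  "gbm B r \<sigma> x s \<omega> = x * exp (\<sigma> * B s \<omega> + (r - \<sigma>\<^sup>2 / 2) * s)"

definition stopping_times_upto ::
    "'a measure \<Rightarrow> (real \<Rightarrow> 'a \<Rightarrow> real) \<Rightarrow> real \<Rightarrow> ('a \<Rightarrow> real) set" where
  "stopping_times_upto M B h =
     {\<tau>. stopping_time (completed_filtration M B) \<tau> \<and> (\<forall>\<omega>\<in>space M. 0 \<le> \<tau> \<omega> \<and> \<tau> \<omega> \<le> h)}"

(* Payoffs take values in [0, K] for one right and in [0, 2 K] for two rights, so the real-valued
   suprema below are over bounded sets, nonempty for a nonnegative horizon. *)

definition V1 ::
    "'a measure \<Rightarrow> (real \<Rightarrow> 'a \<Rightarrow> real) \<Rightarrow> real \<Rightarrow> real \<Rightarrow> real \<Rightarrow> real \<Rightarrow> real \<Rightarrow> real \<Rightarrow> real" where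
  "V1 M B r \<sigma> K T t x =
     (SUP \<tau>\<in>stopping_times_upto M B (T - t).
        \<integral>\<omega>. exp (- r * \<tau> \<omega>) * max 0 (K - gbm B r \<sigma> x (\<tau> \<omega>) \<omega>) \<partial>M)"

definition R ::
    "'a measure \<Rightarrow> (real \<Rightarrow> 'a \<Rightarrow> real) \<Rightarrow> real \<Rightarrow> real \<Rightarrow> real \<Rightarrow> real \<Rightarrow> real \<Rightarrow> real \<Rightarrow> real \<Rightarrow> real" where
  "R M B r \<sigma> K \<delta> T t x =
     exp (- r * \<delta>) * (\<integral>\<omega>. V1 M B r \<sigma> K T (t + \<delta>) (gbm B r \<sigma> x \<delta> \<omega>) \<partial>M)"

definition G ::
    "'a measure \<Rightarrow> (real \<Rightarrow> 'a \<Rightarrow> real) \<Rightarrow> real \<Rightarrow> real \<Rightarrow> real \<Rightarrow> real \<Rightarrow> real \<Rightarrow> real \<Rightarrow> real \<Rightarrow> real" where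
  "G M B r \<sigma> K \<delta> T t x = max 0 (K - x) + R M B r \<sigma> K \<delta> T t x"

definition V2 ::
    "'a measure \<Rightarrow> (real \<Rightarrow> 'a \<Rightarrow> real) \<Rightarrow> real \<Rightarrow> real \<Rightarrow> real \<Rightarrow> real \<Rightarrow> real \<Rightarrow> real \<Rightarrow> real \<Rightarrow> real" where
  "V2 M B r \<sigma> K \<delta> T t x =
     (SUP \<tau>\<in>stopping_times_upto M B ((T - \<delta>) - t).
        \<integral>\<omega>. exp (- r * \<tau> \<omega>) * G M B r \<sigma> K \<delta> T (t + \<tau> \<omega>) (gbm B r \<sigma> x (\<tau> \<omega>) \<omega>) \<partial>M)"

definition C2 ::
    "'a measure \<Rightarrow> (real \<Rightarrow> 'a \<Rightarrow> real) \<Rightarrow> real \<Rightarrow> real \<Rightarrow> real \<Rightarrow> real \<Rightarrow> real \<Rightarrow> real \<Rightarrow> real set" where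
  "C2 M B r \<sigma> K \<delta> T t =
     {x. 0 < x \<and> V2 M B r \<sigma> K \<delta> T t x > G M B r \<sigma> K \<delta> T t x}"

(* At the terminal date the continuation set is empty and the boundary is K by convention. *)
definition c2 ::
    "'a measure \<Rightarrow> (real \<Rightarrow> 'a \<Rightarrow> real) \<Rightarrow> real \<Rightarrow> real \<Rightarrow> real \<Rightarrow> real \<Rightarrow> real \<Rightarrow> real \<Rightarrow> ereal" where
  "c2 M B r \<sigma> K \<delta> T t =
     (if t < T - \<delta> then (SUP x\<in>C2 M B r \<sigma> K \<delta> T t. ereal x) else ereal K)"

end

theory Submission
  imports Defs
begin

text \<open>
  When the price is above the strike, using the first right at once is worth the continuation value
  \<open>R\<close> alone, so waiting is worthwhile only if the chance of coming back below the strike pays for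
  the decrease of the discounted process \<open>R\<close> in the meantime. That decrease is strict: the American
  put satisfies the dynamic programming inequality, and deep in the money, below the level
  \<open>x_star\<close>, it loses at least \<open>(1 - exp (- r * \<epsilon>)) * K / 2\<close> over a period \<open>\<epsilon>\<close>
  (\<open>put_value_strict\<close>). Averaging over the refraction period \<open>\<delta>\<close>, the discounted \<open>R\<close> decreases at
  a rate of at least a constant times the probability that the price lies below \<open>x_star\<close> at time
  \<open>\<delta>\<close> from now (\<open>continuation_strict\<close>).

  What remains is a stopping problem for Brownian motion in the logarithmic coordinate: the player
  receives at most \<open>K\<close> for reaching a half line and pays the penalty \<open>c\<close> times the probability of
  being in another half line \<open>\<delta>\<close> time units later (locale \<open>penalised\<close>). Far away, at distance \<open>d\<close>,
  reaching the half line within time \<open>\<delta> / 4\<close> has probability of order \<open>exp (- 2 * d\<^sup>2 / \<delta>)\<close>, whereas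
  the penalty, even with its look-ahead shortened to \<open>3 / 4 * \<delta>\<close>, is of the larger order
  \<open>exp (- 2 * d\<^sup>2 / (3 * \<delta>))\<close>.
  Hence far away it is optimal to stop when little time is left. If this is
  known beyond a level \<open>l\<close> for a remaining time \<open>n * \<delta> / 8\<close>, then with one more period \<open>\<delta> / 8\<close> the
  player must reach \<open>l\<close> within about that period, and the same comparison applies with \<open>l\<close> as the
  target; finitely many rounds cover the whole horizon (\<open>game_value_vanishes\<close>). The comparison
  itself is done with an explicit function (\<open>supersolution\<close>) that vanishes at the starting point.

  The passage from stopping times to these computations with Gaussian kernels uses
  neither stochastic integrals nor martingales in continuous time. A stopping time is rounded up to a
  finite grid, a supermartingale on the grid is a sequence of functions decreased by the Gaussian
  kernel, and Fatou's lemma gives the bound for the original stopping time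
  (\<open>optional_stopping\<close>). Dynamic programming for the put is obtained by approximation with
  Bermudan puts, whose optimal exercise strategies are explicit (\<open>put_value_superharmonic\<close>).
\<close>

section \<open>Gaussian kernels\<close>

definition gauss :: "real \<Rightarrow> real measure" where
  "gauss d = density lborel (normal_density 0 (sqrt d))"

lemma sets_gauss[simp, measurable_cong]: "sets (gauss d) = sets borel"
  by (simp add: gauss_def)

lemma space_gauss[simp]: "space (gauss d) = UNIV"
  by (simp add: gauss_def)

lemma prob_space_gauss: "d > 0 \<Longrightarrow> prob_space (gauss d)"
  unfolding gauss_def by (rule prob_space_normal_density) simp

lemma measurable_gauss_int[measurable]:
  assumes [measurable]: "(\<lambda>(x, z). f x z) \<in> borel_measurable (N \<Otimes>\<^sub>M borel)"
  shows "(\<lambda>x. \<integral>\<^sup>+z. f x z \<partial>gauss d) \<in> borel_measurable N"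
proof -
  have "(\<integral>\<^sup>+z. f x z \<partial>gauss d) = (\<integral>\<^sup>+z. normal_density 0 (sqrt d) z * f x z \<partial>lborel)"
    if [measurable]: "x \<in> space N" for x
    unfolding gauss_def by (rule nn_integral_density) measurable
  then show ?thesis
    by (subst measurable_cong) (assumption, measurable)
qed

lemma nn_integral_exp_gauss:
  assumes "d > 0"
  shows "(\<integral>\<^sup>+z. ennreal (exp (a * z)) \<partial>gauss d) = ennreal (exp (a\<^sup>2 * d / 2))"
proof -
  have "(\<integral>\<^sup>+z. ennreal (exp (a * z)) \<partial>gauss d) =
      (\<integral>\<^sup>+z. ennreal (normal_density 0 (sqrt d) z) * ennreal (exp (a * z)) \<partial>lborel)"
    unfolding gauss_def by (rule nn_integral_density) measurable
  also have "\<dots> = (\<integral>\<^sup>+z. ennreal (exp (a\<^sup>2 * d / 2)) * ennreal (normal_density (a * d) (sqrt d) z) \<partial>lborel)"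
  proof (rule nn_integral_cong)
    fix z
    have "- z\<^sup>2 / (2 * d) + a * z = a\<^sup>2 * d / 2 + - (z - a * d)\<^sup>2 / (2 * d)"
      using assms by (simp add: field_simps power2_eq_square)
    then have "exp (- z\<^sup>2 / (2 * d)) * exp (a * z) = exp (a\<^sup>2 * d / 2) * exp (- (z - a * d)\<^sup>2 / (2 * d))"
      unfolding exp_add[symmetric] by simp
    then show "ennreal (normal_density 0 (sqrt d) z) * ennreal (exp (a * z)) =
        ennreal (exp (a\<^sup>2 * d / 2)) * ennreal (normal_density (a * d) (sqrt d) z)"
      using assms by (simp add: ennreal_mult[symmetric] normal_density_def divide_simps mult_ac)
  qed
  also have "\<dots> = ennreal (exp (a\<^sup>2 * d / 2)) * emeasure (density lborel (normal_density (a * d) (sqrt d))) UNIV"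
    by (subst nn_integral_cmult) (auto simp: emeasure_density)
  also have "\<dots> = ennreal (exp (a\<^sup>2 * d / 2))"
    using prob_space.emeasure_space_1[OF prob_space_normal_density[of "sqrt d" "a * d"]] assms by simp
  finally show ?thesis .
qed

lemma integral_gauss:
  fixes f :: "real \<Rightarrow> real"
  assumes [measurable]: "f \<in> borel_measurable borel"
  shows "(\<integral>z. f z \<partial>gauss d) = (\<integral>z. normal_density 0 (sqrt d) z * f z \<partial>lborel)"
  unfolding gauss_def by (subst integral_density) auto

lemma gauss_id:
  assumes "d > 0"
  shows "integrable (gauss d) (\<lambda>z. z)" "(\<integral>z. z \<partial>gauss d) = 0"
proof -
  have "has_bochner_integral lborel (\<lambda>x. normal_density 0 (sqrt d) x * x) 0"
    by (rule normal_moment_nz_1) (use assms in simp)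
  then show "integrable (gauss d) (\<lambda>z. z)" "(\<integral>z. z \<partial>gauss d) = 0"
    unfolding integral_gauss[of "\<lambda>z. z" d, simplified]
    by (auto simp: gauss_def integrable_density has_bochner_integral_iff)
qed

lemma gauss_exp:
  assumes "d > 0"
  shows "integrable (gauss d) (\<lambda>z. exp (a * z))" "(\<integral>z. exp (a * z) \<partial>gauss d) = exp (a\<^sup>2 * d / 2)"
proof -
  show 1: "integrable (gauss d) (\<lambda>z. exp (a * z))"
    by (rule integrableI_bounded) (auto simp: nn_integral_exp_gauss[OF assms])
  show "(\<integral>z. exp (a * z) \<partial>gauss d) = exp (a\<^sup>2 * d / 2)"
    using nn_integral_eq_integral[OF 1] nn_integral_exp_gauss[OF assms, of a] by simp
qed

definition gauss_cdf :: "real \<Rightarrow> real \<Rightarrow> real" where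
  "gauss_cdf d a = measure (gauss d) {..<a}"

lemma gauss_cdf_bounds: "d > 0 \<Longrightarrow> 0 \<le> gauss_cdf d a \<and> gauss_cdf d a \<le> 1"
  unfolding gauss_cdf_def using prob_space.prob_le_1[OF prob_space_gauss] by auto

lemma gauss_cdf_mono: "d > 0 \<Longrightarrow> a \<le> b \<Longrightarrow> gauss_cdf d a \<le> gauss_cdf d b"
proof -
  assume d: "d > 0" and "a \<le> b"
  interpret g: prob_space "gauss d" by (rule prob_space_gauss) fact
  show ?thesis unfolding gauss_cdf_def using \<open>a \<le> b\<close> by (intro g.finite_measure_mono) auto
qed

lemma gauss_cdf_measurable[measurable]: "d > 0 \<Longrightarrow> gauss_cdf d \<in> borel_measurable borel"
  by (rule borel_measurable_mono) (auto simp: mono_def gauss_cdf_mono)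

lemma gauss_cdf_scale:
  assumes "d > 0"
  shows "gauss_cdf d a = gauss_cdf 1 (a / sqrt d)"
proof -
  interpret p: prob_space "gauss 1" by (rule prob_space_gauss) simp
  have "distributed (gauss 1) lborel (\<lambda>x. x) (normal_density 0 1)"
    by (auto simp: distributed_def gauss_def distr_id2)
  then have "distributed (gauss 1) lborel (\<lambda>x. 0 + sqrt d * x) (normal_density (0 + sqrt d * 0) (\<bar>sqrt d\<bar> * 1))"
    by (rule p.normal_density_affine) (use assms in auto)
  then have "distr (gauss 1) lborel (\<lambda>x. sqrt d * x) = gauss d"
    using assms by (simp add: distributed_def gauss_def)
  then have "gauss_cdf d a = measure (distr (gauss 1) lborel (\<lambda>x. sqrt d * x)) {..<a}"
    by (simp add: gauss_cdf_def)
  also have "\<dots> = measure (gauss 1) ((\<lambda>x. sqrt d * x) -` {..<a} \<inter> space (gauss 1))"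
    by (rule measure_distr) auto
  also have "(\<lambda>x. sqrt d * x) -` {..<a} \<inter> space (gauss 1) = {..<a / sqrt d}"
    using assms by (auto simp: field_simps)
  finally show ?thesis by (simp add: gauss_cdf_def)
qed

text \<open>To the left of the mean, a larger variance gives more mass to the tail.\<close>

lemma gauss_cdf_variance_mono:
  assumes "0 < d" "d \<le> d'" "a \<le> 0"
  shows "gauss_cdf d a \<le> gauss_cdf d' a"
proof -
  have "a / sqrt d \<le> a / sqrt d'"
    using assms by (intro divide_left_mono_neg) auto
  then show ?thesis
    using assms gauss_cdf_scale[of d a] gauss_cdf_scale[of d' a] gauss_cdf_mono[of 1] by simp
qed

text \<open>The interval of length one to the left of \<open>- a\<close> has at least this mass, since the density is
  smallest at its left end point.\<close>

lemma gauss_cdf_lower: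
  assumes "d > 0" "a \<ge> 0"
  shows "normal_density 0 (sqrt d) (a + 1) \<le> gauss_cdf d (- a)"
proof -
  have "ennreal (normal_density 0 (sqrt d) (a + 1)) = (\<integral>\<^sup>+z. ennreal (normal_density 0 (sqrt d) (a + 1)) * indicator {-a-1<..<-a} z \<partial>lborel)"
    by (subst nn_integral_cmult_indicator) auto
  also have "\<dots> \<le> (\<integral>\<^sup>+z. ennreal (normal_density 0 (sqrt d) z) * indicator {..<-a} z \<partial>lborel)"
  proof (rule nn_integral_mono)
    fix z
    have "normal_density 0 (sqrt d) (a + 1) \<le> normal_density 0 (sqrt d) z" if "-a-1 < z" "z < -a"
    proof -
      have "\<bar>z\<bar> \<le> \<bar>a + 1\<bar>" using that assms by auto
      then have "z\<^sup>2 \<le> (a + 1)\<^sup>2" by (simp add: abs_le_square_iff)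
      then show ?thesis using assms
        by (auto simp: normal_density_def intro!: divide_right_mono)
    qed
    then show "ennreal (normal_density 0 (sqrt d) (a + 1)) * indicator {-a-1<..<-a} z \<le>
      ennreal (normal_density 0 (sqrt d) z) * indicator {..<-a} z"
      by (auto split: split_indicator intro: ennreal_leI)
  qed
  also have "\<dots> = emeasure (gauss d) {..<-a}"
    unfolding gauss_def by (simp add: emeasure_density)
  also have "\<dots> = ennreal (gauss_cdf d (-a))"
    unfolding gauss_cdf_def
    by (rule finite_measure.emeasure_eq_measure[OF prob_space.finite_measure[OF prob_space_gauss[OF assms(1)]]])
  finally show ?thesis by (simp add: gauss_cdf_def)
qed

lemma nn_integral_shift: 
  fixes f :: "real \<Rightarrow> ennreal"
  assumes [measurable]: "f \<in> borel_measurable borel"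
  shows "(\<integral>\<^sup>+z. f (a + z) \<partial>lborel) = (\<integral>\<^sup>+z. f z \<partial>lborel)"
  using nn_integral_real_affine[of f 1 a] by simp

lemma nn_integral_gauss_add:
  fixes f :: "real \<Rightarrow> ennreal"
  assumes d: "d > 0" "e > 0" and [measurable]: "f \<in> borel_measurable borel"
  shows "(\<integral>\<^sup>+x. \<integral>\<^sup>+z. f (x + z) \<partial>gauss d \<partial>gauss e) = (\<integral>\<^sup>+w. f w \<partial>gauss (d + e))"
proof -
  have "(\<integral>\<^sup>+x. \<integral>\<^sup>+z. f (x + z) \<partial>gauss d \<partial>gauss e) =
     (\<integral>\<^sup>+x. ennreal (normal_density 0 (sqrt e) x) * (\<integral>\<^sup>+z. f (x + z) \<partial>gauss d) \<partial>lborel)"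
    unfolding gauss_def[of e] by (rule nn_integral_density) auto
  also have "\<dots> = (\<integral>\<^sup>+x. \<integral>\<^sup>+w. f w * ennreal (normal_density 0 (sqrt d) (w - x) * normal_density 0 (sqrt e) x) \<partial>lborel \<partial>lborel)"
  proof (rule nn_integral_cong)
    fix x
    have "(\<integral>\<^sup>+z. f (x + z) \<partial>gauss d) = (\<integral>\<^sup>+z. ennreal (normal_density 0 (sqrt d) z) * f (x + z) \<partial>lborel)"
      unfolding gauss_def by (rule nn_integral_density) auto
    also have "\<dots> = (\<integral>\<^sup>+z. ennreal (normal_density 0 (sqrt d) ((x + z) - x)) * f (x + z) \<partial>lborel)" by simp
    also have "\<dots> = (\<integral>\<^sup>+w. ennreal (normal_density 0 (sqrt d) (w - x)) * f w \<partial>lborel)"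
      by (rule nn_integral_shift[of "\<lambda>w. ennreal (normal_density 0 (sqrt d) (w - x)) * f w"]) measurable
    finally show "ennreal (normal_density 0 (sqrt e) x) * (\<integral>\<^sup>+z. f (x + z) \<partial>gauss d) =
      (\<integral>\<^sup>+w. f w * ennreal (normal_density 0 (sqrt d) (w - x) * normal_density 0 (sqrt e) x) \<partial>lborel)"
      by (simp add: nn_integral_cmult[symmetric] ennreal_mult mult_ac)
  qed
  also have "\<dots> = (\<integral>\<^sup>+w. \<integral>\<^sup>+x. f w * ennreal (normal_density 0 (sqrt d) (w - x) * normal_density 0 (sqrt e) x) \<partial>lborel \<partial>lborel)"
    by (rule lborel_pair.Fubini') measurable
  also have "\<dots> = (\<integral>\<^sup>+w. f w * (\<integral>\<^sup>+x. ennreal (normal_density 0 (sqrt d) (w - x) * normal_density 0 (sqrt e) x) \<partial>lborel) \<partial>lborel)"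
    by (intro nn_integral_cong nn_integral_cmult) measurable
  also have "\<dots> = (\<integral>\<^sup>+w. f w * ennreal (normal_density 0 (sqrt (d + e)) w) \<partial>lborel)"
    using fun_cong[OF conv_normal_density_zero_mean[of "sqrt d" "sqrt e"]] d by simp
  also have "\<dots> = (\<integral>\<^sup>+w. f w \<partial>gauss (d + e))"
    unfolding gauss_def by (subst nn_integral_density) (auto simp: mult.commute)
  finally show ?thesis .
qed

lemma gauss_cdf_semigroup:
  assumes "d > 0" "e > 0"
  shows "(\<integral>x. gauss_cdf d (a - x) \<partial>gauss e) = gauss_cdf (d + e) a"
proof -
  interpret gd: prob_space "gauss d" by (rule prob_space_gauss) fact
  interpret gde: prob_space "gauss (d + e)" by (rule prob_space_gauss) (use assms in simp)
  have "ennreal (gauss_cdf d (a - x)) = (\<integral>\<^sup>+z. indicator {..<a} (x + z) \<partial>gauss d)" for x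
  proof -
    have "(\<integral>\<^sup>+z. indicator {..<a} (x + z) \<partial>gauss d) = (\<integral>\<^sup>+z. indicator {..<a - x} z \<partial>gauss d)"
      by (intro nn_integral_cong) (auto split: split_indicator)
    then show ?thesis by (simp add: gauss_cdf_def gd.emeasure_eq_measure)
  qed
  then have "(\<integral>\<^sup>+x. ennreal (gauss_cdf d (a - x)) \<partial>gauss e) = (\<integral>\<^sup>+w. indicator {..<a} w \<partial>gauss (d + e))"
    using nn_integral_gauss_add[OF assms, of "indicator {..<a}"] by simp
  also have "\<dots> = ennreal (gauss_cdf (d + e) a)"
    by (simp add: gauss_cdf_def gde.emeasure_eq_measure)
  finally have "(\<integral>\<^sup>+x. ennreal (gauss_cdf d (a - x)) \<partial>gauss e) = ennreal (gauss_cdf (d + e) a)" .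
  moreover have "(\<lambda>x. gauss_cdf d (a - x)) \<in> borel_measurable (gauss e)"
    using gauss_cdf_measurable[OF assms(1)] by measurable
  ultimately show ?thesis
    using gauss_cdf_bounds[OF assms(1)] gauss_cdf_bounds[of "d + e"] assms
    by (subst integral_eq_nn_integral) auto
qed

lemma gauss_cdf_integrable:
  assumes "d > 0" "e > 0"
  shows "integrable (gauss e) (\<lambda>x. gauss_cdf d (a - x))"
proof -
  interpret ge: prob_space "gauss e" by (rule prob_space_gauss) fact
  have "(\<lambda>x. gauss_cdf d (a - x)) \<in> borel_measurable (gauss e)"
    using gauss_cdf_measurable[OF assms(1)] by measurable
  then show ?thesis
    by (intro ge.integrable_const_bound[of _ 1]) (use gauss_cdf_bounds[OF assms(1)] in auto)
qed

section \<open>Lower semicontinuity and integral bounds\<close>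

lemma integral_le_of_nn_integral_le:
  assumes "\<And>x. x \<in> space M \<Longrightarrow> 0 \<le> f x" "(\<integral>\<^sup>+x. ennreal (f x) \<partial>M) \<le> ennreal c" "0 \<le> c"
  shows "(\<integral>x. f x \<partial>M) \<le> c"
proof (cases "f \<in> borel_measurable M")
  case True
  have "(\<integral>x. f x \<partial>M) = enn2real (\<integral>\<^sup>+x. ennreal (f x) \<partial>M)"
    by (rule integral_eq_nn_integral) (use True assms(1) in auto)
  also have "\<dots> \<le> c" using assms by (simp add: enn2real_leI)
  finally show ?thesis .
next
  case False
  then have "\<not> integrable M f" by (auto dest: borel_measurable_integrable)
  then show ?thesis using assms by (simp add: not_integrable_integral_eq)
qed

lemma ennreal_cSUP_le:
  fixes f :: "'i \<Rightarrow> real"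
  assumes "I \<noteq> {}" "\<And>i. i \<in> I \<Longrightarrow> 0 \<le> f i" "\<And>i. i \<in> I \<Longrightarrow> ennreal (f i) \<le> c"
  shows "ennreal (SUP i\<in>I. f i) \<le> c"
proof (cases c)
  case (real l)
  have "(SUP i\<in>I. f i) \<le> l"
    by (rule cSUP_least) (use assms real in auto)
  then show ?thesis using real by (simp add: ennreal_leI)
qed simp

lemma lsc_real_iff:
  fixes w :: real
  assumes "0 \<le> w" "\<And>n. 0 \<le> ws n"
  shows "ennreal w \<le> liminf (\<lambda>n. ennreal (ws n)) \<longleftrightarrow> (\<forall>l<w. \<forall>\<^sub>F n in sequentially. l < ws n)"
  unfolding le_Liminf_iff
proof safe
  fix l assume H: "\<forall>y<ennreal w. \<forall>\<^sub>F n in sequentially. y < ennreal (ws n)" and l: "l < w"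
  show "\<forall>\<^sub>F n in sequentially. l < ws n"
  proof (cases "l < 0")
    case True
    then show ?thesis using assms(2) by (auto intro!: always_eventually order_less_le_trans[of l 0])
  next
    case False
    then have "ennreal l < ennreal w" using l by (simp add: ennreal_less_iff)
    with H have "\<forall>\<^sub>F n in sequentially. ennreal l < ennreal (ws n)" by blast
    then show ?thesis using False by (simp add: ennreal_less_iff)
  qed
next
  fix y assume H: "\<forall>l<w. \<forall>\<^sub>F n in sequentially. l < ws n" and y: "y < ennreal w"
  then obtain l where l: "y = ennreal l" "0 \<le> l" by (cases y) auto
  then have "l < w" using y by (simp add: ennreal_less_iff)
  with H have "\<forall>\<^sub>F n in sequentially. l < ws n" by blast
  then show "\<forall>\<^sub>F n in sequentially. y < ennreal (ws n)"
    using l by (simp add: ennreal_less_iff)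
qed

text \<open>Applied to discounted payoffs: the discount factors and the immediate payoffs converge, while the
  value functions are known to be lower semicontinuous only.\<close>

lemma lsc_real_affine:
  fixes a c w :: real
  assumes w: "0 \<le> w" "\<And>n. 0 \<le> ws n" "ennreal w \<le> liminf (\<lambda>n. ennreal (ws n))"
    and a: "as \<longlonglongrightarrow> a" "0 \<le> a" "\<And>n. 0 \<le> as n" and c: "cs \<longlonglongrightarrow> c" "0 < c" "\<And>n. 0 < cs n"
  shows "ennreal (c * (a + w)) \<le> liminf (\<lambda>n. ennreal (cs n * (as n + ws n)))"
proof -
  have "\<forall>\<^sub>F n in sequentially. l < cs n * (as n + ws n)" if l: "l < c * (a + w)" for l
  proof -
    have "l / c < a + w" using l c by (simp add: field_simps)
    then obtain w' where e: "w' < w" "l / c - a < w'"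
      using dense[of "l / c - a" w] by (auto simp: algebra_simps)
    have "(\<lambda>n. cs n * (as n + w')) \<longlonglongrightarrow> c * (a + w')"
      by (intro tendsto_intros a c)
    moreover have "l < c * (a + w')"
      using e c by (simp add: field_simps)
    ultimately have "\<forall>\<^sub>F n in sequentially. l < cs n * (as n + w')"
      by (rule order_tendstoD(1))
    moreover have "\<forall>\<^sub>F n in sequentially. w' < ws n"
      using w(3) e(1) unfolding lsc_real_iff[OF w(1,2)] by simp
    ultimately show ?thesis
    proof eventually_elim
      case (elim n)
      have "cs n * (as n + w') \<le> cs n * (as n + ws n)"
        using elim c(3)[of n] by (intro mult_left_mono) auto
      then show ?case using elim by simp
    qed
  qed
  moreover have "0 \<le> c * (a + w)" "\<And>n. 0 \<le> cs n * (as n + ws n)"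
    using w a c by (auto intro!: mult_nonneg_nonneg add_nonneg_nonneg less_imp_le[OF c(3)])
  ultimately show ?thesis by (subst lsc_real_iff) auto
qed

section \<open>Brownian motion and its completed filtration\<close>

lemma Int_stable_vimage: "Int_stable {X -` A \<inter> space M | A. A \<in> sets N}"
proof (rule Int_stableI, clarify)
  fix A C assume "A \<in> sets N" "C \<in> sets N"
  then show "\<exists>D. (X -` A \<inter> space M) \<inter> (X -` C \<inter> space M) = X -` D \<inter> space M \<and> D \<in> sets N"
    by (intro exI[of _ "A \<inter> C"]) auto
qed

locale brownian = prob_space M + complete_measure M
  for M :: "'a measure" +
  fixes B :: "real \<Rightarrow> 'a \<Rightarrow> real"
  assumes bm: "standard_brownian_motion M B"
begin

abbreviation "F \<equiv> completed_filtration M B"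

lemma B_measurable[measurable]: "s \<ge> 0 \<Longrightarrow> B s \<in> borel_measurable M"
  using bm by (auto simp: standard_brownian_motion_def)

lemma B_zero: "AE \<omega> in M. B 0 \<omega> = 0"
  using bm by (auto simp: standard_brownian_motion_def)

lemma B_continuous: "AE \<omega> in M. continuous_on {0..} (\<lambda>s. B s \<omega>)"
  using bm by (auto simp: standard_brownian_motion_def)

lemma raw_generators:
  "(\<Union>u\<in>{0..s}. {B u -` A \<inter> space M | A. A \<in> sets borel}) \<subseteq> Pow (space M)"
  by auto

lemma space_raw: "space (raw_filtration M B s) = space M"
  unfolding raw_filtration_def by (rule space_measure_of) (rule raw_generators)

lemma sets_raw:
  "sets (raw_filtration M B s) =
    sigma_sets (space M) (\<Union>u\<in>{0..s}. {B u -` A \<inter> space M | A. A \<in> sets borel})"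
  unfolding raw_filtration_def by (rule sets_measure_of) (rule raw_generators)

lemma raw_in_M: "sets (raw_filtration M B s) \<subseteq> sets M"
  unfolding sets_raw by (rule sets.sigma_sets_subset) (auto intro!: measurable_sets B_measurable)

lemma B_raw:
  assumes "0 \<le> u" "u \<le> s"
  shows "B u \<in> borel_measurable (raw_filtration M B s)"
proof (rule measurableI)
  fix A :: "real set" assume "A \<in> sets borel"
  then have "B u -` A \<inter> space M \<in> (\<Union>u\<in>{0..s}. {B u -` A \<inter> space M | A. A \<in> sets borel})"
    using assms by (intro UN_I[of u]) (simp, blast)
  then show "B u -` A \<inter> space (raw_filtration M B s) \<in> sets (raw_filtration M B s)"
    unfolding sets_raw space_raw by (rule sigma_sets.Basic)
qed simp

lemma completed_generators: "sets (raw_filtration M B s) \<union> null_sets M \<subseteq> Pow (space M)"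
  by (intro Un_least subset_trans[OF raw_in_M sets.space_closed] subset_trans[OF _ sets.space_closed]) (auto)

lemma space_F[simp]: "space (F s) = space M"
  unfolding completed_filtration_def by (rule space_measure_of) (rule completed_generators)

lemma sets_F: "sets (F s) = sigma_sets (space M) (sets (raw_filtration M B s) \<union> null_sets M)"
  unfolding completed_filtration_def by (rule sets_measure_of) (rule completed_generators)

lemma F_in_M: "sets (F s) \<subseteq> sets M"
  unfolding sets_F by (rule sets.sigma_sets_subset) (use raw_in_M in auto)

lemma raw_in_F: "sets (raw_filtration M B s) \<subseteq> sets (F s)"
  unfolding sets_F by (auto intro: sigma_sets.Basic)

lemma F_mono: "s \<le> t \<Longrightarrow> sets (F s) \<subseteq> sets (F t)"
proof -
  assume "s \<le> t"
  then have "sets (raw_filtration M B s) \<subseteq> sets (raw_filtration M B t)"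
    unfolding sets_raw by (intro sigma_sets_mono' UN_mono) auto
  then show ?thesis
    unfolding sets_F by (intro sigma_sets_mono') auto
qed

lemma B_F: "0 \<le> u \<Longrightarrow> u \<le> s \<Longrightarrow> B u \<in> borel_measurable (F s)"
  using B_raw[of u s] raw_in_F[of s] space_raw[of s]
  by (auto simp: measurable_def)

text \<open>Only null sets are added to the natural filtration, so the independence of increments, which is
  given for the natural filtration, carries over to the completed one.\<close>

lemma F_equals_raw_AE:
  assumes "A \<in> sets (F s)"
  shows "\<exists>A'\<in>sets (raw_filtration M B s). AE \<omega> in M. \<omega> \<in> A \<longleftrightarrow> \<omega> \<in> A'"
  using assms unfolding sets_F
proof (induction rule: sigma_sets.induct)
  case (Basic a)
  show ?case
  proof (cases "a \<in> null_sets M")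
    case True
    then show ?thesis
      using AE_not_in[OF True] by (intro bexI[of _ "{}"]) auto
  qed (use Basic in auto)
next
  case Empty
  show ?case by (rule bexI[of _ "{}"]) auto
next
  case (Compl a)
  then obtain A' where "A' \<in> sets (raw_filtration M B s)" "AE \<omega> in M. \<omega> \<in> a \<longleftrightarrow> \<omega> \<in> A'"
    by auto
  then show ?case
    by (intro bexI[of _ "space (raw_filtration M B s) - A'"] sets.compl_sets) (auto simp: space_raw)
next
  case (Union a)
  then obtain A' where A': "\<And>i. A' i \<in> sets (raw_filtration M B s)"
    "\<And>i. AE \<omega> in M. \<omega> \<in> a i \<longleftrightarrow> \<omega> \<in> A' i"
    by metis
  have "AE \<omega> in M. \<forall>i. \<omega> \<in> a i \<longleftrightarrow> \<omega> \<in> A' i"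
    using A' by (simp add: AE_all_countable)
  then show ?case
    using A'(1) by (intro bexI[of _ "\<Union>i. A' i"]) (auto elim!: eventually_mono)
qed

lemma increment_distr:
  assumes "0 \<le> s" "d > 0"
  shows "distr M borel (\<lambda>\<omega>. B (s + d) \<omega> - B s \<omega>) = gauss d"
proof -
  have "distributed M lborel (\<lambda>\<omega>. B (s + d) \<omega> - B s \<omega>) (normal_density 0 (sqrt ((s + d) - s)))"
    using bm assms unfolding standard_brownian_motion_def by (meson less_add_same_cancel1)
  then have "distr M lborel (\<lambda>\<omega>. B (s + d) \<omega> - B s \<omega>) = gauss d"
    by (simp add: distributed_def gauss_def)
  then show ?thesis
    by (metis distr_cong sets_lborel)
qed

lemma B_distr: assumes "d > 0" shows "distr M borel (B d) = gauss d"
proof -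
  have "distr M borel (B d) = distr M borel (\<lambda>\<omega>. B (0 + d) \<omega> - B 0 \<omega>)"
    using B_zero assms by (intro distr_cong_AE) auto
  also have "\<dots> = gauss d" by (rule increment_distr) (use assms in auto)
  finally show ?thesis .
qed

text \<open>The increment is independent of the pair of the indicator of \<open>A\<close> and \<open>B s\<close>, so their joint law is
  a product measure and the increment can be integrated out first.\<close>

lemma markov_raw:
  assumes s: "0 \<le> s" "d > 0" and A: "A \<in> sets (raw_filtration M B s)"
    and f[measurable]: "f \<in> borel_measurable (borel :: real measure)"
  shows "(\<integral>\<^sup>+\<omega>. indicator A \<omega> * f (B (s + d) \<omega>) \<partial>M) =
         (\<integral>\<^sup>+\<omega>. indicator A \<omega> * (\<integral>\<^sup>+z. f (B s \<omega> + z) \<partial>gauss d) \<partial>M)"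
proof -
  define \<Delta> where "\<Delta> \<omega> = (0 :: real, B (s + d) \<omega> - B s \<omega>)" for \<omega>
  define Y where "Y \<omega> = (indicator A \<omega> :: real, B s \<omega>)" for \<omega>
  have [measurable]: "A \<in> sets M" using A raw_in_M by auto
  have [measurable]: "B s \<in> borel_measurable M" "B (s + d) \<in> borel_measurable M"
    using s by auto
  have [measurable]: "\<Delta> \<in> borel_measurable M"
    unfolding \<Delta>_def[abs_def] by measurable
  have Yraw: "Y \<in> borel_measurable (raw_filtration M B s)"
    using A B_raw[of s s] s unfolding Y_def[abs_def] by measurable
  have [measurable]: "Y \<in> borel_measurable M"
    unfolding Y_def[abs_def] by measurable
  have ind: "indep_set (sets (raw_filtration M B s))
      {(\<lambda>\<omega>. B (s + d) \<omega> - B s \<omega>) -` A \<inter> space M | A. A \<in> sets borel}"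
    using bm s unfolding standard_brownian_motion_def by (meson less_add_same_cancel1)
  have Yin: "{Y -` C \<inter> space M | C. C \<in> sets borel} \<subseteq> sets (raw_filtration M B s)"
    using measurable_sets[OF Yraw] unfolding space_raw by blast
  have \<Delta>in: "{\<Delta> -` C \<inter> space M | C. C \<in> sets borel} \<subseteq>
    {(\<lambda>\<omega>. B (s + d) \<omega> - B s \<omega>) -` A \<inter> space M | A. A \<in> sets borel}"
  proof clarify
    fix C :: "(real \<times> real) set" assume C: "C \<in> sets borel"
    have "(\<lambda>z. (0 :: real, z :: real)) \<in> measurable borel borel" by measurable
    from measurable_sets[OF this C] have "Pair 0 -` C \<in> sets borel" by simp
    then show "\<exists>D. \<Delta> -` C \<inter> space M = (\<lambda>\<omega>. B (s + d) \<omega> - B s \<omega>) -` D \<inter> space M \<and> D \<in> sets borel"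
      by (intro exI[of _ "Pair 0 -` C"]) (auto simp: \<Delta>_def)
  qed
  have "indep_set {Y -` C \<inter> space M | C. C \<in> sets borel} {\<Delta> -` C \<inter> space M | C. C \<in> sets borel}"
    using ind Yin \<Delta>in unfolding indep_sets2_eq by (meson subset_iff)
  then have "indep_set (sigma_sets (space M) {Y -` C \<inter> space M | C. C \<in> sets borel})
      (sigma_sets (space M) {\<Delta> -` C \<inter> space M | C. C \<in> sets borel})"
    by (rule indep_set_sigma_sets) (rule Int_stable_vimage)+
  then have "indep_var borel Y borel \<Delta>"
    unfolding indep_var_eq by simp
  then have eq: "distr M (borel \<Otimes>\<^sub>M borel) (\<lambda>\<omega>. (Y \<omega>, \<Delta> \<omega>)) = distr M borel Y \<Otimes>\<^sub>M distr M borel \<Delta>"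
    by (simp add: indep_var_distribution_eq)
  interpret D: prob_space "distr M borel \<Delta>" by (rule prob_space_distr) simp
  let ?h = "\<lambda>(y::real\<times>real, z::real\<times>real). ennreal (fst y) * f (snd y + snd z)"
  have [measurable]: "fst \<in> borel_measurable (borel :: (real \<times> real) measure)"
    "snd \<in> borel_measurable (borel :: (real \<times> real) measure)"
    unfolding borel_prod[symmetric] by measurable
  have [measurable]: "?h \<in> borel_measurable (borel \<Otimes>\<^sub>M borel)"
    unfolding split_beta' by measurable
  have "(\<integral>\<^sup>+\<omega>. indicator A \<omega> * f (B (s + d) \<omega>) \<partial>M) = (\<integral>\<^sup>+\<omega>. ?h (Y \<omega>, \<Delta> \<omega>) \<partial>M)"
    by (intro nn_integral_cong) (auto simp: Y_def \<Delta>_def split: split_indicator)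
  also have "\<dots> = (\<integral>\<^sup>+p. ?h p \<partial>distr M (borel \<Otimes>\<^sub>M borel) (\<lambda>\<omega>. (Y \<omega>, \<Delta> \<omega>)))"
    by (subst nn_integral_distr) auto
  also have "\<dots> = (\<integral>\<^sup>+y. \<integral>\<^sup>+z. ?h (y, z) \<partial>distr M borel \<Delta> \<partial>distr M borel Y)"
    unfolding eq by (subst D.nn_integral_fst[symmetric]) auto
  also have "\<dots> = (\<integral>\<^sup>+y. \<integral>\<^sup>+\<omega>. ?h (y, \<Delta> \<omega>) \<partial>M \<partial>distr M borel Y)"
    by (subst nn_integral_distr) auto
  also have "\<dots> = (\<integral>\<^sup>+y. \<integral>\<^sup>+z. ?h (y, (0, z)) \<partial>gauss d \<partial>distr M borel Y)"
    unfolding increment_distr[OF s, symmetric] by (subst nn_integral_distr) (auto simp: \<Delta>_def)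
  also have "\<dots> = (\<integral>\<^sup>+\<omega>. (\<integral>\<^sup>+z. ?h (Y \<omega>, (0, z)) \<partial>gauss d) \<partial>M)"
    using prob_space_gauss[OF s(2)] by (subst nn_integral_distr) (auto intro!: measurable_gauss_int)
  also have "\<dots> = (\<integral>\<^sup>+\<omega>. indicator A \<omega> * (\<integral>\<^sup>+z. f (B s \<omega> + z) \<partial>gauss d) \<partial>M)"
    by (intro nn_integral_cong) (auto simp: Y_def split: split_indicator)
  finally show ?thesis .
qed

lemma markov:
  assumes s: "0 \<le> s" "d > 0" and A: "A \<in> sets (F s)"
    and f[measurable]: "f \<in> borel_measurable (borel :: real measure)"
  shows "(\<integral>\<^sup>+\<omega>. indicator A \<omega> * f (B (s + d) \<omega>) \<partial>M) =
         (\<integral>\<^sup>+\<omega>. indicator A \<omega> * (\<integral>\<^sup>+z. f (B s \<omega> + z) \<partial>gauss d) \<partial>M)"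
proof -
  obtain A' where A': "A' \<in> sets (raw_filtration M B s)" "AE \<omega> in M. \<omega> \<in> A \<longleftrightarrow> \<omega> \<in> A'"
    using F_equals_raw_AE[OF A] by auto
  have *: "(\<integral>\<^sup>+\<omega>. indicator A \<omega> * u \<omega> \<partial>M) = (\<integral>\<^sup>+\<omega>. indicator A' \<omega> * u \<omega> \<partial>M)" for u :: "'a \<Rightarrow> ennreal"
    by (rule nn_integral_cong_AE) (use A'(2) in \<open>auto simp: indicator_def elim!: eventually_mono\<close>)
  show ?thesis
    unfolding * by (rule markov_raw[OF s A'(1) f])
qed

text \<open>On the event that the player has not yet stopped, which is known at the current grid time, moving
  on by one step replaces \<open>m k\<close> by a kernel average of \<open>m (Suc k)\<close>, which is not larger.\<close>

lemma optional_stopping_grid: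
  fixes m :: "nat \<Rightarrow> real \<Rightarrow> ennreal"
  assumes \<epsilon>: "\<epsilon> > 0" and [measurable]: "\<And>k. m k \<in> borel_measurable borel"
    and super: "\<And>k b. k < N \<Longrightarrow> (\<integral>\<^sup>+z. m (Suc k) (b + z) \<partial>gauss \<epsilon>) \<le> m k b"
    and \<kappa>: "\<And>k. k < N \<Longrightarrow> {\<omega> \<in> space M. \<kappa> \<omega> \<le> k} \<in> sets (F (\<epsilon> * real k))"
    and le: "\<And>\<omega>. \<omega> \<in> space M \<Longrightarrow> \<kappa> \<omega> \<le> N"
  shows "(\<integral>\<^sup>+\<omega>. m (\<kappa> \<omega>) (B (\<epsilon> * real (\<kappa> \<omega>)) \<omega>) \<partial>M) \<le> m 0 0"
proof -
  have [measurable]: "B (\<epsilon> * real k) \<in> borel_measurable M" for k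
    using \<epsilon> by auto
  have \<kappa>M[measurable]: "{\<omega> \<in> space M. \<kappa> \<omega> \<le> k} \<in> sets M" for k
  proof (cases "k < N")
    case True then show ?thesis using \<kappa>[OF True] F_in_M by auto
  next
    case False then have "{\<omega> \<in> space M. \<kappa> \<omega> \<le> k} = space M" using le by force
    then show ?thesis by simp
  qed
  have [measurable]: "\<kappa> \<in> measurable M (count_space UNIV)"
  proof (rule measurable_count_space_eq2_countable[THEN iffD2], intro conjI ballI)
    show "\<kappa> -` {a} \<inter> space M \<in> sets M" for a
    proof (cases a)
      case 0
      then have "\<kappa> -` {a} \<inter> space M = {\<omega> \<in> space M. \<kappa> \<omega> \<le> 0}" by auto
      then show ?thesis using \<kappa>M[of 0] by simp
    next
      case (Suc n)
      then have "\<kappa> -` {a} \<inter> space M = {\<omega> \<in> space M. \<kappa> \<omega> \<le> Suc n} - {\<omega> \<in> space M. \<kappa> \<omega> \<le> n}" by auto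
      then show ?thesis by simp
    qed
  qed auto
  define I where "I j = (\<integral>\<^sup>+\<omega>. m (min (\<kappa> \<omega>) j) (B (\<epsilon> * real (min (\<kappa> \<omega>) j)) \<omega>) \<partial>M)" for j
  have step: "I (Suc j) \<le> I j" if j: "j < N" for j
  proof -
    define C where "C = {\<omega> \<in> space M. \<kappa> \<omega> \<le> j}"
    define E where "E = space M - C"
    have C: "C \<in> sets (F (\<epsilon> * real j))" unfolding C_def using \<kappa>[OF j] .
    have E: "E \<in> sets (F (\<epsilon> * real j))" unfolding E_def using sets.compl_sets[OF C] by simp
    have [measurable]: "C \<in> sets M" "E \<in> sets M" using C E F_in_M by auto
    define J where "J = (\<integral>\<^sup>+\<omega>. indicator C \<omega> * m (min (\<kappa> \<omega>) j) (B (\<epsilon> * real (min (\<kappa> \<omega>) j)) \<omega>) \<partial>M)"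
    have mm[measurable]: "(\<lambda>\<omega>. m (min (\<kappa> \<omega>) i) (B (\<epsilon> * real (min (\<kappa> \<omega>) i)) \<omega>)) \<in> borel_measurable M" for i
      by (rule measurable_compose_countable[where g="\<lambda>\<omega>. min (\<kappa> \<omega>) i"]) measurable
    have "I (Suc j) = (\<integral>\<^sup>+\<omega>. indicator C \<omega> * m (min (\<kappa> \<omega>) j) (B (\<epsilon> * real (min (\<kappa> \<omega>) j)) \<omega>)
        + indicator E \<omega> * m (Suc j) (B (\<epsilon> * real j + \<epsilon>) \<omega>) \<partial>M)"
      unfolding I_def
      by (intro nn_integral_cong) (auto simp: C_def E_def min_def algebra_simps le_Suc_eq split: split_indicator)
    also have "\<dots> = J + (\<integral>\<^sup>+\<omega>. indicator E \<omega> * m (Suc j) (B (\<epsilon> * real j + \<epsilon>) \<omega>) \<partial>M)"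
      unfolding J_def using \<epsilon> by (intro nn_integral_add) auto
    also have "(\<integral>\<^sup>+\<omega>. indicator E \<omega> * m (Suc j) (B (\<epsilon> * real j + \<epsilon>) \<omega>) \<partial>M) =
      (\<integral>\<^sup>+\<omega>. indicator E \<omega> * (\<integral>\<^sup>+z. m (Suc j) (B (\<epsilon> * real j) \<omega> + z) \<partial>gauss \<epsilon>) \<partial>M)"
      by (rule markov) (use \<epsilon> E in auto)
    also have "J + \<dots> \<le> J + (\<integral>\<^sup>+\<omega>. indicator E \<omega> * m j (B (\<epsilon> * real j) \<omega>) \<partial>M)"
      by (intro add_left_mono nn_integral_mono mult_left_mono super[OF j]) auto
    also have "\<dots> = (\<integral>\<^sup>+\<omega>. indicator C \<omega> * m (min (\<kappa> \<omega>) j) (B (\<epsilon> * real (min (\<kappa> \<omega>) j)) \<omega>)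
        + indicator E \<omega> * m j (B (\<epsilon> * real j) \<omega>) \<partial>M)"
      unfolding J_def by (intro nn_integral_add[symmetric]) auto
    also have "\<dots> = I j"
      unfolding I_def
      by (intro nn_integral_cong) (auto simp: C_def E_def min_def split: split_indicator)
    finally show ?thesis .
  qed
  have "I j \<le> I 0" if "j \<le> N" for j
    using that by (induction j) (auto intro: order_trans[OF step])
  moreover have "I N = (\<integral>\<^sup>+\<omega>. m (\<kappa> \<omega>) (B (\<epsilon> * real (\<kappa> \<omega>)) \<omega>) \<partial>M)"
    unfolding I_def using le by (intro nn_integral_cong) (auto simp: min_absorb1)
  moreover have "I 0 = m 0 0"
  proof -
    have "I 0 = (\<integral>\<^sup>+\<omega>. m 0 0 \<partial>M)"
      unfolding I_def by (intro nn_integral_cong_AE) (use B_zero in auto)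
    then show ?thesis by (simp add: emeasure_space_1)
  qed
  ultimately show ?thesis by (metis order_refl)
qed

end

section \<open>Optional stopping by discretisation\<close>

text \<open>Index of the grid time obtained by rounding up to a multiple of \<open>\<epsilon>\<close>. Rounding up, unlike
  rounding down, turns stopping times into stopping times.\<close>

definition ceil_grid :: "real \<Rightarrow> ('a \<Rightarrow> real) \<Rightarrow> 'a \<Rightarrow> nat" where
  "ceil_grid \<epsilon> \<tau> \<omega> = nat \<lceil>\<tau> \<omega> / \<epsilon>\<rceil>"

lemma ceil_grid_le_iff:
  assumes "\<epsilon> > 0"
  shows "ceil_grid \<epsilon> \<tau> \<omega> \<le> k \<longleftrightarrow> \<tau> \<omega> \<le> \<epsilon> * real k"
  unfolding ceil_grid_def nat_le_iff ceiling_le_iff using assms by (simp add: field_simps)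

lemma ceil_grid_bounds:
  assumes "\<epsilon> > 0" "0 \<le> \<tau> \<omega>"
  shows "\<tau> \<omega> \<le> \<epsilon> * real (ceil_grid \<epsilon> \<tau> \<omega>)" "\<epsilon> * real (ceil_grid \<epsilon> \<tau> \<omega>) \<le> \<tau> \<omega> + \<epsilon>"
proof -
  show "\<tau> \<omega> \<le> \<epsilon> * real (ceil_grid \<epsilon> \<tau> \<omega>)"
    using ceil_grid_le_iff[OF assms(1), of \<tau> \<omega> "ceil_grid \<epsilon> \<tau> \<omega>"] by simp
  have "real (ceil_grid \<epsilon> \<tau> \<omega>) = of_int \<lceil>\<tau> \<omega> / \<epsilon>\<rceil>"
    using assms by (simp add: ceil_grid_def)
  also have "\<dots> \<le> \<tau> \<omega> / \<epsilon> + 1" by linarith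
  finally show "\<epsilon> * real (ceil_grid \<epsilon> \<tau> \<omega>) \<le> \<tau> \<omega> + \<epsilon>"
    using assms by (simp add: field_simps)
qed

context brownian
begin

lemma stopping_timesD:
  assumes "\<tau> \<in> stopping_times_upto M B h"
  shows "stopping_time F \<tau>" "\<omega> \<in> space M \<Longrightarrow> 0 \<le> \<tau> \<omega>" "\<omega> \<in> space M \<Longrightarrow> \<tau> \<omega> \<le> h"
    "{\<omega> \<in> space M. \<tau> \<omega> \<le> s} \<in> sets (F s)"
  using assms stopping_timeD[of F \<tau> s] by (auto simp: stopping_times_upto_def pred_def)

lemma ceil_grid_F:
  assumes "\<tau> \<in> stopping_times_upto M B h" "\<epsilon> > 0"
  shows "{\<omega> \<in> space M. ceil_grid \<epsilon> \<tau> \<omega> \<le> k} \<in> sets (F (\<epsilon> * real k))"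
  unfolding ceil_grid_le_iff[OF assms(2)] by (rule stopping_timesD(4)[OF assms(1)])

lemma stopping_time_measurable[measurable_dest]:
  "\<tau> \<in> stopping_times_upto M B h \<Longrightarrow> \<tau> \<in> borel_measurable M"
  using measurable_stopping_time[OF stopping_timesD(1), of \<tau> h M] F_in_M by auto

lemma ceil_grid_tendsto:
  assumes \<tau>: "\<tau> \<in> stopping_times_upto M B h" and \<epsilon>: "\<And>n. \<epsilon> n > 0" "\<epsilon> \<longlonglongrightarrow> 0"
    and \<omega>: "\<omega> \<in> space M"
  shows "(\<lambda>n. \<epsilon> n * real (ceil_grid (\<epsilon> n) \<tau> \<omega>)) \<longlonglongrightarrow> \<tau> \<omega>"
proof (rule tendsto_sandwich[OF _ _ tendsto_const])
  show "(\<lambda>n. \<tau> \<omega> + \<epsilon> n) \<longlonglongrightarrow> \<tau> \<omega>"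
    using tendsto_add[OF tendsto_const \<epsilon>(2), of "\<tau> \<omega>"] by simp
qed (use ceil_grid_bounds[of "\<epsilon> _" \<tau> \<omega>] \<epsilon> stopping_timesD(2)[OF \<tau> \<omega>] in auto)

lemma B_ceil_grid_tendsto:
  assumes \<tau>: "\<tau> \<in> stopping_times_upto M B h" and \<epsilon>: "\<And>n. \<epsilon> n > 0" "\<epsilon> \<longlonglongrightarrow> 0"
  shows "AE \<omega> in M. (\<lambda>n. B (\<epsilon> n * real (ceil_grid (\<epsilon> n) \<tau> \<omega>)) \<omega>) \<longlonglongrightarrow> B (\<tau> \<omega>) \<omega>"
  using B_continuous AE_space
proof eventually_elim
  case (elim \<omega>)
  show ?case
  proof (rule continuous_on_tendsto_compose[OF elim(1) ceil_grid_tendsto[OF \<tau> \<epsilon> elim(2)]])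
    show "\<tau> \<omega> \<in> {0..}" using stopping_timesD(2)[OF \<tau> elim(2)] by simp
    show "\<forall>\<^sub>F n in sequentially. \<epsilon> n * real (ceil_grid (\<epsilon> n) \<tau> \<omega>) \<in> {0..}"
      using \<epsilon>(1) by (intro always_eventually allI) (simp add: less_imp_le)
  qed
qed

lemma ceil_grid_measurable[measurable]:
  assumes "\<tau> \<in> stopping_times_upto M B h"
  shows "ceil_grid \<epsilon> \<tau> \<in> measurable M (count_space UNIV)"
  using stopping_time_measurable[OF assms] unfolding ceil_grid_def[abs_def] by measurable

lemma grid_value_measurable:
  assumes "\<epsilon> > 0" and \<tau>: "\<tau> \<in> stopping_times_upto M B h"
    and g: "\<And>k. g k \<in> borel_measurable borel"
  shows "(\<lambda>\<omega>. g (ceil_grid \<epsilon> \<tau> \<omega>) (B (\<epsilon> * real (ceil_grid \<epsilon> \<tau> \<omega>)) \<omega>)) \<in> borel_measurable M"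
proof (rule measurable_compose_countable[where g="ceil_grid \<epsilon> \<tau>"])
  show "ceil_grid \<epsilon> \<tau> \<in> measurable M (count_space UNIV)"
    by (rule ceil_grid_measurable[OF \<tau>])
  show "(\<lambda>\<omega>. g k (B (\<epsilon> * real k) \<omega>)) \<in> borel_measurable M" for k
    using g[of k] B_measurable[of "\<epsilon> * real k"] assms(1)
    by (intro measurable_compose[OF _ g]) simp
qed

lemma measurable_of_AE_eq:
  fixes f g :: "'a \<Rightarrow> 'b::topological_space"
  assumes g: "g \<in> borel_measurable M" and eq: "AE \<omega> in M. g \<omega> = f \<omega>"
  shows "f \<in> borel_measurable M"
proof (rule measurableI)
  fix A :: "'b set" assume A: "A \<in> sets borel"
  show "f -` A \<inter> space M \<in> sets M"
  proof (rule in_sets_AE[OF _ measurable_sets[OF g A]])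
    show "AE x in M. (x \<in> g -` A \<inter> space M) = (x \<in> f -` A \<inter> space M)"
      using eq by eventually_elim auto
  qed auto
qed simp

text \<open>Paths are continuous only almost surely, so \<open>B\<close> at a stopping time is measurable because it is an
  almost sure limit of its values at the grid times and \<open>M\<close> is complete.\<close>

lemma B_stopped_measurable:
  assumes \<tau>: "\<tau> \<in> stopping_times_upto M B h"
  shows "(\<lambda>\<omega>. B (\<tau> \<omega>) \<omega>) \<in> borel_measurable M"
proof -
  define \<epsilon> :: "nat \<Rightarrow> real" where "\<epsilon> n = 1 / real (Suc n)" for n
  have \<epsilon>: "\<And>n. \<epsilon> n > 0" "\<epsilon> \<longlonglongrightarrow> 0"
    unfolding \<epsilon>_def by (simp, rule LIMSEQ_Suc[OF lim_1_over_n])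
  have m: "(\<lambda>\<omega>. B (\<epsilon> n * real (ceil_grid (\<epsilon> n) \<tau> \<omega>)) \<omega>) \<in> borel_measurable M" for n
    using grid_value_measurable[OF \<epsilon>(1) \<tau>, of "\<lambda>_ b. b"] by simp
  show ?thesis
  proof (rule measurable_of_AE_eq)
    show "(\<lambda>\<omega>. lim (\<lambda>n. B (\<epsilon> n * real (ceil_grid (\<epsilon> n) \<tau> \<omega>)) \<omega>)) \<in> borel_measurable M"
      using m by (rule borel_measurable_lim_metric)
    show "AE \<omega> in M. lim (\<lambda>n. B (\<epsilon> n * real (ceil_grid (\<epsilon> n) \<tau> \<omega>)) \<omega>) = B (\<tau> \<omega>) \<omega>"
      using B_ceil_grid_tendsto[OF \<tau> \<epsilon>] by eventually_elim (rule limI)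
  qed
qed

text \<open>The functions \<open>m n\<close> form a supermartingale on the \<open>n\<close>-th grid that dominates the payoff \<open>f\<close> there.
  The grid times approach the stopping time from the right, hence lower semicontinuity of \<open>f\<close> along such
  sequences is what Fatou's lemma requires.\<close>

lemma optional_stopping:
  fixes f :: "real \<Rightarrow> real \<Rightarrow> ennreal" and m :: "nat \<Rightarrow> nat \<Rightarrow> real \<Rightarrow> ennreal"
  assumes h: "h > 0" and \<tau>: "\<tau> \<in> stopping_times_upto M B h"
    and N: "\<And>n. N n > 0" "filterlim N at_top sequentially"
    and m[measurable]: "\<And>n k. m n k \<in> borel_measurable borel"
    and super: "\<And>n k b. k < N n \<Longrightarrow> (\<integral>\<^sup>+z. m n (Suc k) (b + z) \<partial>gauss (h / real (N n))) \<le> m n k b"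
    and dom: "\<And>n k b. k \<le> N n \<Longrightarrow> f (h / real (N n) * real k) b \<le> m n k b"
    and lsc: "\<And>s b S b'. 0 \<le> s \<Longrightarrow> (\<And>n. s \<le> S n \<and> S n \<le> h) \<Longrightarrow> S \<longlonglongrightarrow> s \<Longrightarrow> b' \<longlonglongrightarrow> b
        \<Longrightarrow> f s b \<le> liminf (\<lambda>n. f (S n) (b' n))"
  shows "(\<integral>\<^sup>+\<omega>. f (\<tau> \<omega>) (B (\<tau> \<omega>) \<omega>) \<partial>M) \<le> liminf (\<lambda>n. m n 0 0)"
proof -
  define \<epsilon> where "\<epsilon> n = h / real (N n)" for n
  have \<epsilon>0: "\<epsilon> n > 0" for n using N(1)[of n] h by (simp add: \<epsilon>_def)
  have \<epsilon>lim: "\<epsilon> \<longlonglongrightarrow> 0"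
    unfolding \<epsilon>_def
    by (rule tendsto_divide_0[OF tendsto_const filterlim_at_top_imp_at_infinity])
      (rule filterlim_compose[OF filterlim_real_sequentially N(2)])
  have \<epsilon>N: "\<epsilon> n * real (N n) = h" for n using N(1)[of n] by (simp add: \<epsilon>_def)
  define \<kappa> where "\<kappa> n = ceil_grid (\<epsilon> n) \<tau>" for n
  have \<kappa>N: "\<kappa> n \<omega> \<le> N n" if "\<omega> \<in> space M" for n \<omega>
    unfolding \<kappa>_def ceil_grid_le_iff[OF \<epsilon>0] \<epsilon>N by (rule stopping_timesD(3)[OF \<tau> that])
  have "(\<integral>\<^sup>+\<omega>. f (\<tau> \<omega>) (B (\<tau> \<omega>) \<omega>) \<partial>M) \<le>
    (\<integral>\<^sup>+\<omega>. liminf (\<lambda>n. m n (\<kappa> n \<omega>) (B (\<epsilon> n * real (\<kappa> n \<omega>)) \<omega>)) \<partial>M)"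
  proof (rule nn_integral_mono_AE)
    show "AE \<omega> in M. f (\<tau> \<omega>) (B (\<tau> \<omega>) \<omega>) \<le> liminf (\<lambda>n. m n (\<kappa> n \<omega>) (B (\<epsilon> n * real (\<kappa> n \<omega>)) \<omega>))"
      using B_ceil_grid_tendsto[OF \<tau> \<epsilon>0 \<epsilon>lim] AE_space
    proof eventually_elim
      case (elim \<omega>)
      have le: "\<epsilon> n * real (\<kappa> n \<omega>) \<le> h" for n
        using mult_left_mono[of "real (\<kappa> n \<omega>)" "real (N n)" "\<epsilon> n"] \<kappa>N[OF elim(2), of n] \<epsilon>0[of n]
        by (simp add: \<epsilon>N)
      have "f (\<tau> \<omega>) (B (\<tau> \<omega>) \<omega>) \<le> liminf (\<lambda>n. f (\<epsilon> n * real (\<kappa> n \<omega>)) (B (\<epsilon> n * real (\<kappa> n \<omega>)) \<omega>))"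
        unfolding \<kappa>_def
        by (rule lsc) (use stopping_timesD(2)[OF \<tau> elim(2)] ceil_grid_bounds(1)[OF \<epsilon>0, of \<tau> \<omega>] le
            ceil_grid_tendsto[OF \<tau> \<epsilon>0 \<epsilon>lim elim(2)] elim(1) in \<open>auto simp: \<kappa>_def\<close>)
      also have "\<dots> \<le> liminf (\<lambda>n. m n (\<kappa> n \<omega>) (B (\<epsilon> n * real (\<kappa> n \<omega>)) \<omega>))"
        by (rule Liminf_mono, rule always_eventually) (use dom[OF \<kappa>N[OF elim(2)]] in \<open>auto simp: \<epsilon>_def\<close>)
      finally show ?case .
    qed
  qed
  also have "\<dots> \<le> liminf (\<lambda>n. \<integral>\<^sup>+\<omega>. m n (\<kappa> n \<omega>) (B (\<epsilon> n * real (\<kappa> n \<omega>)) \<omega>) \<partial>M)"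
    unfolding \<kappa>_def by (intro nn_integral_liminf grid_value_measurable[OF \<epsilon>0 \<tau>] m)
  also have "\<dots> \<le> liminf (\<lambda>n. m n 0 0)"
  proof (rule Liminf_mono, rule always_eventually, rule allI)
    fix n
    show "(\<integral>\<^sup>+\<omega>. m n (\<kappa> n \<omega>) (B (\<epsilon> n * real (\<kappa> n \<omega>)) \<omega>) \<partial>M) \<le> m n 0 0"
    proof (rule optional_stopping_grid[OF \<epsilon>0 m])
      show "(\<integral>\<^sup>+z. m n (Suc k) (b + z) \<partial>gauss (\<epsilon> n)) \<le> m n k b" if "k < N n" for k b
        using super[OF that] by (simp add: \<epsilon>_def)
      show "{\<omega> \<in> space M. \<kappa> n \<omega> \<le> k} \<in> sets (F (\<epsilon> n * real k))" for k
        unfolding \<kappa>_def by (rule ceil_grid_F[OF \<tau> \<epsilon>0])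
    qed (rule \<kappa>N)
  qed
  finally show ?thesis .
qed

end

section \<open>The American put\<close>

locale market = brownian +
  fixes r \<sigma> K :: real
  assumes r: "r > 0" and \<sigma>: "\<sigma> > 0" and K: "K > 0"
begin

definition S :: "real \<Rightarrow> real \<Rightarrow> real \<Rightarrow> real" where
  "S x s b = x * exp (\<sigma> * b + (r - \<sigma>\<^sup>2 / 2) * s)"

lemma gbm_S: "gbm B r \<sigma> x s \<omega> = S x s (B s \<omega>)"
  by (simp add: gbm_def S_def)

lemma S_pos: "x > 0 \<Longrightarrow> S x s b > 0"
  by (simp add: S_def)

lemma S_add: "S x (s + d) (b + z) = S (S x s b) d z"
  by (simp add: S_def exp_add[symmetric] algebra_simps)

lemma S_commute: "S (S x s b) d z = S (S x d z) s b"
  by (simp add: S_def mult_ac)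

lemma S_zero[simp]: "S x 0 0 = x"
  by (simp add: S_def)

lemma S_measurable[measurable (raw)]:
  assumes [measurable]: "f \<in> borel_measurable N" "g \<in> borel_measurable N" "u \<in> borel_measurable N"
  shows "(\<lambda>x. S (f x) (g x) (u x)) \<in> borel_measurable N"
  unfolding S_def by measurable

lemma tendsto_S[tendsto_intros]:
  assumes "(f \<longlongrightarrow> x) A" "(g \<longlongrightarrow> s) A" "(u \<longlongrightarrow> b) A"
  shows "((\<lambda>n. S (f n) (g n) (u n)) \<longlongrightarrow> S x s b) A"
  unfolding S_def by (intro tendsto_intros assms)

definition payoff :: "real \<Rightarrow> real" where "payoff x = max 0 (K - x)"

lemma payoff_bounds: "0 \<le> payoff x" "x \<ge> 0 \<Longrightarrow> payoff x \<le> K"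
  using K by (auto simp: payoff_def)

lemma payoff_measurable[measurable]: "payoff \<in> borel_measurable borel"
  unfolding payoff_def[abs_def] by measurable

lemma tendsto_payoff[tendsto_intros]: "(f \<longlongrightarrow> x) A \<Longrightarrow> ((\<lambda>n. payoff (f n)) \<longlongrightarrow> payoff x) A"
  unfolding payoff_def by (intro tendsto_intros)

definition reward :: "real \<Rightarrow> ('a \<Rightarrow> real) \<Rightarrow> 'a \<Rightarrow> real" where
  "reward x \<tau> \<omega> = exp (- r * \<tau> \<omega>) * payoff (S x (\<tau> \<omega>) (B (\<tau> \<omega>) \<omega>))"

definition put_value :: "real \<Rightarrow> real \<Rightarrow> real" where
  "put_value h x = (SUP \<tau>\<in>stopping_times_upto M B h. \<integral>\<omega>. reward x \<tau> \<omega> \<partial>M)"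

lemma V1_put_value: "V1 M B r \<sigma> K T t x = put_value (T - t) x"
  by (simp add: V1_def put_value_def reward_def payoff_def gbm_S)

lemma reward_nonneg: "0 \<le> reward x \<tau> \<omega>"
  by (simp add: reward_def payoff_bounds)

lemma reward_le:
  assumes "\<tau> \<in> stopping_times_upto M B h" "\<omega> \<in> space M" "x > 0"
  shows "reward x \<tau> \<omega> \<le> K"
proof -
  have "exp (- r * \<tau> \<omega>) \<le> 1" using stopping_timesD(2)[OF assms(1,2)] r by simp
  moreover have "payoff (S x (\<tau> \<omega>) (B (\<tau> \<omega>) \<omega>)) \<le> K"
    using S_pos[OF assms(3)] by (simp add: payoff_bounds less_imp_le)
  ultimately have "reward x \<tau> \<omega> \<le> 1 * K"
    unfolding reward_def by (intro mult_mono) (auto simp: payoff_bounds)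
  then show ?thesis by simp
qed

lemma reward_measurable:
  assumes "\<tau> \<in> stopping_times_upto M B h"
  shows "reward x \<tau> \<in> borel_measurable M"
proof -
  note [measurable] = B_stopped_measurable[OF assms] stopping_time_measurable[OF assms]
  show ?thesis unfolding reward_def[abs_def] by measurable
qed

lemma reward_integrable:
  assumes "\<tau> \<in> stopping_times_upto M B h" "x > 0"
  shows "integrable M (reward x \<tau>)"
  by (rule integrable_const_bound[of _ K])
    (use reward_measurable[OF assms(1)] reward_le[OF assms(1) _ assms(2)] reward_nonneg in auto)

lemma nn_integral_reward:
  assumes "\<tau> \<in> stopping_times_upto M B h" "x > 0"
  shows "(\<integral>\<^sup>+\<omega>. ennreal (reward x \<tau> \<omega>) \<partial>M) = ennreal (\<integral>\<omega>. reward x \<tau> \<omega> \<partial>M)"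
  by (rule nn_integral_eq_integral[OF reward_integrable[OF assms]]) (simp add: reward_nonneg)

lemma integral_reward_bounds:
  assumes "\<tau> \<in> stopping_times_upto M B h" "x > 0"
  shows "0 \<le> (\<integral>\<omega>. reward x \<tau> \<omega> \<partial>M)" "(\<integral>\<omega>. reward x \<tau> \<omega> \<partial>M) \<le> K"
proof -
  show "0 \<le> (\<integral>\<omega>. reward x \<tau> \<omega> \<partial>M)" by (simp add: reward_nonneg)
  have "(\<integral>\<omega>. reward x \<tau> \<omega> \<partial>M) \<le> (\<integral>\<omega>. K \<partial>M)"
    by (rule integral_mono) (use reward_integrable[OF assms] reward_le[OF assms(1) _ assms(2)] in auto)
  then show "(\<integral>\<omega>. reward x \<tau> \<omega> \<partial>M) \<le> K" by (simp add: prob_space)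
qed

lemma zero_stopping: "h \<ge> 0 \<Longrightarrow> (\<lambda>_. 0) \<in> stopping_times_upto M B h"
  by (simp add: stopping_times_upto_def stopping_time_const)

lemma integral_reward_zero: "(\<integral>\<omega>. reward x (\<lambda>_. 0) \<omega> \<partial>M) = payoff x"
proof -
  have [measurable]: "B 0 \<in> borel_measurable M" by simp
  have "(\<integral>\<omega>. reward x (\<lambda>_. 0) \<omega> \<partial>M) = (\<integral>\<omega>. payoff x \<partial>M)"
    by (rule integral_cong_AE) (use B_zero in \<open>auto simp: reward_def[abs_def]\<close>)
  then show ?thesis by (simp add: prob_space)
qed

lemma reward_bdd_above: "x > 0 \<Longrightarrow> bdd_above ((\<lambda>\<tau>. \<integral>\<omega>. reward x \<tau> \<omega> \<partial>M) ` stopping_times_upto M B h)"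
  by (rule bdd_aboveI2[of _ _ K]) (rule integral_reward_bounds)

lemma put_value_upper:
  assumes "\<tau> \<in> stopping_times_upto M B h" "x > 0"
  shows "(\<integral>\<omega>. reward x \<tau> \<omega> \<partial>M) \<le> put_value h x"
  unfolding put_value_def by (rule cSUP_upper[OF assms(1) reward_bdd_above[OF assms(2)]])

lemma put_value_bounds:
  assumes "h \<ge> 0" "x > 0"
  shows "payoff x \<le> put_value h x" "put_value h x \<le> K" "0 \<le> put_value h x"
proof -
  show 1: "payoff x \<le> put_value h x"
    using put_value_upper[OF zero_stopping[OF assms(1)] assms(2)] by (simp add: integral_reward_zero)
  show "put_value h x \<le> K" unfolding put_value_def
    by (rule cSUP_least) (use zero_stopping[OF assms(1)] integral_reward_bounds assms in auto)
  show "0 \<le> put_value h x" using 1 payoff_bounds(1)[of x] by simp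
qed

text \<open>Monotonicity in the price is the source of measurability of the value function, which as a
  supremum over an uncountable family would not be measurable for free.\<close>

lemma put_value_antimono:
  assumes "h \<ge> 0" "0 < x" "x \<le> y"
  shows "put_value h y \<le> put_value h x"
  unfolding put_value_def
proof (rule cSUP_mono[OF _ reward_bdd_above[OF assms(2)]])
  fix \<tau> assume \<tau>: "\<tau> \<in> stopping_times_upto M B h"
  have "payoff (S y s b) \<le> payoff (S x s b)" for s b
  proof -
    have "S x s b \<le> S y s b" unfolding S_def using assms by (intro mult_right_mono) auto
    then show ?thesis by (auto simp: payoff_def)
  qed
  then have "reward y \<tau> \<omega> \<le> reward x \<tau> \<omega>" for \<omega>
    unfolding reward_def by (intro mult_left_mono) auto
  then have "(\<integral>\<omega>. reward y \<tau> \<omega> \<partial>M) \<le> (\<integral>\<omega>. reward x \<tau> \<omega> \<partial>M)"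
    using assms by (intro integral_mono reward_integrable[OF \<tau>]) auto
  with \<tau> show "\<exists>m\<in>stopping_times_upto M B h. (\<integral>\<omega>. reward y \<tau> \<omega> \<partial>M) \<le> (\<integral>\<omega>. reward x m \<omega> \<partial>M)"
    by auto
qed (use zero_stopping[OF assms(1)] in auto)

lemma put_value_measurable:
  assumes "h \<ge> 0"
  shows "put_value h \<in> borel_measurable (restrict_space borel {0<..})"
proof -
  have "(\<lambda>x. - put_value h x) \<in> borel_measurable (restrict_space borel {0<..})"
    by (rule borel_measurable_mono_on_fnc) (use put_value_antimono[OF assms] in \<open>auto simp: mono_on_def\<close>)
  then show ?thesis by simp
qed

lemma put_value_S_measurable[measurable (raw)]:
  assumes "h \<ge> 0" "x > 0" and [measurable]: "f \<in> borel_measurable N" "g \<in> borel_measurable N"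
  shows "(\<lambda>z. put_value h (S x (f z) (g z))) \<in> borel_measurable N"
  by (rule measurable_compose[OF _ put_value_measurable[OF assms(1)]])
    (auto simp: measurable_restrict_space2_iff S_pos assms(2))

text \<open>The value is a supremum of expected rewards, and for one strategy, cut off at the shorter horizon,
  the expected reward depends continuously on the horizon and the price.\<close>

lemma put_value_lsc:
  assumes x: "x > 0" "\<And>n. xs n > 0" "xs \<longlonglongrightarrow> x"
    and h: "\<And>n. 0 \<le> hs n \<and> hs n \<le> h" "hs \<longlonglongrightarrow> h"
  shows "ennreal (put_value h x) \<le> liminf (\<lambda>n. ennreal (put_value (hs n) (xs n)))"
  unfolding put_value_def[of h x]
proof (rule ennreal_cSUP_le)
  have "h \<ge> 0" using h(1)[of 0] by simp
  then show "stopping_times_upto M B h \<noteq> {}" using zero_stopping by blast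
  fix \<tau> assume \<tau>: "\<tau> \<in> stopping_times_upto M B h"
  show "0 \<le> (\<integral>\<omega>. reward x \<tau> \<omega> \<partial>M)" by (simp add: reward_nonneg)
  define \<rho> where "\<rho> n \<omega> = min (\<tau> \<omega>) (hs n)" for n \<omega>
  have \<rho>: "\<rho> n \<in> stopping_times_upto M B (hs n)" for n
    using \<tau> h(1)[of n] unfolding \<rho>_def stopping_times_upto_def
    by (auto intro: stopping_time_min stopping_time_const)
  have "(\<lambda>n. \<integral>\<omega>. reward (xs n) (\<rho> n) \<omega> \<partial>M) \<longlonglongrightarrow> (\<integral>\<omega>. reward x \<tau> \<omega> \<partial>M)"
  proof (rule integral_dominated_convergence[where w="\<lambda>_. K"])
    show "AE \<omega> in M. (\<lambda>n. reward (xs n) (\<rho> n) \<omega>) \<longlonglongrightarrow> reward x \<tau> \<omega>"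
      using B_continuous AE_space
    proof eventually_elim
      case (elim \<omega>)
      have "(\<lambda>n. \<rho> n \<omega>) \<longlonglongrightarrow> min (\<tau> \<omega>) h"
        unfolding \<rho>_def by (intro tendsto_intros h)
      then have lim: "(\<lambda>n. \<rho> n \<omega>) \<longlonglongrightarrow> \<tau> \<omega>"
        using stopping_timesD(3)[OF \<tau> elim(2)] by (simp add: min_absorb1)
      have "(\<lambda>n. B (\<rho> n \<omega>) \<omega>) \<longlonglongrightarrow> B (\<tau> \<omega>) \<omega>"
        by (rule continuous_on_tendsto_compose[OF elim(1) lim])
          (use stopping_timesD(2)[OF \<tau> elim(2)] stopping_timesD(2)[OF \<rho> elim(2)] in auto)
      then show ?case unfolding reward_def by (intro tendsto_intros lim x)
    qed
  qed (use reward_measurable[OF \<tau>] reward_measurable[OF \<rho>] reward_le[OF \<rho> _ x(2)] reward_nonneg in auto)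
  then have "(\<lambda>n. ennreal (\<integral>\<omega>. reward (xs n) (\<rho> n) \<omega> \<partial>M)) \<longlonglongrightarrow> ennreal (\<integral>\<omega>. reward x \<tau> \<omega> \<partial>M)"
    by (intro tendsto_ennrealI)
  then have "ennreal (\<integral>\<omega>. reward x \<tau> \<omega> \<partial>M) = liminf (\<lambda>n. ennreal (\<integral>\<omega>. reward (xs n) (\<rho> n) \<omega> \<partial>M))"
    by (metis lim_imp_Liminf trivial_limit_sequentially)
  also have "\<dots> \<le> liminf (\<lambda>n. ennreal (put_value (hs n) (xs n)))"
    by (rule Liminf_mono, rule always_eventually) (use put_value_upper[OF \<rho> x(2)] in \<open>auto intro: ennreal_leI\<close>)
  finally show "ennreal (\<integral>\<omega>. reward x \<tau> \<omega> \<partial>M) \<le> liminf (\<lambda>n. ennreal (put_value (hs n) (xs n)))" .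
qed

text \<open>Optional stopping for the put, in terms of functions of the price.\<close>

lemma put_value_le_liminf:
  assumes h: "h > 0" and x: "x > 0" and u[measurable]: "\<And>n k. u n k \<in> borel_measurable borel"
    and super: "\<And>n k y. k \<le> n \<Longrightarrow> y > 0 \<Longrightarrow>
      (\<integral>\<^sup>+z. u n (Suc k) (S y (h / real (Suc n)) z) \<partial>gauss (h / real (Suc n))) \<le> u n k y"
    and dom: "\<And>n k y. k \<le> Suc n \<Longrightarrow> y > 0 \<Longrightarrow>
      ennreal (exp (- r * (h / real (Suc n) * real k)) * payoff y) \<le> u n k y"
  shows "ennreal (put_value h x) \<le> liminf (\<lambda>n. u n 0 x)"
  unfolding put_value_def
proof (rule ennreal_cSUP_le)
  show "stopping_times_upto M B h \<noteq> {}" using zero_stopping[of h] h by auto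
  fix \<tau> assume \<tau>: "\<tau> \<in> stopping_times_upto M B h"
  show "0 \<le> (\<integral>\<omega>. reward x \<tau> \<omega> \<partial>M)" by (simp add: reward_nonneg)
  define f where "f s b = ennreal (exp (- r * s) * payoff (S x s b))" for s b
  define m where "m n k b = u n k (S x (h / real (Suc n) * real k) b)" for n k b
  have "ennreal (\<integral>\<omega>. reward x \<tau> \<omega> \<partial>M) = (\<integral>\<^sup>+\<omega>. f (\<tau> \<omega>) (B (\<tau> \<omega>) \<omega>) \<partial>M)"
    unfolding nn_integral_reward[OF \<tau> x, symmetric] by (simp add: f_def reward_def)
  also have "\<dots> \<le> liminf (\<lambda>n. m n 0 0)"
  proof (rule optional_stopping[OF h \<tau>, of Suc])
    show "filterlim Suc at_top sequentially" by (rule filterlim_Suc)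
    show "m n k \<in> borel_measurable borel" for n k unfolding m_def[abs_def] by measurable
    show "(\<integral>\<^sup>+z. m n (Suc k) (b + z) \<partial>gauss (h / real (Suc n))) \<le> m n k b" if "k < Suc n" for n k b
      using super[of k n "S x (h / real (Suc n) * real k) b"] that S_pos[OF x]
      by (simp add: m_def S_add[symmetric] distrib_left add.commute)
    show "f (h / real (Suc n) * real k) b \<le> m n k b" if "k \<le> Suc n" for n k b
      unfolding f_def m_def by (rule dom[OF that S_pos[OF x]])
    fix s b :: real and Sq b' :: "nat \<Rightarrow> real" assume lim: "Sq \<longlonglongrightarrow> s" "b' \<longlonglongrightarrow> b"
    have "(\<lambda>n. f (Sq n) (b' n)) \<longlonglongrightarrow> f s b"
      unfolding f_def by (intro tendsto_ennrealI tendsto_intros lim)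
    then show "f s b \<le> liminf (\<lambda>n. f (Sq n) (b' n))"
      by (metis lim_imp_Liminf trivial_limit_sequentially order_refl)
  qed simp
  also have "\<dots> = liminf (\<lambda>n. u n 0 x)" by (simp add: m_def)
  finally show "ennreal (\<integral>\<omega>. reward x \<tau> \<omega> \<partial>M) \<le> liminf (\<lambda>n. u n 0 x)" .
qed

text \<open>The exponent for which \<open>exp (- r * s) * X s powr (- \<gamma>)\<close> is a martingale, where \<open>X\<close> is the price.\<close>

definition \<gamma> :: real where "\<gamma> = 2 * r / \<sigma>\<^sup>2"

lemma \<gamma>: "\<gamma> > 0" using r \<sigma> by (simp add: \<gamma>_def)

text \<open>The payoff \<open>K - x\<close> plus the difference between the convex function \<open>y / \<gamma> * (y / x) powr \<gamma>\<close> of \<open>x\<close> and its tangent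
  at \<open>y\<close>. It equals \<open>K - y\<close> at \<open>y\<close>. After discounting it is a multiple of the martingale
  \<open>exp (- r * s) * X s powr (- \<gamma>)\<close> plus a discounted constant, and hence a supermartingale if
  that constant is nonnegative, which means that \<open>y\<close> does not exceed the exercise boundary of the
  perpetual put.\<close>

definition tangent :: "real \<Rightarrow> real \<Rightarrow> real" where
  "tangent y x = (K - (1 + 1 / \<gamma>) * y) + y / \<gamma> * (y / x) powr \<gamma>"

lemma tangent_measurable[measurable]: "tangent y \<in> borel_measurable borel"
  unfolding tangent_def[abs_def] by measurable

lemma payoff_le_tangent:
  assumes "x > 0" "y > 0" "(1 + 1 / \<gamma>) * y \<le> K"
  shows "payoff x \<le> tangent y x"
proof -
  have "0 \<le> y / \<gamma> * (y / x) powr \<gamma>" using assms \<gamma> by simp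
  moreover have "K - x \<le> tangent y x"
  proof -
    \<comment> \<open>the convex map x powr (- \<gamma>) lies above its tangent at y\<close>
    have "1 - x / y \<le> ln (y / x)"
      using ln_le_minus_one[of "x / y"] assms by (simp add: ln_div)
    then have "1 + \<gamma> * (1 - x / y) \<le> 1 + \<gamma> * ln (y / x)"
      using \<gamma> by simp
    also have "\<dots> \<le> exp (\<gamma> * ln (y / x))" by (rule exp_ge_add_one_self)
    also have "\<dots> = (y / x) powr \<gamma>" using assms by (simp add: powr_def)
    finally have "y / \<gamma> * (1 + \<gamma> * (1 - x / y)) \<le> y / \<gamma> * (y / x) powr \<gamma>"
      using assms \<gamma> by (intro mult_left_mono) auto
    moreover have "y / \<gamma> * (1 + \<gamma> * (1 - x / y)) = y / \<gamma> + y - x"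
      using assms \<gamma> by (simp add: field_simps)
    ultimately show ?thesis unfolding tangent_def by (simp add: algebra_simps)
  qed
  ultimately show ?thesis using assms by (auto simp: payoff_def tangent_def)
qed

lemma tangent_kernel:
  assumes "x > 0" "y > 0" "(1 + 1 / \<gamma>) * y \<le> K" "d > 0"
  shows "(\<integral>\<^sup>+z. ennreal (exp (- r * d) * tangent y (S x d z)) \<partial>gauss d) =
    ennreal (exp (- r * d) * (K - (1 + 1 / \<gamma>) * y) + y / \<gamma> * (y / x) powr \<gamma>)"
proof -
  define c where "c = exp (- r * d) * (K - (1 + 1 / \<gamma>) * y)"
  define a where "a = exp (- r * d) * (y / \<gamma> * (y / x) powr \<gamma> * exp (- \<gamma> * (r - \<sigma>\<^sup>2 / 2) * d))"
  have c: "c \<ge> 0" using assms by (simp add: c_def)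
  have a: "a \<ge> 0" using assms \<gamma> by (simp add: a_def)
  interpret g: prob_space "gauss d" by (rule prob_space_gauss) fact
  have "exp (- r * d) * tangent y (S x d z) = c + a * exp ((- \<gamma> * \<sigma>) * z)" for z
  proof -
    have "(y / S x d z) powr \<gamma> = (y / x) powr \<gamma> * exp (- \<gamma> * (r - \<sigma>\<^sup>2 / 2) * d) * exp ((- \<gamma> * \<sigma>) * z)"
      using assms by (simp add: S_def powr_def ln_div ln_mult exp_add[symmetric] algebra_simps)
    then show ?thesis by (simp add: tangent_def c_def a_def algebra_simps)
  qed
  then have "(\<integral>\<^sup>+z. ennreal (exp (- r * d) * tangent y (S x d z)) \<partial>gauss d) =
      (\<integral>\<^sup>+z. ennreal c + ennreal a * ennreal (exp ((- \<gamma> * \<sigma>) * z)) \<partial>gauss d)"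
    using a c by (simp add: ennreal_plus ennreal_mult)
  also have "\<dots> = ennreal c + ennreal a * ennreal (exp ((- \<gamma> * \<sigma>)\<^sup>2 * d / 2))"
    unfolding nn_integral_exp_gauss[OF assms(4), symmetric]
    by (subst nn_integral_add) (auto simp: nn_integral_cmult g.emeasure_space_1[simplified])
  also have "\<dots> = ennreal (c + a * exp ((- \<gamma> * \<sigma>)\<^sup>2 * d / 2))"
    using a c by (simp add: ennreal_plus ennreal_mult)
  also have "a * exp ((- \<gamma> * \<sigma>)\<^sup>2 * d / 2) = y / \<gamma> * (y / x) powr \<gamma>"
  proof -
    have "- r * d + - \<gamma> * (r - \<sigma>\<^sup>2 / 2) * d + (- \<gamma> * \<sigma>)\<^sup>2 * d / 2 = 0"
      unfolding \<gamma>_def using \<sigma> by (simp add: field_simps power2_eq_square)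
    then have "exp (- r * d) * exp (- \<gamma> * (r - \<sigma>\<^sup>2 / 2) * d) * exp ((- \<gamma> * \<sigma>)\<^sup>2 * d / 2) = 1"
      unfolding exp_add[symmetric] by simp
    moreover have "a * exp ((- \<gamma> * \<sigma>)\<^sup>2 * d / 2) = (y / \<gamma> * (y / x) powr \<gamma>) *
        (exp (- r * d) * exp (- \<gamma> * (r - \<sigma>\<^sup>2 / 2) * d) * exp ((- \<gamma> * \<sigma>)\<^sup>2 * d / 2))"
      unfolding a_def by (simp only: mult_ac)
    ultimately show ?thesis by simp
  qed
  finally show ?thesis by (simp add: c_def)
qed

lemma put_value_zero:
  assumes "x > 0" shows "put_value 0 x = payoff x"
proof (rule antisym)
  show "payoff x \<le> put_value 0 x" by (rule put_value_bounds(1)) (use assms in auto)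
  show "put_value 0 x \<le> payoff x"
    unfolding put_value_def
  proof (rule cSUP_least)
    fix \<tau> assume \<tau>: "\<tau> \<in> stopping_times_upto M B 0"
    have "\<tau> \<omega> = 0" if "\<omega> \<in> space M" for \<omega>
      using stopping_timesD(2,3)[OF \<tau> that] by simp
    then have "(\<integral>\<omega>. reward x \<tau> \<omega> \<partial>M) = (\<integral>\<omega>. reward x (\<lambda>_. 0) \<omega> \<partial>M)"
      by (intro Bochner_Integration.integral_cong) (auto simp: reward_def)
    then show "(\<integral>\<omega>. reward x \<tau> \<omega> \<partial>M) \<le> payoff x" by (simp add: integral_reward_zero)
  qed (use zero_stopping[of 0] in auto)
qed

lemma borel_measurable_tangent_S:
  "(\<lambda>w. ennreal (c * tangent y (S z d w))) \<in> borel_measurable (gauss e)"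
  by measurable

text \<open>The tangent dominates the payoff and its discounted values form a supermartingale, so no strategy
  can earn more.\<close>

lemma put_value_le_tangent:
  assumes h: "h \<ge> 0" and x: "x > 0" and y: "y > 0" "(1 + 1 / \<gamma>) * y \<le> K"
  shows "put_value h x \<le> tangent y x"
proof (cases "h = 0")
  case True
  then show ?thesis using put_value_zero[OF x] payoff_le_tangent[OF x y] by simp
next
  case False
  define u where "u n k x = ennreal (exp (- r * (h / real (Suc n) * real k)) * tangent y x)" for n k :: nat and x
  have "0 \<le> tangent y x"
    using payoff_le_tangent[OF x y] payoff_bounds(1)[of x] by simp
  moreover have "ennreal (put_value h x) \<le> liminf (\<lambda>n. u n 0 x)"
  proof (rule put_value_le_liminf[OF _ x])
    show "h > 0" using h False by simp
    show "u n k \<in> borel_measurable borel" for n k unfolding u_def[abs_def] by measurable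
    show "ennreal (exp (- r * (h / real (Suc n) * real k)) * payoff z) \<le> u n k z" if "z > 0" for n k z
      unfolding u_def by (intro ennreal_leI mult_left_mono payoff_le_tangent that y) auto
    fix n k :: nat and z :: real assume z: "z > 0"
    let ?d = "h / real (Suc n)"
    have d: "?d > 0" using h False by simp
    have "u n (Suc k) w = ennreal (exp (- r * (?d * real k))) * ennreal (exp (- r * ?d) * tangent y w)" for w
    proof -
      have "exp (- r * (e * real (Suc k))) = exp (- r * (e * real k)) * exp (- r * e)" for e
        unfolding exp_add[symmetric] by (simp add: algebra_simps)
      from this[of ?d] show ?thesis
        unfolding u_def by (simp only: ennreal_mult'[OF exp_ge_zero, symmetric] mult.assoc)
    qed
    then have "(\<integral>\<^sup>+w. u n (Suc k) (S z ?d w) \<partial>gauss ?d) =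
       ennreal (exp (- r * (?d * real k))) * (\<integral>\<^sup>+w. ennreal (exp (- r * ?d) * tangent y (S z ?d w)) \<partial>gauss ?d)"
      by (simp only: nn_integral_cmult[OF borel_measurable_tangent_S])
    also have "(\<integral>\<^sup>+w. ennreal (exp (- r * ?d) * tangent y (S z ?d w)) \<partial>gauss ?d) =
      ennreal (exp (- r * ?d) * (K - (1 + 1 / \<gamma>) * y) + y / \<gamma> * (y / z) powr \<gamma>)"
      by (rule tangent_kernel[OF z y d])
    also have "\<dots> \<le> ennreal (tangent y z)"
    proof (rule ennreal_leI)
      have "exp (- r * ?d) \<le> 1" using mult_pos_pos[OF r d] by simp
      then have "exp (- r * ?d) * (K - (1 + 1 / \<gamma>) * y) \<le> 1 * (K - (1 + 1 / \<gamma>) * y)"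
        by (rule mult_right_mono) (use y in simp)
      then show "exp (- r * ?d) * (K - (1 + 1 / \<gamma>) * y) + y / \<gamma> * (y / z) powr \<gamma> \<le> tangent y z"
        by (simp add: tangent_def)
    qed
    also have "ennreal (exp (- r * (?d * real k))) * ennreal (tangent y z) = u n k z"
      unfolding u_def by (simp add: ennreal_mult'[symmetric])
    finally show "(\<integral>\<^sup>+w. u n (Suc k) (S z ?d w) \<partial>gauss ?d) \<le> u n k z"
      by (simp add: mult_left_mono)
  qed
  ultimately show ?thesis by (simp add: u_def Liminf_const)
qed

end

section \<open>Bermudan approximation and dynamic programming\<close>

context market
begin

text \<open>The value of a put that can be exercised now and after each of the waiting times in the list.\<close>

primrec bermudan :: "real list \<Rightarrow> real \<Rightarrow> ennreal" where
  "bermudan [] x = ennreal (payoff x)"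
| "bermudan (d # ds) x =
    max (ennreal (payoff x)) (ennreal (exp (- r * d)) * (\<integral>\<^sup>+z. bermudan ds (S x d z) \<partial>gauss d))"

declare bermudan.simps(2)[simp del]

lemma bermudan_measurable[measurable]: "bermudan ds \<in> borel_measurable borel"
proof (induction ds)
  case Nil
  show ?case unfolding bermudan.simps(1)[abs_def] by measurable
next
  case (Cons d ds)
  note [measurable] = Cons
  show ?case unfolding bermudan.simps(2)[abs_def] by measurable
qed

lemma payoff_le_bermudan: "ennreal (payoff x) \<le> bermudan ds x"
  by (cases ds) (auto simp: bermudan.simps(2))

lemma put_value_le_liminf_bermudan:
  assumes h: "h \<ge> 0"
  obtains L where "\<And>n d. d \<in> set (L n) \<Longrightarrow> d > 0" "\<And>n. sum_list (L n) = h"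
    "\<And>x. x > 0 \<Longrightarrow> ennreal (put_value h x) \<le> liminf (\<lambda>n. bermudan (L n) x)"
proof (cases "h = 0")
  case True
  have "ennreal (put_value h x) \<le> liminf (\<lambda>n. bermudan [] x)" if "x > 0" for x
    using put_value_zero[OF that] by (simp add: True Liminf_const)
  then show ?thesis using True by (intro that[of "\<lambda>_. []"]) auto
next
  case False
  define L where "L n = replicate (Suc n) (h / real (Suc n))" for n
  have "ennreal (put_value h x) \<le> liminf (\<lambda>n. bermudan (L n) x)" if x: "x > 0" for x
  proof -
    define u where "u n k x = ennreal (exp (- r * (h / real (Suc n) * real k))) *
      bermudan (replicate (Suc n - k) (h / real (Suc n))) x" for n k :: nat and x
    have "ennreal (put_value h x) \<le> liminf (\<lambda>n. u n 0 x)"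
    proof (rule put_value_le_liminf[OF _ x])
      show "h > 0" using h False by simp
      show "u n k \<in> borel_measurable borel" for n k unfolding u_def[abs_def] by measurable
      show "ennreal (exp (- r * (h / real (Suc n) * real k)) * payoff z) \<le> u n k z" if "z > 0" for n k z
        unfolding u_def by (simp add: ennreal_mult' mult_left_mono payoff_le_bermudan)
      fix n k :: nat and z :: real assume k: "k \<le> n" and z: "z > 0"
      let ?d = "h / real (Suc n)"
      have d: "?d > 0" using h False by simp
      have "u n (Suc k) w = ennreal (exp (- r * (?d * real k))) * (ennreal (exp (- r * ?d)) * bermudan (replicate (n - k) ?d) w)" for w
      proof -
        have "exp (- r * (e * real (Suc k))) = exp (- r * (e * real k)) * exp (- r * e)" for e
          unfolding exp_add[symmetric] by (simp add: algebra_simps)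
        from this[of ?d] show ?thesis
          unfolding u_def by (simp only: ennreal_mult'[OF exp_ge_zero] mult.assoc diff_Suc_Suc)
      qed
      then have "(\<integral>\<^sup>+w. u n (Suc k) (S z ?d w) \<partial>gauss ?d) =
         ennreal (exp (- r * (?d * real k))) * (ennreal (exp (- r * ?d)) * (\<integral>\<^sup>+w. bermudan (replicate (n - k) ?d) (S z ?d w) \<partial>gauss ?d))"
        by (simp only:) (simp add: nn_integral_cmult)
      also have "\<dots> \<le> ennreal (exp (- r * (?d * real k))) * bermudan (?d # replicate (n - k) ?d) z"
        by (intro mult_left_mono) (auto simp: bermudan.simps(2))
      also have "\<dots> = u n k z"
        unfolding u_def using k by (simp only: Suc_diff_le replicate_Suc)
      finally show "(\<integral>\<^sup>+w. u n (Suc k) (S z ?d w) \<partial>gauss ?d) \<le> u n k z" .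
    qed
    also have "(\<lambda>n. u n 0 x) = (\<lambda>n. bermudan (L n) x)" unfolding u_def L_def by simp
    finally show ?thesis .
  qed
  moreover have "sum_list (L n) = h" for n
  proof -
    have "sum_list (L n) = real (Suc n) * (h / real (Suc n))"
      unfolding L_def by (simp only: sum_list_replicate)
    then show ?thesis by simp
  qed
  moreover have "d > 0" if "d \<in> set (L n)" for d n
    using that h False by (auto simp: L_def simp del: of_nat_Suc)
  ultimately show ?thesis
    by (intro that[of L])
qed

text \<open>Stopping as soon as the Bermudan value equals the payoff attains the value. The statement is
  conditional on the past \<open>F s\<close> so that it can be proved by induction on the list: the strategy for the
  remaining dates is used on the event, known at time \<open>s\<close>, where waiting is better.\<close>

lemma bermudan_strategy:
  assumes "\<And>d. d \<in> set ds \<Longrightarrow> d > 0" "0 \<le> s" "x > 0"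
  shows "\<exists>\<tau>. stopping_time F \<tau> \<and> (\<forall>\<omega>\<in>space M. s \<le> \<tau> \<omega> \<and> \<tau> \<omega> \<le> s + sum_list ds) \<and>
    (\<forall>A\<in>sets (F s). (\<integral>\<^sup>+\<omega>. indicator A \<omega> * (ennreal (exp (- r * s)) * bermudan ds (S x s (B s \<omega>))) \<partial>M)
      \<le> (\<integral>\<^sup>+\<omega>. indicator A \<omega> * ennreal (reward x \<tau> \<omega>) \<partial>M))"
  using assms
proof (induction ds arbitrary: s)
  case Nil
  have "ennreal (exp (- r * s)) * bermudan [] (S x s (B s \<omega>)) = ennreal (reward x (\<lambda>_. s) \<omega>)" for \<omega>
    by (simp add: reward_def ennreal_mult')
  then show ?case
    by (intro exI[of _ "\<lambda>_. s"]) (auto simp: stopping_time_const)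
next
  case (Cons d ds)
  have d: "d > 0" using Cons.prems by simp
  have s: "0 \<le> s" using Cons.prems by simp
  have "s + d \<ge> 0" using d s by simp
  from Cons.IH[OF _ this Cons.prems(3)] Cons.prems(1) obtain \<tau>' where
    \<tau>': "stopping_time F \<tau>'" "\<And>\<omega>. \<omega> \<in> space M \<Longrightarrow> s + d \<le> \<tau>' \<omega> \<and> \<tau>' \<omega> \<le> s + d + sum_list ds"
    "\<And>A. A \<in> sets (F (s + d)) \<Longrightarrow>
      (\<integral>\<^sup>+\<omega>. indicator A \<omega> * (ennreal (exp (- r * (s + d))) * bermudan ds (S x (s + d) (B (s + d) \<omega>))) \<partial>M)
      \<le> (\<integral>\<^sup>+\<omega>. indicator A \<omega> * ennreal (reward x \<tau>' \<omega>) \<partial>M)"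
    by auto
  define C where "C = {\<omega> \<in> space M. bermudan (d # ds) (S x s (B s \<omega>)) = ennreal (payoff (S x s (B s \<omega>)))}"
  define \<tau> where "\<tau> \<omega> = (if \<omega> \<in> C then s else \<tau>' \<omega>)" for \<omega>
  have sum: "0 \<le> sum_list ds" using Cons.prems(1) by (intro sum_list_nonneg) (auto intro: less_imp_le)
  have CF: "C \<in> sets (F s)"
  proof -
    have B: "B s \<in> borel_measurable (F s)" by (rule B_F) (use s in auto)
    define E where "E = {b. bermudan (d # ds) (S x s b) = ennreal (payoff (S x s b))}"
    have "(\<lambda>b. bermudan (d # ds) (S x s b)) \<in> borel_measurable borel"
      by (rule measurable_compose[OF _ bermudan_measurable]) measurable
    moreover have "(\<lambda>b. ennreal (payoff (S x s b))) \<in> borel_measurable borel"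
      by measurable
    ultimately have "E \<in> sets borel"
      using borel_measurable_eq[of "\<lambda>b. bermudan (d # ds) (S x s b)" borel] by (simp add: E_def)
    from measurable_sets[OF B this]
    have "{\<omega> \<in> space (F s). bermudan (d # ds) (S x s (B s \<omega>)) = ennreal (payoff (S x s (B s \<omega>)))} \<in> sets (F s)"
      by (simp add: E_def vimage_def Int_def conj_commute)
    then show ?thesis by (simp add: C_def)
  qed
  have st: "stopping_time F \<tau>"
  proof (rule stopping_timeI)
    fix t
    have "{\<omega> \<in> space M. \<tau> \<omega> \<le> t} \<in> sets (F t)"
    proof (cases "s \<le> t")
      case True
      have C: "C \<in> sets (F t)" using CF F_mono[OF True] by auto
      have "{\<omega> \<in> space M. \<tau> \<omega> \<le> t} = C \<union> ({\<omega> \<in> space M. \<tau>' \<omega> \<le> t} - C)"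
        using True by (auto simp: \<tau>_def C_def)
      then show ?thesis using C stopping_timeD[OF \<tau>'(1), of t] by (auto simp: pred_def)
    next
      case False
      then have "{\<omega> \<in> space M. \<tau> \<omega> \<le> t} = {}"
        using \<tau>'(2) d by (force simp: \<tau>_def)
      then show ?thesis by (simp only: sets.empty_sets)
    qed
    then show "Measurable.pred (F t) (\<lambda>\<omega>. \<tau> \<omega> \<le> t)" by (simp add: pred_def)
  qed
  have bd: "s \<le> \<tau> \<omega> \<and> \<tau> \<omega> \<le> s + sum_list (d # ds)" if "\<omega> \<in> space M" for \<omega>
    using \<tau>'(2)[OF that] d sum by (auto simp: \<tau>_def)
  have \<tau>mem: "\<tau> \<in> stopping_times_upto M B (s + sum_list (d # ds))"
    using st bd s by (force simp: stopping_times_upto_def)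
  have [measurable]: "B s \<in> borel_measurable M" "reward x \<tau> \<in> borel_measurable M"
    using s reward_measurable[OF \<tau>mem] by auto
  have main: "(\<integral>\<^sup>+\<omega>. indicator A \<omega> * (ennreal (exp (- r * s)) * bermudan (d # ds) (S x s (B s \<omega>))) \<partial>M)
      \<le> (\<integral>\<^sup>+\<omega>. indicator A \<omega> * ennreal (reward x \<tau> \<omega>) \<partial>M)" if A: "A \<in> sets (F s)" for A
  proof -
    define A1 A2 where "A1 = A \<inter> C" and "A2 = A - C"
    have A12: "A1 \<in> sets (F s)" "A2 \<in> sets (F s)" using A CF by (auto simp: A1_def A2_def)
    have [measurable]: "A1 \<in> sets M" "A2 \<in> sets M" using A12 F_in_M by auto
    have ind: "(indicator A \<omega> :: ennreal) = indicator A1 \<omega> + indicator A2 \<omega>" for \<omega>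
      by (auto simp: A1_def A2_def split: split_indicator)
    have split: "(\<integral>\<^sup>+\<omega>. indicator A \<omega> * g \<omega> \<partial>M) =
        (\<integral>\<^sup>+\<omega>. indicator A1 \<omega> * g \<omega> \<partial>M) + (\<integral>\<^sup>+\<omega>. indicator A2 \<omega> * g \<omega> \<partial>M)"
      if [measurable]: "g \<in> borel_measurable M" for g
      unfolding ind distrib_right by (rule nn_integral_add) measurable
    have 1: "(\<integral>\<^sup>+\<omega>. indicator A1 \<omega> * (ennreal (exp (- r * s)) * bermudan (d # ds) (S x s (B s \<omega>))) \<partial>M) =
        (\<integral>\<^sup>+\<omega>. indicator A1 \<omega> * ennreal (reward x \<tau> \<omega>) \<partial>M)"
    proof (rule nn_integral_cong)
      fix \<omega>
      show "indicator A1 \<omega> * (ennreal (exp (- r * s)) * bermudan (d # ds) (S x s (B s \<omega>))) =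
        indicator A1 \<omega> * ennreal (reward x \<tau> \<omega>)"
      proof (cases "\<omega> \<in> A1")
        case True
        then have "bermudan (d # ds) (S x s (B s \<omega>)) = ennreal (payoff (S x s (B s \<omega>)))" "\<tau> \<omega> = s"
          by (auto simp: A1_def C_def \<tau>_def)
        then show ?thesis by (simp only: reward_def) (simp add: ennreal_mult')
      qed simp
    qed
    have "(\<integral>\<^sup>+\<omega>. indicator A2 \<omega> * (ennreal (exp (- r * s)) * bermudan (d # ds) (S x s (B s \<omega>))) \<partial>M) =
      (\<integral>\<^sup>+\<omega>. indicator A2 \<omega> * (\<integral>\<^sup>+z. ennreal (exp (- r * (s + d))) * bermudan ds (S x (s + d) (B s \<omega> + z)) \<partial>gauss d) \<partial>M)"
    proof (rule nn_integral_cong)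
      fix \<omega> assume \<omega>: "\<omega> \<in> space M"
      show "indicator A2 \<omega> * (ennreal (exp (- r * s)) * bermudan (d # ds) (S x s (B s \<omega>))) =
        indicator A2 \<omega> * (\<integral>\<^sup>+z. ennreal (exp (- r * (s + d))) * bermudan ds (S x (s + d) (B s \<omega> + z)) \<partial>gauss d)"
      proof (cases "\<omega> \<in> A2")
        case True
        then have "bermudan (d # ds) (S x s (B s \<omega>)) \<noteq> ennreal (payoff (S x s (B s \<omega>)))"
          using \<omega> by (auto simp: A2_def C_def)
        then have "bermudan (d # ds) (S x s (B s \<omega>)) =
          ennreal (exp (- r * d)) * (\<integral>\<^sup>+z. bermudan ds (S x (s + d) (B s \<omega> + z)) \<partial>gauss d)"
          by (auto simp: bermudan.simps(2) max_def S_add split: if_splits)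
        then have "ennreal (exp (- r * s)) * bermudan (d # ds) (S x s (B s \<omega>)) =
          (ennreal (exp (- r * s)) * ennreal (exp (- r * d))) * (\<integral>\<^sup>+z. bermudan ds (S x (s + d) (B s \<omega> + z)) \<partial>gauss d)"
          by (simp only: mult.assoc)
        also have "ennreal (exp (- r * s)) * ennreal (exp (- r * d)) = ennreal (exp (- r * (s + d)))"
          by (simp add: ennreal_mult'[symmetric] exp_add[symmetric] algebra_simps)
        also have "\<dots> * (\<integral>\<^sup>+z. bermudan ds (S x (s + d) (B s \<omega> + z)) \<partial>gauss d) =
          (\<integral>\<^sup>+z. ennreal (exp (- r * (s + d))) * bermudan ds (S x (s + d) (B s \<omega> + z)) \<partial>gauss d)"
          by (rule nn_integral_cmult[symmetric]) measurable
        finally show ?thesis by simp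
      qed simp
    qed
    also have "\<dots> = (\<integral>\<^sup>+\<omega>. indicator A2 \<omega> * (ennreal (exp (- r * (s + d))) * bermudan ds (S x (s + d) (B (s + d) \<omega>))) \<partial>M)"
      by (rule markov[symmetric]) (use s d A12 in \<open>auto\<close>)
    also have "\<dots> \<le> (\<integral>\<^sup>+\<omega>. indicator A2 \<omega> * ennreal (reward x \<tau>' \<omega>) \<partial>M)"
      by (rule \<tau>'(3)) (use A12 F_mono[of s "s + d"] d in auto)
    also have "\<dots> = (\<integral>\<^sup>+\<omega>. indicator A2 \<omega> * ennreal (reward x \<tau> \<omega>) \<partial>M)"
      by (intro nn_integral_cong) (auto simp: A2_def \<tau>_def reward_def split: split_indicator)
    finally have 2: "(\<integral>\<^sup>+\<omega>. indicator A2 \<omega> * (ennreal (exp (- r * s)) * bermudan (d # ds) (S x s (B s \<omega>))) \<partial>M)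
      \<le> (\<integral>\<^sup>+\<omega>. indicator A2 \<omega> * ennreal (reward x \<tau> \<omega>) \<partial>M)" .
    have "(\<lambda>\<omega>. ennreal (exp (- r * s)) * bermudan (d # ds) (S x s (B s \<omega>))) \<in> borel_measurable M"
      "(\<lambda>\<omega>. ennreal (reward x \<tau> \<omega>)) \<in> borel_measurable M"
      by measurable
    from this[THEN split] show ?thesis using 1 2 by (simp add: add_left_mono)
  qed
  show ?case
    by (intro exI[of _ \<tau>] conjI ballI st) (use bd main in auto)
qed

lemma bermudan_le_put_value:
  assumes "\<And>d. d \<in> set ds \<Longrightarrow> d > 0" "x > 0" "sum_list ds \<le> h"
  shows "bermudan ds x \<le> ennreal (put_value h x)"
proof -
  obtain \<tau> where \<tau>: "stopping_time F \<tau>" "\<And>\<omega>. \<omega> \<in> space M \<Longrightarrow> 0 \<le> \<tau> \<omega> \<and> \<tau> \<omega> \<le> sum_list ds"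
    "\<And>A. A \<in> sets (F 0) \<Longrightarrow>
      (\<integral>\<^sup>+\<omega>. indicator A \<omega> * (ennreal (exp (- r * 0)) * bermudan ds (S x 0 (B 0 \<omega>))) \<partial>M)
      \<le> (\<integral>\<^sup>+\<omega>. indicator A \<omega> * ennreal (reward x \<tau> \<omega>) \<partial>M)"
    using bermudan_strategy[OF assms(1) order_refl assms(2), of ds] by auto
  have mem: "\<tau> \<in> stopping_times_upto M B h"
    using \<tau> assms(3) by (force simp: stopping_times_upto_def)
  have sp: "space M \<in> sets (F 0)" using sets.top[of "F 0"] by simp
  have "bermudan ds x = (\<integral>\<^sup>+\<omega>. bermudan ds x \<partial>M)" by (simp add: emeasure_space_1)
  also have "\<dots> = (\<integral>\<^sup>+\<omega>. indicator (space M) \<omega> * (ennreal (exp (- r * 0)) * bermudan ds (S x 0 (B 0 \<omega>))) \<partial>M)"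
    by (intro nn_integral_cong_AE) (use B_zero AE_space in \<open>eventually_elim, auto\<close>)
  also have "\<dots> \<le> (\<integral>\<^sup>+\<omega>. indicator (space M) \<omega> * ennreal (reward x \<tau> \<omega>) \<partial>M)"
    by (rule \<tau>(3)[OF sp])
  also have "\<dots> = (\<integral>\<^sup>+\<omega>. ennreal (reward x \<tau> \<omega>) \<partial>M)"
    by (intro nn_integral_cong) auto
  also have "\<dots> = ennreal (\<integral>\<omega>. reward x \<tau> \<omega> \<partial>M)"
    by (rule nn_integral_reward[OF mem assms(2)])
  also have "\<dots> \<le> ennreal (put_value h x)"
    by (intro ennreal_leI put_value_upper[OF mem assms(2)])
  finally show ?thesis .
qed

text \<open>Waiting for time \<open>\<epsilon>\<close> and then holding a Bermudan put is itself a Bermudan put, hence worth at most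
  the American put. Fatou's lemma transfers this to the limit of Bermudan puts with ever finer grids;
  in this way no measurable choice of optimal strategies is needed.\<close>

lemma put_value_superharmonic:
  assumes \<epsilon>: "\<epsilon> > 0" "\<epsilon> \<le> h" and x: "x > 0"
  shows "(\<integral>\<^sup>+z. ennreal (exp (- r * \<epsilon>) * put_value (h - \<epsilon>) (S x \<epsilon> z)) \<partial>gauss \<epsilon>) \<le> ennreal (put_value h x)"
proof -
  obtain L where L: "\<And>n d. d \<in> set (L n) \<Longrightarrow> d > 0" "\<And>n. sum_list (L n) = h - \<epsilon>"
    "\<And>x. x > 0 \<Longrightarrow> ennreal (put_value (h - \<epsilon>) x) \<le> liminf (\<lambda>n. bermudan (L n) x)"
    using put_value_le_liminf_bermudan[of "h - \<epsilon>"] \<epsilon> by auto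
  have "(\<integral>\<^sup>+z. ennreal (exp (- r * \<epsilon>) * put_value (h - \<epsilon>) (S x \<epsilon> z)) \<partial>gauss \<epsilon>) =
    (\<integral>\<^sup>+z. ennreal (exp (- r * \<epsilon>)) * ennreal (put_value (h - \<epsilon>) (S x \<epsilon> z)) \<partial>gauss \<epsilon>)"
    by (simp add: ennreal_mult')
  also have "\<dots> = ennreal (exp (- r * \<epsilon>)) * (\<integral>\<^sup>+z. ennreal (put_value (h - \<epsilon>) (S x \<epsilon> z)) \<partial>gauss \<epsilon>)"
    using \<epsilon> x by (intro nn_integral_cmult) measurable
  also have "\<dots> \<le> ennreal (exp (- r * \<epsilon>)) * (\<integral>\<^sup>+z. liminf (\<lambda>n. bermudan (L n) (S x \<epsilon> z)) \<partial>gauss \<epsilon>)"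
    by (intro mult_left_mono nn_integral_mono L(3) S_pos x) auto
  also have "\<dots> \<le> ennreal (exp (- r * \<epsilon>)) * liminf (\<lambda>n. \<integral>\<^sup>+z. bermudan (L n) (S x \<epsilon> z) \<partial>gauss \<epsilon>)"
    by (intro mult_left_mono nn_integral_liminf) auto
  also have "\<dots> \<le> ennreal (exp (- r * \<epsilon>)) * liminf (\<lambda>n. ennreal (exp (r * \<epsilon>)) * ennreal (put_value h x))"
  proof (intro mult_left_mono Liminf_mono always_eventually allI)
    fix n
    have "(\<integral>\<^sup>+z. bermudan (L n) (S x \<epsilon> z) \<partial>gauss \<epsilon>) =
      ennreal (exp (r * \<epsilon>) * exp (- r * \<epsilon>)) * (\<integral>\<^sup>+z. bermudan (L n) (S x \<epsilon> z) \<partial>gauss \<epsilon>)"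
      unfolding exp_add[symmetric] by simp
    also have "\<dots> = ennreal (exp (r * \<epsilon>)) * (ennreal (exp (- r * \<epsilon>)) * (\<integral>\<^sup>+z. bermudan (L n) (S x \<epsilon> z) \<partial>gauss \<epsilon>))"
      by (simp add: ennreal_mult' mult.assoc)
    also have "\<dots> \<le> ennreal (exp (r * \<epsilon>)) * bermudan (\<epsilon> # L n) x"
      by (intro mult_left_mono) (auto simp: bermudan.simps(2))
    also have "\<dots> \<le> ennreal (exp (r * \<epsilon>)) * ennreal (put_value h x)"
      by (intro mult_left_mono bermudan_le_put_value) (use L \<epsilon> x in auto)
    finally show "(\<integral>\<^sup>+z. bermudan (L n) (S x \<epsilon> z) \<partial>gauss \<epsilon>) \<le> ennreal (exp (r * \<epsilon>)) * ennreal (put_value h x)" .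
  qed auto
  also have "\<dots> = ennreal (exp (- r * \<epsilon>) * exp (r * \<epsilon>)) * ennreal (put_value h x)"
    by (simp add: Liminf_const ennreal_mult' mult.assoc)
  also have "\<dots> = ennreal (put_value h x)"
    unfolding exp_add[symmetric] by simp
  finally show ?thesis .
qed

end

section \<open>The continuation value of the first right\<close>

context market
begin

text \<open>Half of the exercise boundary of the perpetual put.\<close>

definition x_star :: real where "x_star = K / 2 / (1 + 1 / \<gamma>)"

lemma x_star: "x_star > 0" "(1 + 1 / \<gamma>) * x_star = K / 2"
proof -
  have "1 + 1 / \<gamma> > 0" using \<gamma> by (simp add: add_pos_pos)
  then show "x_star > 0" using K by (simp add: x_star_def)
  have "k * (K / 2 / k) = K / 2" if "k > 0" for k using that by simp
  from this[OF \<open>1 + 1 / \<gamma> > 0\<close>] show "(1 + 1 / \<gamma>) * x_star = K / 2" unfolding x_star_def .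
qed

text \<open>At \<open>x\<close> itself the tangent at \<open>x\<close> equals the payoff, and the kernel keeps its power part while
  discounting its constant part, which is at least \<open>K / 2\<close> for \<open>x\<close> up to \<open>x_star\<close>.\<close>

lemma put_value_strict:
  assumes \<epsilon>: "0 < \<epsilon>" "\<epsilon> \<le> h" and x: "0 < x" "x \<le> x_star"
  shows "(\<integral>\<^sup>+z. ennreal (exp (- r * \<epsilon>) * put_value (h - \<epsilon>) (S x \<epsilon> z)) \<partial>gauss \<epsilon>) +
    ennreal ((1 - exp (- r * \<epsilon>)) * (K / 2)) \<le> ennreal (put_value h x)"
proof -
  define k where "k = K - (1 + 1 / \<gamma>) * x"
  have "(1 + 1 / \<gamma>) * x \<le> (1 + 1 / \<gamma>) * x_star"
    using x \<gamma> by (intro mult_left_mono) auto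
  then have k: "K / 2 \<le> k" and cx: "(1 + 1 / \<gamma>) * x \<le> K"
    unfolding k_def x_star(2) using K by linarith+
  have e1: "exp (- r * \<epsilon>) \<le> 1" using mult_pos_pos[OF r \<epsilon>(1)] by simp
  have "(\<integral>\<^sup>+z. ennreal (exp (- r * \<epsilon>) * put_value (h - \<epsilon>) (S x \<epsilon> z)) \<partial>gauss \<epsilon>) \<le>
    (\<integral>\<^sup>+z. ennreal (exp (- r * \<epsilon>) * tangent x (S x \<epsilon> z)) \<partial>gauss \<epsilon>)"
    using \<epsilon> x cx by (intro nn_integral_mono ennreal_leI mult_left_mono put_value_le_tangent S_pos) auto
  also have "\<dots> = ennreal (exp (- r * \<epsilon>) * k + x / \<gamma> * (x / x) powr \<gamma>)"
    unfolding k_def by (rule tangent_kernel[OF x(1) x(1) cx \<epsilon>(1)])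
  also have "\<dots> = ennreal (exp (- r * \<epsilon>) * k + x / \<gamma>)" using x by simp
  finally have "(\<integral>\<^sup>+z. ennreal (exp (- r * \<epsilon>) * put_value (h - \<epsilon>) (S x \<epsilon> z)) \<partial>gauss \<epsilon>) +
    ennreal ((1 - exp (- r * \<epsilon>)) * (K / 2)) \<le> ennreal (exp (- r * \<epsilon>) * k + x / \<gamma>) + ennreal ((1 - exp (- r * \<epsilon>)) * (K / 2))"
    by (rule add_right_mono)
  also have "\<dots> = ennreal (exp (- r * \<epsilon>) * k + x / \<gamma> + (1 - exp (- r * \<epsilon>)) * (K / 2))"
    using e1 K k x \<gamma> by (intro ennreal_plus[symmetric]) auto
  also have "\<dots> \<le> ennreal (put_value h x)"
  proof (rule ennreal_leI)
    have "(1 - exp (- r * \<epsilon>)) * (K / 2) \<le> (1 - exp (- r * \<epsilon>)) * k"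
      using e1 k by (intro mult_left_mono) auto
    then have "exp (- r * \<epsilon>) * k + x / \<gamma> + (1 - exp (- r * \<epsilon>)) * (K / 2) \<le> k + x / \<gamma>"
      by (simp add: algebra_simps)
    also have "\<dots> = K - x" by (simp add: k_def field_simps)
    also have "\<dots> \<le> payoff x" by (simp add: payoff_def)
    also have "\<dots> \<le> put_value h x" using \<epsilon> x by (intro put_value_bounds) auto
    finally show "exp (- r * \<epsilon>) * k + x / \<gamma> + (1 - exp (- r * \<epsilon>)) * (K / 2) \<le> put_value h x" .
  qed
  finally show ?thesis .
qed

end

locale swing = market +
  fixes \<delta> :: real
  assumes \<delta>: "\<delta> > 0"
begin

text \<open>The function \<open>R\<close> of the remaining time in which the first right may be used.\<close>

definition continuation :: "real \<Rightarrow> real \<Rightarrow> real" where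
  "continuation h x = exp (- r * \<delta>) * (\<integral>z. put_value h (S x \<delta> z) \<partial>gauss \<delta>)"

lemma R_continuation:
  assumes "t + \<delta> \<le> T" "x > 0"
  shows "R M B r \<sigma> K \<delta> T t x = continuation (T - \<delta> - t) x"
proof -
  have [measurable]: "B \<delta> \<in> borel_measurable M" using \<delta> by simp
  have [measurable]: "(\<lambda>z. put_value (T - (t + \<delta>)) (S x \<delta> z)) \<in> borel_measurable borel"
    using assms by (intro put_value_S_measurable) auto
  have "(\<integral>z. put_value (T - (t + \<delta>)) (S x \<delta> z) \<partial>gauss \<delta>) = (\<integral>\<omega>. put_value (T - (t + \<delta>)) (S x \<delta> (B \<delta> \<omega>)) \<partial>M)"
    unfolding B_distr[OF \<delta>, symmetric] by (rule integral_distr) auto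
  then show ?thesis
    by (simp add: R_def V1_put_value gbm_S continuation_def algebra_simps)
qed

lemma put_value_gauss_integrable:
  assumes "h \<ge> 0" "x > 0"
  shows "integrable (gauss \<delta>) (\<lambda>z. put_value h (S x \<delta> z))"
proof -
  interpret g: prob_space "gauss \<delta>" by (rule prob_space_gauss[OF \<delta>])
  have "(\<lambda>z. put_value h (S x \<delta> z)) \<in> borel_measurable (gauss \<delta>)"
    using assms by (intro put_value_S_measurable) auto
  then show ?thesis
    by (intro g.integrable_const_bound[of _ K]) (use put_value_bounds[OF assms(1)] S_pos[OF assms(2)] in auto)
qed

lemma continuation_nonneg: "h \<ge> 0 \<Longrightarrow> x > 0 \<Longrightarrow> 0 \<le> continuation h x"
  unfolding continuation_def using put_value_bounds(3) S_pos by (simp add: integral_nonneg_AE)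

lemma ennreal_continuation:
  assumes "h \<ge> 0" "x > 0"
  shows "ennreal (continuation h x) = (\<integral>\<^sup>+z. ennreal (exp (- r * \<delta>) * put_value h (S x \<delta> z)) \<partial>gauss \<delta>)"
proof -
  have "(\<integral>\<^sup>+z. ennreal (exp (- r * \<delta>) * put_value h (S x \<delta> z)) \<partial>gauss \<delta>) =
     ennreal (\<integral>z. exp (- r * \<delta>) * put_value h (S x \<delta> z) \<partial>gauss \<delta>)"
    by (rule nn_integral_eq_integral)
      (use put_value_gauss_integrable[OF assms] put_value_bounds(3)[OF assms(1) S_pos[OF assms(2)]] in auto)
  then show ?thesis by (simp add: continuation_def)
qed

lemma continuation_lsc:
  assumes x: "x > 0" "\<And>n. xs n > 0" "xs \<longlonglongrightarrow> x"
    and h: "\<And>n. 0 \<le> hs n \<and> hs n \<le> h" "hs \<longlonglongrightarrow> h"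
  shows "ennreal (continuation h x) \<le> liminf (\<lambda>n. ennreal (continuation (hs n) (xs n)))"
proof -
  have h0: "h \<ge> 0" using h(1)[of 0] by simp
  have "ennreal (continuation h x) = (\<integral>\<^sup>+z. ennreal (exp (- r * \<delta>) * put_value h (S x \<delta> z)) \<partial>gauss \<delta>)"
    by (rule ennreal_continuation[OF h0 x(1)])
  also have "\<dots> \<le> (\<integral>\<^sup>+z. liminf (\<lambda>n. ennreal (exp (- r * \<delta>) * put_value (hs n) (S (xs n) \<delta> z))) \<partial>gauss \<delta>)"
  proof (rule nn_integral_mono)
    fix z
    have "ennreal (put_value h (S x \<delta> z)) \<le> liminf (\<lambda>n. ennreal (put_value (hs n) (S (xs n) \<delta> z)))"
      by (rule put_value_lsc) (auto intro!: S_pos x tendsto_intros h simp: h)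
    from lsc_real_affine[OF _ _ this tendsto_const order_refl order_refl tendsto_const, of "exp (- r * \<delta>)"]
    show "ennreal (exp (- r * \<delta>) * put_value h (S x \<delta> z)) \<le> liminf (\<lambda>n. ennreal (exp (- r * \<delta>) * put_value (hs n) (S (xs n) \<delta> z)))"
      using put_value_bounds(3) h0 h(1) x S_pos by simp
  qed
  also have "\<dots> \<le> liminf (\<lambda>n. \<integral>\<^sup>+z. ennreal (exp (- r * \<delta>) * put_value (hs n) (S (xs n) \<delta> z)) \<partial>gauss \<delta>)"
  proof (rule nn_integral_liminf)
    fix n
    have [measurable]: "(\<lambda>z. put_value (hs n) (S (xs n) \<delta> z)) \<in> borel_measurable (gauss \<delta>)"
      using h(1)[of n] x(2)[of n] by (intro put_value_S_measurable) auto
    show "(\<lambda>z. ennreal (exp (- r * \<delta>) * put_value (hs n) (S (xs n) \<delta> z))) \<in> borel_measurable (gauss \<delta>)"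
      by measurable
  qed
  also have "\<dots> = liminf (\<lambda>n. ennreal (continuation (hs n) (xs n)))"
    using ennreal_continuation h(1) x(2) by simp
  finally show ?thesis .
qed

text \<open>The kernels for \<open>\<epsilon>\<close> and \<open>\<delta>\<close> commute, so the inequality for the put can be applied after the
  refraction period; the strict part contributes on the event that the price is then below \<open>x_star\<close>.\<close>

lemma continuation_strict:
  assumes \<epsilon>: "0 < \<epsilon>" "\<epsilon> \<le> h" and x: "0 < x"
  shows "(\<integral>\<^sup>+z. ennreal (exp (- r * \<epsilon>) * continuation (h - \<epsilon>) (S x \<epsilon> z)) \<partial>gauss \<epsilon>) +
    ennreal (exp (- r * \<delta>) * (1 - exp (- r * \<epsilon>)) * (K / 2) * measure (gauss \<delta>) {z. S x \<delta> z \<le> x_star})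
    \<le> ennreal (continuation h x)"
proof -
  interpret gd: prob_space "gauss \<delta>" by (rule prob_space_gauss[OF \<delta>])
  interpret ge: prob_space "gauss \<epsilon>" by (rule prob_space_gauss[OF \<epsilon>(1)])
  interpret P: pair_sigma_finite "gauss \<epsilon>" "gauss \<delta>" ..
  have he: "h - \<epsilon> \<ge> 0" using \<epsilon> by simp
  define E where "E = {z. S x \<delta> z \<le> x_star}"
  have [measurable]: "E \<in> sets borel" unfolding E_def by measurable
  have e1: "exp (- r * \<epsilon>) \<le> 1" using mult_pos_pos[OF r \<epsilon>(1)] by simp
  define q where "q = (1 - exp (- r * \<epsilon>)) * (K / 2)"
  have q: "q \<ge> 0" using e1 K by (simp add: q_def)
  have "(\<lambda>p. put_value (h - \<epsilon>) (S x (\<epsilon> + \<delta>) (fst p + snd p))) \<in> borel_measurable (gauss \<epsilon> \<Otimes>\<^sub>M gauss \<delta>)"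
    by (rule put_value_S_measurable[OF he x]) auto
  then have vm[measurable]: "(\<lambda>(z, w). put_value (h - \<epsilon>) (S (S x \<epsilon> z) \<delta> w)) \<in> borel_measurable (gauss \<epsilon> \<Otimes>\<^sub>M gauss \<delta>)"
    by (simp add: S_add split_beta')
  have "(\<integral>\<^sup>+z. ennreal (exp (- r * \<epsilon>) * continuation (h - \<epsilon>) (S x \<epsilon> z)) \<partial>gauss \<epsilon>) =
    (\<integral>\<^sup>+z. \<integral>\<^sup>+w. ennreal (exp (- r * \<delta>)) * ennreal (exp (- r * \<epsilon>) * put_value (h - \<epsilon>) (S (S x \<epsilon> z) \<delta> w)) \<partial>gauss \<delta> \<partial>gauss \<epsilon>)"
  proof (rule nn_integral_cong)
    fix z
    have [measurable]: "(\<lambda>w. put_value (h - \<epsilon>) (S (S x \<epsilon> z) \<delta> w)) \<in> borel_measurable (gauss \<delta>)"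
      by (rule put_value_S_measurable[OF he S_pos[OF x]]) auto
    have "ennreal (exp (- r * \<epsilon>) * continuation (h - \<epsilon>) (S x \<epsilon> z)) =
      ennreal (exp (- r * \<epsilon>)) * (\<integral>\<^sup>+w. ennreal (exp (- r * \<delta>) * put_value (h - \<epsilon>) (S (S x \<epsilon> z) \<delta> w)) \<partial>gauss \<delta>)"
      by (simp add: ennreal_mult' ennreal_continuation[OF he S_pos[OF x]])
    also have "\<dots> = (\<integral>\<^sup>+w. ennreal (exp (- r * \<epsilon>)) * ennreal (exp (- r * \<delta>) * put_value (h - \<epsilon>) (S (S x \<epsilon> z) \<delta> w)) \<partial>gauss \<delta>)"
      by (rule nn_integral_cmult[symmetric]) measurable
    also have "\<dots> = (\<integral>\<^sup>+w. ennreal (exp (- r * \<delta>)) * ennreal (exp (- r * \<epsilon>) * put_value (h - \<epsilon>) (S (S x \<epsilon> z) \<delta> w)) \<partial>gauss \<delta>)"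
      by (intro nn_integral_cong) (simp add: ennreal_mult' mult.left_commute)
    finally show "ennreal (exp (- r * \<epsilon>) * continuation (h - \<epsilon>) (S x \<epsilon> z)) = \<dots>" .
  qed
  also have "\<dots> = (\<integral>\<^sup>+w. \<integral>\<^sup>+z. ennreal (exp (- r * \<delta>)) * ennreal (exp (- r * \<epsilon>) * put_value (h - \<epsilon>) (S (S x \<epsilon> z) \<delta> w)) \<partial>gauss \<epsilon> \<partial>gauss \<delta>)"
    by (rule P.Fubini'[symmetric]) measurable
  also have "\<dots> = (\<integral>\<^sup>+w. ennreal (exp (- r * \<delta>)) * (\<integral>\<^sup>+z. ennreal (exp (- r * \<epsilon>) * put_value (h - \<epsilon>) (S (S x \<delta> w) \<epsilon> z)) \<partial>gauss \<epsilon>) \<partial>gauss \<delta>)"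
  proof (rule nn_integral_cong)
    fix w
    have [measurable]: "(\<lambda>z. put_value (h - \<epsilon>) (S (S x \<delta> w) \<epsilon> z)) \<in> borel_measurable (gauss \<epsilon>)"
      by (rule put_value_S_measurable[OF he S_pos[OF x]]) auto
    show "(\<integral>\<^sup>+z. ennreal (exp (- r * \<delta>)) * ennreal (exp (- r * \<epsilon>) * put_value (h - \<epsilon>) (S (S x \<epsilon> z) \<delta> w)) \<partial>gauss \<epsilon>) =
      ennreal (exp (- r * \<delta>)) * (\<integral>\<^sup>+z. ennreal (exp (- r * \<epsilon>) * put_value (h - \<epsilon>) (S (S x \<delta> w) \<epsilon> z)) \<partial>gauss \<epsilon>)"
      unfolding S_commute[of x \<epsilon> _ \<delta> w] by (rule nn_integral_cmult) measurable
  qed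
  finally have 1: "(\<integral>\<^sup>+z. ennreal (exp (- r * \<epsilon>) * continuation (h - \<epsilon>) (S x \<epsilon> z)) \<partial>gauss \<epsilon>) =
    (\<integral>\<^sup>+w. ennreal (exp (- r * \<delta>)) * (\<integral>\<^sup>+z. ennreal (exp (- r * \<epsilon>) * put_value (h - \<epsilon>) (S (S x \<delta> w) \<epsilon> z)) \<partial>gauss \<epsilon>) \<partial>gauss \<delta>)" .
  have 2: "ennreal (exp (- r * \<delta>) * (1 - exp (- r * \<epsilon>)) * (K / 2) * measure (gauss \<delta>) E) =
     (\<integral>\<^sup>+w. ennreal (exp (- r * \<delta>)) * (ennreal q * indicator E w) \<partial>gauss \<delta>)"
  proof -
    have "ennreal (exp (- r * \<delta>) * (1 - exp (- r * \<epsilon>)) * (K / 2) * measure (gauss \<delta>) E) =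
      ennreal (exp (- r * \<delta>)) * (ennreal q * ennreal (measure (gauss \<delta>) E))"
      using q by (simp only: q_def mult.assoc ennreal_mult'[OF exp_ge_zero] ennreal_mult''[OF measure_nonneg, symmetric])
    then show ?thesis by (simp add: nn_integral_cmult gd.emeasure_eq_measure)
  qed
  have meas: "(\<lambda>w. ennreal (exp (- r * \<delta>)) * (\<integral>\<^sup>+z. ennreal (exp (- r * \<epsilon>) * put_value (h - \<epsilon>) (S (S x \<delta> w) \<epsilon> z)) \<partial>gauss \<epsilon>)) \<in> borel_measurable (gauss \<delta>)"
  proof -
    have "(\<lambda>p. put_value (h - \<epsilon>) (S x (\<delta> + \<epsilon>) (fst p + snd p))) \<in> borel_measurable (gauss \<delta> \<Otimes>\<^sub>M borel)"
      by (rule put_value_S_measurable[OF he x]) auto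
    then have [measurable]: "(\<lambda>(w, z). put_value (h - \<epsilon>) (S (S x \<delta> w) \<epsilon> z)) \<in> borel_measurable (gauss \<delta> \<Otimes>\<^sub>M borel)"
      by (simp add: S_add split_beta')
    show ?thesis by measurable
  qed
  have "(\<integral>\<^sup>+z. ennreal (exp (- r * \<epsilon>) * continuation (h - \<epsilon>) (S x \<epsilon> z)) \<partial>gauss \<epsilon>) +
    ennreal (exp (- r * \<delta>) * (1 - exp (- r * \<epsilon>)) * (K / 2) * measure (gauss \<delta>) E) =
    (\<integral>\<^sup>+w. ennreal (exp (- r * \<delta>)) * (\<integral>\<^sup>+z. ennreal (exp (- r * \<epsilon>) * put_value (h - \<epsilon>) (S (S x \<delta> w) \<epsilon> z)) \<partial>gauss \<epsilon>)
      + ennreal (exp (- r * \<delta>)) * (ennreal q * indicator E w) \<partial>gauss \<delta>)"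
    unfolding 1 2 by (rule nn_integral_add[symmetric, OF meas]) measurable
  also have "\<dots> \<le> (\<integral>\<^sup>+w. ennreal (exp (- r * \<delta>)) * ennreal (put_value h (S x \<delta> w)) \<partial>gauss \<delta>)"
  proof (rule nn_integral_mono)
    fix w
    have "(\<integral>\<^sup>+z. ennreal (exp (- r * \<epsilon>) * put_value (h - \<epsilon>) (S (S x \<delta> w) \<epsilon> z)) \<partial>gauss \<epsilon>) + ennreal q * indicator E w
      \<le> ennreal (put_value h (S x \<delta> w))"
    proof (cases "w \<in> E")
      case True
      then show ?thesis
        using put_value_strict[OF \<epsilon> S_pos[OF x], of \<delta> w] by (simp add: E_def q_def)
    next
      case False
      then show ?thesis
        using put_value_superharmonic[OF \<epsilon> S_pos[OF x], of \<delta> w] by simp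
    qed
    then show "ennreal (exp (- r * \<delta>)) * (\<integral>\<^sup>+z. ennreal (exp (- r * \<epsilon>) * put_value (h - \<epsilon>) (S (S x \<delta> w) \<epsilon> z)) \<partial>gauss \<epsilon>)
      + ennreal (exp (- r * \<delta>)) * (ennreal q * indicator E w) \<le> ennreal (exp (- r * \<delta>)) * ennreal (put_value h (S x \<delta> w))"
      unfolding distrib_left[symmetric] by (rule mult_left_mono) simp
  qed
  also have "\<dots> = ennreal (continuation h x)"
    using ennreal_continuation[of h x] \<epsilon> x by (simp add: ennreal_mult')
  finally show ?thesis unfolding E_def .
qed

end

section \<open>A penalised stopping problem for Brownian motion\<close>

text \<open>The player may stop a Brownian motion on a grid, receives \<open>K\<close> if it is then at most \<open>\<kappa>\<close>, and pays
  until then at a rate of \<open>c\<close> times the probability of being below \<open>\<beta>\<close> after a further time \<open>\<delta>\<close>.\<close>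

locale penalised =
  fixes K \<kappa> \<beta> c \<delta> :: real
  assumes K_pos: "K > 0" and c_pos: "c > 0" and \<delta>_pos: "\<delta> > 0"
begin

definition penalty :: "real \<Rightarrow> real" where "penalty y = gauss_cdf \<delta> (\<beta> - y)"
definition claim :: "real \<Rightarrow> real" where "claim y = K * indicator {..\<kappa>} y"

primrec game_value :: "real \<Rightarrow> nat \<Rightarrow> real \<Rightarrow> real" where
  "game_value \<epsilon> 0 y = claim y"
| "game_value \<epsilon> (Suc j) y = max (claim y) ((\<integral>z. game_value \<epsilon> j (y + z) \<partial>gauss \<epsilon>) - \<epsilon> * c * penalty y)"

lemma claim_bounds: "0 \<le> claim y" "claim y \<le> K"
  using K_pos by (auto simp: claim_def split: split_indicator)

lemma penalty_bounds: "0 \<le> penalty y" "penalty y \<le> 1"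
  using gauss_cdf_bounds[OF \<delta>_pos] by (auto simp: penalty_def)

lemma penalty_measurable[measurable]: "penalty \<in> borel_measurable borel"
  unfolding penalty_def[abs_def] using gauss_cdf_measurable[OF \<delta>_pos] by measurable

lemma claim_measurable[measurable]: "claim \<in> borel_measurable borel"
  unfolding claim_def[abs_def] by measurable

lemma game_value_nonneg: "0 \<le> game_value \<epsilon> j y"
  using claim_bounds(1)[of y] by (cases j) (auto simp: max_def)

lemma game_value_measurable:
  assumes "\<epsilon> > 0" shows "game_value \<epsilon> j \<in> borel_measurable borel"
proof (induction j)
  case 0
  show ?case unfolding game_value.simps(1)[abs_def] by measurable
next
  case (Suc j)
  note [measurable] = Suc
  interpret g: prob_space "gauss \<epsilon>" by (rule prob_space_gauss) fact
  have [measurable]: "(\<lambda>y. \<integral>z. game_value \<epsilon> j (y + z) \<partial>gauss \<epsilon>) \<in> borel_measurable borel"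
    by (rule g.borel_measurable_lebesgue_integral) measurable
  show ?case unfolding game_value.simps(2)[abs_def] by measurable
qed

lemma game_value_le:
  assumes "\<epsilon> > 0" shows "game_value \<epsilon> j y \<le> K"
proof (induction j arbitrary: y)
  case 0
  show ?case by (simp add: claim_bounds)
next
  case (Suc j)
  interpret g: prob_space "gauss \<epsilon>" by (rule prob_space_gauss) fact
  have "(\<integral>z. game_value \<epsilon> j (y + z) \<partial>gauss \<epsilon>) \<le> K"
    by (rule g.integral_le_const) (use game_value_measurable[OF assms] Suc game_value_nonneg in \<open>auto intro!: g.integrable_const_bound[of _ K]\<close>)
  moreover have "0 \<le> \<epsilon> * c * penalty y" using assms c_pos penalty_bounds by simp
  ultimately show ?case using claim_bounds(2)[of y] by simp
qed

lemma game_value_integrable: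
  assumes "\<epsilon> > 0" shows "integrable (gauss \<epsilon>) (\<lambda>z. game_value \<epsilon> j (y + z))"
proof -
  interpret g: prob_space "gauss \<epsilon>" by (rule prob_space_gauss) fact
  note [measurable] = game_value_measurable[OF assms]
  show ?thesis
    by (rule g.integrable_const_bound[of _ K]) (use game_value_le[OF assms] game_value_nonneg in auto)
qed

lemma game_value_le_supersolution:
  assumes \<epsilon>: "\<epsilon> > 0" and i: "\<epsilon> * real i \<le> s'"
    and start: "\<And>y. game_value \<epsilon> j y \<le> w (\<epsilon> * real i) y"
    and dom: "\<And>s y. 0 \<le> s \<Longrightarrow> s \<le> s' \<Longrightarrow> claim y \<le> w s y"
    and int: "\<And>s y. 0 \<le> s \<Longrightarrow> s \<le> s' \<Longrightarrow> integrable (gauss \<epsilon>) (\<lambda>z. w s (y + z))"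
    and super: "\<And>s y. 0 \<le> s \<Longrightarrow> s + \<epsilon> \<le> s' \<Longrightarrow> (\<integral>z. w (s + \<epsilon>) (y + z) \<partial>gauss \<epsilon>) \<le> w s y + \<epsilon> * c * penalty y"
  shows "game_value \<epsilon> (j + i) y \<le> w 0 y"
proof -
  have "game_value \<epsilon> (j + k) y \<le> w (\<epsilon> * real (i - k)) y" if "k \<le> i" for k y
    using that
  proof (induction k arbitrary: y)
    case 0
    then show ?case using start by simp
  next
    case (Suc k)
    let ?s = "\<epsilon> * real (i - Suc k)"
    have s: "?s + \<epsilon> = \<epsilon> * real (i - k)"
      using Suc.prems by (simp add: of_nat_diff algebra_simps)
    have "\<epsilon> * real (i - k) \<le> \<epsilon> * real i"
      using \<epsilon> by (intro mult_left_mono) auto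
    with i have s': "\<epsilon> * real (i - k) \<le> s'" by simp
    have s0: "0 \<le> ?s" "0 \<le> \<epsilon> * real (i - k)" using \<epsilon> by auto
    have "(\<integral>z. game_value \<epsilon> (j + k) (y + z) \<partial>gauss \<epsilon>) \<le> (\<integral>z. w (\<epsilon> * real (i - k)) (y + z) \<partial>gauss \<epsilon>)"
      by (rule integral_mono) (use game_value_integrable[OF \<epsilon>] int[OF s0(2) s'] Suc in auto)
    also have "\<dots> \<le> w ?s y + \<epsilon> * c * penalty y"
      using super[OF s0(1), of y] s' unfolding s by simp
    finally show ?case using dom[OF s0(1), of y] s' s \<epsilon> by simp
  qed
  from this[of i y] show ?thesis by simp
qed

text \<open>The penalty seen with the shorter look-ahead \<open>\<delta> - s\<close>. As a function of time and position it is a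
  martingale, which the penalty itself is not.\<close>

definition "q s y = gauss_cdf (\<delta> - s) (\<beta> - y)"

text \<open>The factor makes \<open>c' * q\<close> a lower bound for \<open>c\<close> times the penalty also at positions below \<open>\<beta>\<close>, where a
  shorter look-ahead increases the probability.\<close>

definition "c' = c * gauss_cdf \<delta> 0"

lemma c'_pos: "c' > 0"
proof -
  have "0 < normal_density 0 (sqrt \<delta>) (0 + 1)" using \<delta>_pos by (intro normal_density_pos) simp
  also have "\<dots> \<le> gauss_cdf \<delta> (- 0)" by (rule gauss_cdf_lower) (use \<delta>_pos in auto)
  finally show ?thesis using c_pos by (simp add: c'_def)
qed

lemma q_le_penalty:
  assumes "0 \<le> s" "s < \<delta>"
  shows "c' * q s y \<le> c * penalty y"
proof (cases "y \<ge> \<beta>")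
  case True
  have "gauss_cdf \<delta> 0 * q s y \<le> 1 * penalty y"
    using gauss_cdf_bounds[OF \<delta>_pos] gauss_cdf_bounds[of "\<delta> - s"] assms True
      gauss_cdf_variance_mono[of "\<delta> - s" \<delta> "\<beta> - y"]
    by (intro mult_mono) (auto simp: q_def penalty_def)
  then show ?thesis using c_pos by (simp add: c'_def mult.assoc)
next
  case False
  have "gauss_cdf \<delta> 0 * q s y \<le> penalty y * 1"
    using gauss_cdf_bounds[OF \<delta>_pos] gauss_cdf_bounds[of "\<delta> - s"] assms False
      gauss_cdf_mono[OF \<delta>_pos, of 0 "\<beta> - y"]
    by (intro mult_mono) (auto simp: q_def penalty_def)
  then show ?thesis using c_pos by (simp add: c'_def mult.assoc)
qed

text \<open>The first summand is a martingale: an exponential martingale with slope parameter \<open>\<theta>\<close> minus its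
  tangent in space at time \<open>0\<close> and position \<open>z\<close>. It bounds the probability of reaching a target in
  due time, but it becomes negative near \<open>z\<close> as time passes. The second summand compensates for
  this at a cost that the penalty covers: its drift is \<open>c' * q\<close>. Both vanish at time \<open>0\<close> and
  position \<open>z\<close>.\<close>

definition supersolution :: "real \<Rightarrow> real \<Rightarrow> real \<Rightarrow> real \<Rightarrow> real \<Rightarrow> real" where
  "supersolution a \<theta> z s y = a * (exp (- \<theta> * (y - z) - \<theta>\<^sup>2 * s / 2) - 1 + \<theta> * (y - z)) + c' * s * q s y"

lemma supersolution_integral:
  assumes \<epsilon>: "\<epsilon> > 0" and s: "s < \<delta>"
  shows "integrable (gauss \<epsilon>) (\<lambda>x. supersolution a \<theta> z s (y + x))"
    "(\<integral>x. supersolution a \<theta> z s (y + x) \<partial>gauss \<epsilon>) =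
      a * (exp (- \<theta> * (y - z) - \<theta>\<^sup>2 * (s - \<epsilon>) / 2) - 1 + \<theta> * (y - z)) + c' * s * q (s - \<epsilon>) y"
proof -
  interpret G: prob_space "gauss \<epsilon>" by (rule prob_space_gauss) fact
  have eq: "supersolution a \<theta> z s (y + x) = a * exp (- \<theta> * (y - z) - \<theta>\<^sup>2 * s / 2) * exp ((- \<theta>) * x)
      + (a * (\<theta> * (y - z) - 1) + a * \<theta> * x) + c' * s * gauss_cdf (\<delta> - s) ((\<beta> - y) - x)" for x
    by (simp add: supersolution_def q_def exp_add[symmetric] mult.assoc algebra_simps)
  have s': "\<delta> - s > 0" using s by simp
  note I = gauss_exp(1)[OF \<epsilon>, of "- \<theta>"] gauss_id(1)[OF \<epsilon>] gauss_cdf_integrable[OF s' \<epsilon>, of "\<beta> - y"]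
  show "integrable (gauss \<epsilon>) (\<lambda>x. supersolution a \<theta> z s (y + x))"
    unfolding eq using I by (intro Bochner_Integration.integrable_add integrable_mult_right) auto
  have "(\<integral>x. supersolution a \<theta> z s (y + x) \<partial>gauss \<epsilon>) = a * exp (- \<theta> * (y - z) - \<theta>\<^sup>2 * s / 2) * exp ((- \<theta>)\<^sup>2 * \<epsilon> / 2)
      + (a * (\<theta> * (y - z) - 1) + a * \<theta> * 0) + c' * s * gauss_cdf ((\<delta> - s) + \<epsilon>) (\<beta> - y)"
    unfolding eq using I gauss_exp(2)[OF \<epsilon>, of "- \<theta>"] gauss_id(2)[OF \<epsilon>] gauss_cdf_semigroup[OF s' \<epsilon>, of "\<beta> - y"]
    by (simp add: G.prob_space[simplified])
  also have "\<dots> = a * (exp (- \<theta> * (y - z) - \<theta>\<^sup>2 * (s - \<epsilon>) / 2) - 1 + \<theta> * (y - z)) + c' * s * q (s - \<epsilon>) y"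
  proof -
    have "exp (- \<theta> * (y - z) - \<theta>\<^sup>2 * s / 2) * exp ((- \<theta>)\<^sup>2 * \<epsilon> / 2) = exp (- \<theta> * (y - z) - \<theta>\<^sup>2 * (s - \<epsilon>) / 2)"
      unfolding exp_add[symmetric] by (simp add: field_simps)
    moreover have "\<delta> - s + \<epsilon> = \<delta> - (s - \<epsilon>)" by simp
    ultimately show ?thesis unfolding q_def by (simp add: algebra_simps)
  qed
  finally show "(\<integral>x. supersolution a \<theta> z s (y + x) \<partial>gauss \<epsilon>) =
      a * (exp (- \<theta> * (y - z) - \<theta>\<^sup>2 * (s - \<epsilon>) / 2) - 1 + \<theta> * (y - z)) + c' * s * q (s - \<epsilon>) y" .
qed

lemma supersolution_kernel:
  assumes "\<epsilon> > 0" "0 \<le> s" "s + \<epsilon> < \<delta>"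
  shows "(\<integral>x. supersolution a \<theta> z (s + \<epsilon>) (y + x) \<partial>gauss \<epsilon>) \<le> supersolution a \<theta> z s y + \<epsilon> * c * penalty y"
proof -
  have "(\<integral>x. supersolution a \<theta> z (s + \<epsilon>) (y + x) \<partial>gauss \<epsilon>) = supersolution a \<theta> z s y + \<epsilon> * (c' * q s y)"
    using supersolution_integral(2)[OF assms(1,3), of a \<theta> z y] by (simp add: supersolution_def algebra_simps)
  also have "\<epsilon> * (c' * q s y) \<le> \<epsilon> * (c * penalty y)"
    by (rule mult_left_mono[OF q_le_penalty]) (use assms in auto)
  finally show ?thesis by (simp add: mult.assoc)
qed

text \<open>Up to \<open>z + 1\<close> the inequality \<open>1 + u \<le> exp u\<close> shows that the martingale part is at least
  \<open>- a * \<theta>\<^sup>2 * s / 2\<close>, which is small against \<open>c' * s\<close> times the smallest value of \<open>q\<close> on this range.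
  Beyond \<open>z + 1\<close> the linear part alone is nonnegative.\<close>

lemma supersolution_nonneg:
  assumes a: "a \<ge> 0" and \<theta>: "\<theta> \<ge> 1" and s: "0 \<le> s" "s \<le> \<delta> / 4" and z: "z + 1 \<ge> \<beta>"
    and small: "a * \<theta>\<^sup>2 / 2 \<le> c' * (exp (- 2 * (z + 2 - \<beta>)\<^sup>2 / (3 * \<delta>)) / sqrt (2 * pi * \<delta>))"
  shows "0 \<le> supersolution a \<theta> z s y"
proof (cases "y \<le> z + 1")
  case True
  have d: "\<delta> - s > 0" "\<delta> - s \<le> \<delta>" "3 * \<delta> / 4 \<le> \<delta> - s" using s \<delta>_pos by auto
  have "exp (- 2 * (z + 2 - \<beta>)\<^sup>2 / (3 * \<delta>)) / sqrt (2 * pi * \<delta>) \<le> normal_density 0 (sqrt (\<delta> - s)) ((z + 1 - \<beta>) + 1)"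
  proof -
    have "(z + 2 - \<beta>)\<^sup>2 / (2 * (\<delta> - s)) \<le> (z + 2 - \<beta>)\<^sup>2 / (2 * (3 * \<delta> / 4))"
      using d \<delta>_pos by (intro divide_left_mono) auto
    then have "exp (- 2 * (z + 2 - \<beta>)\<^sup>2 / (3 * \<delta>)) \<le> exp (- (z + 2 - \<beta>)\<^sup>2 / (2 * (\<delta> - s)))"
      by simp
    moreover have "1 / sqrt (2 * pi * \<delta>) \<le> 1 / sqrt (2 * pi * (\<delta> - s))"
      using d by (intro divide_left_mono) (auto intro!: mult_pos_pos)
    ultimately have "1 / sqrt (2 * pi * \<delta>) * exp (- 2 * (z + 2 - \<beta>)\<^sup>2 / (3 * \<delta>)) \<le>
       1 / sqrt (2 * pi * (\<delta> - s)) * exp (- (z + 2 - \<beta>)\<^sup>2 / (2 * (\<delta> - s)))"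
      using d by (intro mult_mono) auto
    moreover have "(z + 1 - \<beta>) + 1 = z + 2 - \<beta>" by simp
    ultimately show ?thesis
      using d by (simp only: normal_density_def) (simp add: algebra_simps)
  qed
  also have "\<dots> \<le> gauss_cdf (\<delta> - s) (- (z + 1 - \<beta>))"
    by (rule gauss_cdf_lower) (use d z in auto)
  also have "\<dots> \<le> q s y"
    unfolding q_def by (rule gauss_cdf_mono) (use d True in auto)
  finally have "exp (- 2 * (z + 2 - \<beta>)\<^sup>2 / (3 * \<delta>)) / sqrt (2 * pi * \<delta>) \<le> q s y" .
  from order_trans[OF small mult_left_mono[OF this less_imp_le[OF c'_pos]]]
  have "a * \<theta>\<^sup>2 / 2 \<le> c' * q s y" .
  then have 1: "s * (a * \<theta>\<^sup>2 / 2) \<le> s * (c' * q s y)"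
    using s by (intro mult_left_mono) auto
  have "a * (- (\<theta>\<^sup>2 * s / 2)) \<le> a * (exp (- \<theta> * (y - z) - \<theta>\<^sup>2 * s / 2) - 1 + \<theta> * (y - z))"
  proof (rule mult_left_mono[OF _ a])
    have "1 + (- \<theta> * (y - z) - \<theta>\<^sup>2 * s / 2) \<le> exp (- \<theta> * (y - z) - \<theta>\<^sup>2 * s / 2)"
      by (rule exp_ge_add_one_self)
    then show "- (\<theta>\<^sup>2 * s / 2) \<le> exp (- \<theta> * (y - z) - \<theta>\<^sup>2 * s / 2) - 1 + \<theta> * (y - z)"
      by linarith
  qed
  with 1 show ?thesis unfolding supersolution_def by (simp add: algebra_simps)
next
  case False
  have "1 * 1 \<le> \<theta> * (y - z)" using False \<theta> by (intro mult_mono) auto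
  then have "0 \<le> exp (- \<theta> * (y - z) - \<theta>\<^sup>2 * s / 2) - 1 + \<theta> * (y - z)"
    using exp_gt_zero[of "- \<theta> * (y - z) - \<theta>\<^sup>2 * s / 2"] by linarith
  moreover have "0 \<le> c' * s * q s y"
    using c'_pos s gauss_cdf_bounds[of "\<delta> - s"] \<delta>_pos by (simp add: q_def)
  ultimately show ?thesis unfolding supersolution_def using a by simp
qed

text \<open>With this \<open>a\<close> the exponential martingale is at least \<open>2 * K\<close> on the target at all times up to
  \<open>\<delta> / 4\<close>, and the tangent takes away at most half of it.\<close>

lemma supersolution_ge_K:
  assumes s: "0 \<le> s" "s \<le> \<delta> / 4" and y: "y \<le> l" and z: "l \<le> z" and \<theta>: "\<theta> > 0"
    and a: "a = 2 * K * exp (- \<theta> * (z - l) + \<theta>\<^sup>2 * \<delta> / 8)" and small: "a * (1 + \<theta> * (z - l)) \<le> K"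
  shows "K \<le> supersolution a \<theta> z s y"
proof -
  have a0: "a \<ge> 0" using K_pos by (simp add: a)
  have "2 * K * exp (\<theta> * (l - y)) = a * exp (\<theta> * (z - l) - \<theta>\<^sup>2 * \<delta> / 8) * exp (\<theta> * (l - y))"
    unfolding a by (simp add: exp_add[symmetric])
  also have "\<dots> = a * exp (- \<theta> * (y - z) - \<theta>\<^sup>2 * (\<delta> / 4) / 2)"
    unfolding mult.assoc exp_add[symmetric] by (simp add: algebra_simps)
  also have "\<dots> \<le> a * exp (- \<theta> * (y - z) - \<theta>\<^sup>2 * s / 2)"
  proof (rule mult_left_mono[OF _ a0])
    have "\<theta>\<^sup>2 * s \<le> \<theta>\<^sup>2 * (\<delta> / 4)" by (rule mult_left_mono[OF s(2)]) simp
    then show "exp (- \<theta> * (y - z) - \<theta>\<^sup>2 * (\<delta> / 4) / 2) \<le> exp (- \<theta> * (y - z) - \<theta>\<^sup>2 * s / 2)"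
      unfolding exp_le_cancel_iff by linarith
  qed
  finally have 1: "2 * K * exp (\<theta> * (l - y)) \<le> a * exp (- \<theta> * (y - z) - \<theta>\<^sup>2 * s / 2)" .
  have "a * (1 + \<theta> * (z - y)) \<le> a * (1 + \<theta> * (z - l)) * (1 + \<theta> * (l - y))"
  proof -
    have "0 \<le> (\<theta> * (z - l)) * (\<theta> * (l - y))" using y z \<theta> by (intro mult_nonneg_nonneg) auto
    then have "1 + \<theta> * (z - y) \<le> (1 + \<theta> * (z - l)) * (1 + \<theta> * (l - y))"
      by (simp add: algebra_simps)
    then show ?thesis using a0 by (simp add: mult.assoc mult_left_mono)
  qed
  also have "\<dots> \<le> K * exp (\<theta> * (l - y))"
    using small exp_ge_add_one_self[of "\<theta> * (l - y)"] y \<theta> K_pos by (intro mult_mono) auto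
  finally have 2: "a * (1 + \<theta> * (z - y)) \<le> K * exp (\<theta> * (l - y))" .
  have "1 \<le> exp (\<theta> * (l - y))" using y \<theta> by simp
  then have "K \<le> K * exp (\<theta> * (l - y))" using K_pos by simp
  moreover have "0 \<le> c' * s * q s y"
    using c'_pos s gauss_cdf_bounds[of "\<delta> - s"] \<delta>_pos by (simp add: q_def)
  ultimately show ?thesis using 1 2 unfolding supersolution_def by (simp add: algebra_simps)
qed

text \<open>The inequality involving \<open>c'\<close> compares the two Gaussian orders of magnitude and uses
  \<open>2 * (t + m)\<^sup>2 \<le> 3 * (t\<^sup>2 + 2 * m\<^sup>2)\<close> to absorb the distance between the target \<open>l\<close> and the
  level \<open>\<beta>\<close>. The value \<open>\<theta> = 4 * (z - l) / \<delta>\<close> is the one that minimises the bound for the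
  probability of travelling from \<open>z\<close> to \<open>l\<close> within time \<open>\<delta> / 4\<close>.\<close>

lemma eventually_small:
  shows "eventually (\<lambda>z. z \<ge> l + \<delta> \<and> z + 1 \<ge> \<beta> \<and>
     2 * K * exp (- 2 * (z - l)\<^sup>2 / \<delta>) * (4 * (z - l) / \<delta>)\<^sup>2 / 2 \<le>
       c' * (exp (- 2 * (z + 2 - \<beta>)\<^sup>2 / (3 * \<delta>)) / sqrt (2 * pi * \<delta>)) \<and>
     2 * K * exp (- 2 * (z - l)\<^sup>2 / \<delta>) * (1 + 4 * (z - l) / \<delta> * (z - l)) \<le> K) at_top"
proof -
  define m where "m = l + 2 - \<beta>"
  define C where "C = c' * exp (- 2 * m\<^sup>2 / \<delta>) / sqrt (2 * pi * \<delta>)"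
  have C: "C > 0" using c'_pos \<delta>_pos by (simp add: C_def)
  define u where "u z = (z - l)\<^sup>2 / \<delta>" for z
  have u: "filterlim u at_top at_top"
  proof -
    have "filterlim (\<lambda>z. - l + z) at_top (at_top :: real filter)"
      by (rule filterlim_tendsto_add_at_top[OF tendsto_const filterlim_ident])
    then have "filterlim (\<lambda>z. (- l + z) ^ 2) at_top (at_top :: real filter)"
      by (rule filterlim_pow_at_top[rotated]) simp
    then have "filterlim (\<lambda>z. (1 / \<delta>) * (- l + z) ^ 2) at_top (at_top :: real filter)"
      by (rule filterlim_tendsto_pos_mult_at_top[OF tendsto_const, rotated]) (use \<delta>_pos in simp)
    then show ?thesis by (simp add: u_def[abs_def])
  qed
  have "((\<lambda>x. 16 * K / \<delta> * (x ^ 1 / exp x)) \<longlongrightarrow> 16 * K / \<delta> * 0) (at_top :: real filter)"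
    by (intro tendsto_mult tendsto_const tendsto_power_div_exp_0)
  then have "eventually (\<lambda>x. 16 * K / \<delta> * (x / exp x) < C) at_top"
    using C by (intro order_tendstoD(2)[of _ 0]) auto
  then have E1: "eventually (\<lambda>z. 16 * K / \<delta> * (u z / exp (u z)) < C) at_top"
    by (rule eventually_compose_filterlim[OF _ u])
  have E2: "eventually (\<lambda>z. 7 \<le> u z) at_top"
    using u by (simp add: filterlim_at_top)
  show ?thesis
    using E1 E2 eventually_ge_at_top[of "l + \<delta>"] eventually_ge_at_top[of "\<beta> - 1"]
  proof eventually_elim
    case (elim z)
    have "2 * K * exp (- 2 * (z - l)\<^sup>2 / \<delta>) * (4 * (z - l) / \<delta>)\<^sup>2 / 2 =
      (16 * K / \<delta> * (u z / exp (u z))) * exp (- u z)"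
    proof -
      have "(4 * (z - l) / \<delta>)\<^sup>2 = 16 / \<delta> * u z"
        using \<delta>_pos by (simp add: u_def power2_eq_square field_simps)
      moreover have "exp (- 2 * (z - l)\<^sup>2 / \<delta>) = exp (- u z) * exp (- u z)"
        unfolding exp_add[symmetric] by (simp add: u_def)
      ultimately show ?thesis by (simp add: exp_minus field_simps)
    qed
    also have "\<dots> \<le> C * exp (- u z)" using elim(1) by (intro mult_right_mono) auto
    also have "\<dots> = c' / sqrt (2 * pi * \<delta>) * exp (- 2 * m\<^sup>2 / \<delta> - u z)"
      by (simp add: C_def exp_diff exp_minus field_simps)
    also have "\<dots> \<le> c' / sqrt (2 * pi * \<delta>) * exp (- 2 * (z + 2 - \<beta>)\<^sup>2 / (3 * \<delta>))"
    proof (intro mult_left_mono)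
      have "0 \<le> ((z - l) - 2 * m)\<^sup>2" by simp
      then have "2 * ((z - l) + m)\<^sup>2 \<le> 3 * ((z - l)\<^sup>2 + 2 * m\<^sup>2)"
        by (simp add: power2_eq_square algebra_simps)
      then have "2 * (z + 2 - \<beta>)\<^sup>2 \<le> 3 * ((z - l)\<^sup>2 + 2 * m\<^sup>2)"
        by (simp add: m_def algebra_simps)
      then have "2 * (z + 2 - \<beta>)\<^sup>2 / (3 * \<delta>) \<le> 3 * ((z - l)\<^sup>2 + 2 * m\<^sup>2) / (3 * \<delta>)"
        using \<delta>_pos by (intro divide_right_mono) auto
      also have "\<dots> = u z + 2 * m\<^sup>2 / \<delta>"
        using \<delta>_pos by (simp add: u_def field_simps)
      finally show "exp (- 2 * m\<^sup>2 / \<delta> - u z) \<le> exp (- 2 * (z + 2 - \<beta>)\<^sup>2 / (3 * \<delta>))"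
        by simp
    qed (use c'_pos \<delta>_pos in simp)
    finally have 1: "2 * K * exp (- 2 * (z - l)\<^sup>2 / \<delta>) * (4 * (z - l) / \<delta>)\<^sup>2 / 2 \<le>
       c' * (exp (- 2 * (z + 2 - \<beta>)\<^sup>2 / (3 * \<delta>)) / sqrt (2 * pi * \<delta>))"
      by simp
    have 2: "2 * K * exp (- 2 * (z - l)\<^sup>2 / \<delta>) * (1 + 4 * (z - l) / \<delta> * (z - l)) \<le> K"
    proof -
      have "7 * u z \<le> u z * u z" using elim(2) by (intro mult_right_mono) auto
      then have "2 + 8 * u z \<le> 1 + 2 * u z + u z * u z" using elim(2) by linarith
      then have "2 * (1 + 4 * u z) \<le> 1 + 2 * u z + u z * u z" by (simp only: distrib_left)
      also have "\<dots> = (1 + u z) * (1 + u z)" by (simp add: algebra_simps)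
      also have "\<dots> \<le> exp (u z) * exp (u z)"
        using elim(2) by (intro mult_mono exp_ge_add_one_self) auto
      finally have "2 * (1 + 4 * u z) * exp (- (2 * u z)) \<le> 1"
        by (simp add: exp_minus exp_add[symmetric] field_simps)
      then have "K * (2 * (1 + 4 * u z) * exp (- (2 * u z))) \<le> K" using K_pos by simp
      moreover have "2 * K * exp (- 2 * (z - l)\<^sup>2 / \<delta>) * (1 + 4 * (z - l) / \<delta> * (z - l)) =
        K * (2 * (1 + 4 * u z) * exp (- (2 * u z)))"
        by (simp add: u_def power2_eq_square)
      ultimately show ?thesis by (simp only:)
    qed
    show ?case using 1 2 elim by simp
  qed
qed

text \<open>If stopping is optimal above \<open>l\<close> when little time is left, the value at that moment is at most \<open>K\<close>
  below \<open>l\<close> and zero above, which the supersolution for the target \<open>l\<close> dominates.\<close>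

lemma game_value_vanishes_step:
  assumes l: "\<kappa> \<le> l" and IH: "\<And>\<epsilon> j y. 0 < \<epsilon> \<Longrightarrow> \<epsilon> \<le> \<delta> / 8 \<Longrightarrow> \<epsilon> * real j \<le> real n * (\<delta> / 8) \<Longrightarrow> l \<le> y \<Longrightarrow> game_value \<epsilon> j y = 0"
  shows "\<exists>l'\<ge>l. \<forall>\<epsilon> j y. 0 < \<epsilon> \<longrightarrow> \<epsilon> \<le> \<delta> / 8 \<longrightarrow> \<epsilon> * real j \<le> real (Suc n) * (\<delta> / 8) \<longrightarrow> l' \<le> y \<longrightarrow> game_value \<epsilon> j y = 0"
proof -
  obtain l' where l': "\<And>z. z \<ge> l' \<Longrightarrow> z \<ge> l + \<delta> \<and> z + 1 \<ge> \<beta> \<and>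
     2 * K * exp (- 2 * (z - l)\<^sup>2 / \<delta>) * (4 * (z - l) / \<delta>)\<^sup>2 / 2 \<le>
       c' * (exp (- 2 * (z + 2 - \<beta>)\<^sup>2 / (3 * \<delta>)) / sqrt (2 * pi * \<delta>)) \<and>
     2 * K * exp (- 2 * (z - l)\<^sup>2 / \<delta>) * (1 + 4 * (z - l) / \<delta> * (z - l)) \<le> K"
    using eventually_small[of l] unfolding eventually_at_top_linorder by blast
  have "game_value \<epsilon> j z = 0" if \<epsilon>: "0 < \<epsilon>" "\<epsilon> \<le> \<delta> / 8" and j: "\<epsilon> * real j \<le> real (Suc n) * (\<delta> / 8)"
    and z: "l' \<le> z" for \<epsilon> j z
  proof (cases "\<epsilon> * real j \<le> real n * (\<delta> / 8)")
    case True
    show ?thesis by (rule IH[OF \<epsilon> True]) (use l'[OF z] \<delta>_pos in auto)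
  next
    case False
    \<comment> \<open>the largest number of steps to go to which the induction hypothesis applies; the remaining
      \<open>i\<close> steps take at most \<open>\<delta> / 8 + \<epsilon>\<close>, hence the bound \<open>\<delta> / 4\<close>\<close>
    define j0 where "j0 = nat \<lfloor>real n * (\<delta> / 8) / \<epsilon>\<rfloor>"
    have r0: "real j0 \<le> real n * (\<delta> / 8) / \<epsilon>" "real n * (\<delta> / 8) / \<epsilon> < real j0 + 1"
      unfolding j0_def using \<epsilon> \<delta>_pos by (auto simp: of_nat_nat)
    have j0: "\<epsilon> * real j0 \<le> real n * (\<delta> / 8)" "real n * (\<delta> / 8) < \<epsilon> * real j0 + \<epsilon>"
      using r0 \<epsilon> by (auto simp: field_simps)
    have "\<epsilon> * real j0 < \<epsilon> * real j" using False j0 by linarith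
    then have "j0 \<le> j" using \<epsilon> by simp
    then obtain i where i: "j = j0 + i" using le_Suc_ex by blast
    have i4: "\<epsilon> * real i \<le> \<delta> / 4"
      using j j0 \<epsilon> unfolding i by (simp add: algebra_simps)
    define \<theta> where "\<theta> = 4 * (z - l) / \<delta>"
    define a where "a = 2 * K * exp (- \<theta> * (z - l) + \<theta>\<^sup>2 * \<delta> / 8)"
    have "- \<theta> * (z - l) + \<theta>\<^sup>2 * \<delta> / 8 = - 2 * (z - l)\<^sup>2 / \<delta>"
      using \<delta>_pos by (simp add: \<theta>_def field_simps power2_eq_square)
    then have a': "a = 2 * K * exp (- 2 * (z - l)\<^sup>2 / \<delta>)" by (simp add: a_def)
    have a0: "a \<ge> 0" using K_pos by (simp add: a_def)
    have zl: "l \<le> z" using l'[OF z] \<delta>_pos by auto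
    have \<theta>1: "\<theta> \<ge> 1" using l'[OF z] \<delta>_pos by (simp add: \<theta>_def field_simps)
    have nonneg: "0 \<le> supersolution a \<theta> z s y" if "0 \<le> s" "s \<le> \<delta> / 4" for s y
      by (rule supersolution_nonneg[OF a0 \<theta>1 that]) (use l'[OF z] in \<open>auto simp: a' \<theta>_def\<close>)
    have geK: "K \<le> supersolution a \<theta> z s y" if "0 \<le> s" "s \<le> \<delta> / 4" "y \<le> l" for s y
      by (rule supersolution_ge_K[OF that zl _ a_def]) (use l'[OF z] \<theta>1 in \<open>auto simp: a' \<theta>_def\<close>)
    have ge: "(if y \<le> l then K else 0) \<le> supersolution a \<theta> z s y" if "0 \<le> s" "s \<le> \<delta> / 4" for s y
      using nonneg[OF that] geK[OF that] by simp
    have "game_value \<epsilon> (j0 + i) z \<le> supersolution a \<theta> z 0 z"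
    proof (rule game_value_le_supersolution[OF \<epsilon>(1) i4, where w = "supersolution a \<theta> z"])
      fix y :: real
      have "game_value \<epsilon> j0 y \<le> (if y \<le> l then K else 0)"
        using game_value_le[OF \<epsilon>(1), of j0 y] IH[OF \<epsilon> j0(1), of y] by auto
      also have "\<dots> \<le> supersolution a \<theta> z (\<epsilon> * real i) y" by (rule ge) (use \<epsilon> i4 in auto)
      finally show "game_value \<epsilon> j0 y \<le> supersolution a \<theta> z (\<epsilon> * real i) y" .
    next
      fix s y :: real assume "0 \<le> s" "s \<le> \<delta> / 4"
      from ge[OF this, of y] show "claim y \<le> supersolution a \<theta> z s y"
        using l K_pos by (auto simp: claim_def split: split_indicator if_splits)
    next
      fix s y :: real assume "0 \<le> s" "s \<le> \<delta> / 4"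
      then show "integrable (gauss \<epsilon>) (\<lambda>x. supersolution a \<theta> z s (y + x))"
        by (intro supersolution_integral \<epsilon>) (use \<delta>_pos in auto)
    next
      fix s y :: real assume "0 \<le> s" "s + \<epsilon> \<le> \<delta> / 4"
      then show "(\<integral>x. supersolution a \<theta> z (s + \<epsilon>) (y + x) \<partial>gauss \<epsilon>) \<le> supersolution a \<theta> z s y + \<epsilon> * c * penalty y"
        by (intro supersolution_kernel \<epsilon>) (use \<delta>_pos in auto)
    qed
    also have "supersolution a \<theta> z 0 z = 0" by (simp add: supersolution_def)
    finally show ?thesis using game_value_nonneg[of \<epsilon> j z] by (simp add: i)
  qed
  moreover have "l' \<ge> l" using l'[OF order_refl] \<delta>_pos by auto
  ultimately show ?thesis by blast
qed

lemma game_value_vanishes: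
  "\<exists>l. \<forall>\<epsilon> j y. 0 < \<epsilon> \<longrightarrow> \<epsilon> \<le> \<delta> / 8 \<longrightarrow> \<epsilon> * real j \<le> H \<longrightarrow> l \<le> y \<longrightarrow> game_value \<epsilon> j y = 0"
proof -
  have "\<exists>l\<ge>\<kappa>. \<forall>\<epsilon> j y. 0 < \<epsilon> \<longrightarrow> \<epsilon> \<le> \<delta> / 8 \<longrightarrow> \<epsilon> * real j \<le> real n * (\<delta> / 8) \<longrightarrow> l \<le> y \<longrightarrow> game_value \<epsilon> j y = 0" for n
  proof (induction n)
    case 0
    have "game_value \<epsilon> j y = 0" if "0 < \<epsilon>" "\<epsilon> * real j \<le> 0" "\<kappa> + 1 \<le> y" for \<epsilon> j y
    proof -
      have "j = 0" using that by (simp add: mult_le_0_iff)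
      then show ?thesis using that by (simp add: claim_def)
    qed
    then show ?case by (intro exI[of _ "\<kappa> + 1"]) auto
  next
    case (Suc n)
    then obtain l where "l \<ge> \<kappa>" "\<And>\<epsilon> j y. 0 < \<epsilon> \<Longrightarrow> \<epsilon> \<le> \<delta> / 8 \<Longrightarrow> \<epsilon> * real j \<le> real n * (\<delta> / 8) \<Longrightarrow> l \<le> y \<Longrightarrow> game_value \<epsilon> j y = 0"
      by blast
    from game_value_vanishes_step[OF this] obtain l' where l': "l \<le> l'"
      "\<forall>\<epsilon> j y. 0 < \<epsilon> \<longrightarrow> \<epsilon> \<le> \<delta> / 8 \<longrightarrow> \<epsilon> * real j \<le> real (Suc n) * (\<delta> / 8) \<longrightarrow> l' \<le> y \<longrightarrow> game_value \<epsilon> j y = 0"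
      by blast
    then show ?case using \<open>l \<ge> \<kappa>\<close> by (intro exI[of _ l'] conjI) auto
  qed
  moreover obtain n :: nat where n: "H / (\<delta> / 8) \<le> real n" using real_arch_simple[of "H / (\<delta> / 8)"] by auto
  ultimately obtain l where l: "\<And>\<epsilon> j y. 0 < \<epsilon> \<Longrightarrow> \<epsilon> \<le> \<delta> / 8 \<Longrightarrow> \<epsilon> * real j \<le> real n * (\<delta> / 8) \<Longrightarrow> l \<le> y \<Longrightarrow> game_value \<epsilon> j y = 0"
    by metis
  have "H \<le> real n * (\<delta> / 8)" using n \<delta>_pos by (simp add: field_simps)
  then have "game_value \<epsilon> j y = 0" if "0 < \<epsilon>" "\<epsilon> \<le> \<delta> / 8" "\<epsilon> * real j \<le> H" "l \<le> y" for \<epsilon> j y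
    by (intro l that order_trans[OF that(3)])
  then show ?thesis by blast
qed

end

section \<open>Boundedness of the upper boundary\<close>

context swing
begin

lemma exp_gap: "r * \<epsilon> * exp (- r * \<epsilon>) \<le> 1 - exp (- r * \<epsilon>)"
proof -
  have "1 + r * \<epsilon> \<le> exp (r * \<epsilon>)" by (rule exp_ge_add_one_self)
  then have "(1 + r * \<epsilon>) * exp (- (r * \<epsilon>)) \<le> exp (r * \<epsilon>) * exp (- (r * \<epsilon>))"
    by (rule mult_right_mono) simp
  then show ?thesis unfolding exp_add[symmetric] by (simp add: algebra_simps)
qed

text \<open>The player of the penalised problem is the driftless process \<open>ln x / \<sigma> + B\<close>, which differs from the
  logarithm of the price, divided by \<open>\<sigma>\<close>, by a bounded drift term. Taking that term at its worst over
  \<open>[0, T]\<close>, and the smallest discount factor, gives constants that do not depend on time.\<close>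

definition \<kappa>T :: "real \<Rightarrow> real" where "\<kappa>T T = (ln K + \<bar>r - \<sigma>\<^sup>2 / 2\<bar> * T) / \<sigma>"
definition \<beta>T :: "real \<Rightarrow> real" where "\<beta>T T = (ln x_star - \<bar>r - \<sigma>\<^sup>2 / 2\<bar> * T) / \<sigma>"
definition cT :: "real \<Rightarrow> real" where "cT T = exp (- r * \<delta>) * exp (- r * T) * r * (K / 2)"

lemma cT_pos: "cT T > 0" using r K by (simp add: cT_def)

lemma drift_bound:
  assumes "0 \<le> s" "s \<le> T"
  shows "\<bar>(r - \<sigma>\<^sup>2 / 2) * s\<bar> \<le> \<bar>r - \<sigma>\<^sup>2 / 2\<bar> * T"
  unfolding abs_mult using assms by (intro mult_mono) auto

lemma S_exp: "x > 0 \<Longrightarrow> S x s b = exp (\<sigma> * (ln x / \<sigma> + b) + (r - \<sigma>\<^sup>2 / 2) * s)"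
  using \<sigma> by (simp add: S_def exp_add distrib_left)

lemma payoff_le_claim:
  assumes x: "x > 0" and s: "0 \<le> s" "s \<le> T"
  shows "payoff (S x s b) \<le> K * indicator {..\<kappa>T T} (ln x / \<sigma> + b)"
proof (cases "ln x / \<sigma> + b \<le> \<kappa>T T")
  case True
  then show ?thesis using payoff_bounds(2) S_pos[OF x] by (simp add: less_imp_le)
next
  case False
  then have "\<sigma> * \<kappa>T T < \<sigma> * (ln x / \<sigma> + b)" using \<sigma> by simp
  then have "ln K + \<bar>r - \<sigma>\<^sup>2 / 2\<bar> * T < \<sigma> * (ln x / \<sigma> + b)" using \<sigma> by (simp add: \<kappa>T_def)
  then have "ln K \<le> \<sigma> * (ln x / \<sigma> + b) + (r - \<sigma>\<^sup>2 / 2) * s"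
    using drift_bound[OF s] by linarith
  then have "K \<le> S x s b"
    unfolding S_exp[OF x] using K by (metis exp_le_cancel_iff exp_ln)
  then show ?thesis using False by (simp add: payoff_def)
qed

lemma penalty_le_decrease:
  assumes x: "x > 0" and s: "0 \<le> s" "0 \<le> \<epsilon>" "s + \<epsilon> \<le> T" "s + \<delta> \<le> T"
  shows "\<epsilon> * cT T * gauss_cdf \<delta> (\<beta>T T - (ln x / \<sigma> + b)) \<le>
    exp (- r * s) * (exp (- r * \<delta>) * (1 - exp (- r * \<epsilon>)) * (K / 2) * measure (gauss \<delta>) {z. S (S x s b) \<delta> z \<le> x_star})"
proof -
  interpret gd: prob_space "gauss \<delta>" by (rule prob_space_gauss[OF \<delta>])
  let ?y = "ln x / \<sigma> + b"
  let ?E = "{z. S (S x s b) \<delta> z \<le> x_star}"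
  have "{..<\<beta>T T - ?y} \<subseteq> ?E"
  proof
    fix z assume "z \<in> {..<\<beta>T T - ?y}"
    then have "\<sigma> * (?y + z) \<le> \<sigma> * \<beta>T T" using \<sigma> by (intro mult_left_mono) auto
    then have "\<sigma> * (?y + z) \<le> ln x_star - \<bar>r - \<sigma>\<^sup>2 / 2\<bar> * T" using \<sigma> by (simp add: \<beta>T_def)
    then have "\<sigma> * (ln x / \<sigma> + (b + z)) + (r - \<sigma>\<^sup>2 / 2) * (s + \<delta>) \<le> ln x_star"
      using drift_bound[of "s + \<delta>" T] s \<delta> by (simp add: add.assoc)
    then have "exp (\<sigma> * (ln x / \<sigma> + (b + z)) + (r - \<sigma>\<^sup>2 / 2) * (s + \<delta>)) \<le> x_star"
      using x_star(1) by (metis exp_le_cancel_iff exp_ln)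
    moreover have "S (S x s b) \<delta> z = exp (\<sigma> * (ln x / \<sigma> + (b + z)) + (r - \<sigma>\<^sup>2 / 2) * (s + \<delta>))"
      using S_exp[OF x, of "s + \<delta>" "b + z"] unfolding S_add .
    ultimately show "z \<in> ?E" by simp
  qed
  moreover have "?E \<in> sets (gauss \<delta>)" by simp
  ultimately have E: "gauss_cdf \<delta> (\<beta>T T - ?y) \<le> gd.prob ?E"
    unfolding gauss_cdf_def by (rule gd.finite_measure_mono)
  have "exp (- r * T) * (r * \<epsilon>) \<le> exp (- r * s) * (1 - exp (- r * \<epsilon>))"
  proof -
    have "exp (- r * T) \<le> exp (- r * (s + \<epsilon>))" using s r by simp
    then have "exp (- r * T) * (r * \<epsilon>) \<le> exp (- r * (s + \<epsilon>)) * (r * \<epsilon>)"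
      using s r by (intro mult_right_mono) auto
    also have "\<dots> = exp (- r * s) * (r * \<epsilon> * exp (- r * \<epsilon>))"
    proof -
      have "exp (- r * (s + \<epsilon>)) = exp (- r * s) * exp (- r * \<epsilon>)"
        unfolding exp_add[symmetric] by (simp add: algebra_simps)
      then show ?thesis by (simp only: mult_ac)
    qed
    also have "\<dots> \<le> exp (- r * s) * (1 - exp (- r * \<epsilon>))"
      by (intro mult_left_mono exp_gap) simp
    finally show ?thesis .
  qed
  then have "exp (- r * \<delta>) * (K / 2) * (exp (- r * T) * (r * \<epsilon>)) \<le>
    exp (- r * \<delta>) * (K / 2) * (exp (- r * s) * (1 - exp (- r * \<epsilon>)))"
    using K by (intro mult_left_mono) auto
  from mult_mono[OF this E]
  have "exp (- r * \<delta>) * (K / 2) * (exp (- r * T) * (r * \<epsilon>)) * gauss_cdf \<delta> (\<beta>T T - ?y) \<le>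
    exp (- r * \<delta>) * (K / 2) * (exp (- r * s) * (1 - exp (- r * \<epsilon>))) * gd.prob ?E"
    using gauss_cdf_bounds[OF \<delta>] K r s by (simp add: mult_nonneg_nonneg)
  then show ?thesis by (simp only: cT_def mult_ac)
qed

lemma continuation_measurable:
  assumes "h \<ge> 0" "x > 0"
  shows "(\<lambda>b. ennreal (continuation h (S x s b))) \<in> borel_measurable borel"
proof -
  have "(\<lambda>p. put_value h (S x (s + \<delta>) (fst p + snd p))) \<in> borel_measurable (borel \<Otimes>\<^sub>M borel)"
    by (rule put_value_S_measurable[OF assms]) auto
  then have [measurable]: "(\<lambda>(b, z). put_value h (S (S x s b) \<delta> z)) \<in> borel_measurable (borel \<Otimes>\<^sub>M borel)"
    by (simp add: S_add split_beta')
  show ?thesis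
    unfolding ennreal_continuation[OF assms(1) S_pos[OF assms(2)]] by measurable
qed

text \<open>The discounted continuation value plus the value of the penalised problem is a supermartingale on
  the grid: the decrease of the former pays for the penalty in the latter. It dominates the reward, and
  it starts at the continuation value where the penalised problem is worthless.\<close>

lemma immediate_exercise_optimal:
  assumes T: "\<delta> \<le> T" and h: "0 < h" "h \<le> T - \<delta>" and x: "x > 0"
    and D0: "\<And>\<epsilon> j. 0 < \<epsilon> \<Longrightarrow> \<epsilon> \<le> \<delta> / 8 \<Longrightarrow> \<epsilon> * real j \<le> T \<Longrightarrow>
      penalised.game_value K (\<kappa>T T) (\<beta>T T) (cT T) \<delta> \<epsilon> j (ln x / \<sigma>) = 0"
    and \<tau>: "\<tau> \<in> stopping_times_upto M B h"
  shows "(\<integral>\<^sup>+\<omega>. ennreal (exp (- r * \<tau> \<omega>) * (payoff (S x (\<tau> \<omega>) (B (\<tau> \<omega>) \<omega>)) +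
      continuation (h - \<tau> \<omega>) (S x (\<tau> \<omega>) (B (\<tau> \<omega>) \<omega>)))) \<partial>M) \<le> ennreal (continuation h x)"
proof -
  interpret G: penalised K "\<kappa>T T" "\<beta>T T" "cT T" \<delta>
    by unfold_locales (use K cT_pos \<delta> in auto)
  obtain N0 :: nat where N0: "h / (\<delta> / 8) \<le> real N0" using real_arch_simple by blast
  \<comment> \<open>grids fine enough for the steps to be at most \<open>\<delta> / 8\<close>\<close>
  define N where "N n = Suc n + N0" for n
  define \<epsilon> where "\<epsilon> n = h / real (N n)" for n
  have N: "N n > 0" for n by (simp add: N_def)
  have \<epsilon>0: "\<epsilon> n > 0" for n using h N[of n] by (simp add: \<epsilon>_def)
  have \<epsilon>N: "\<epsilon> n * real (N n) = h" for n using N[of n] by (simp add: \<epsilon>_def)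
  have \<epsilon>8: "\<epsilon> n \<le> \<delta> / 8" for n
  proof -
    have "h / (\<delta> / 8) \<le> real (N n)" using N0 by (simp add: N_def)
    then have "h \<le> real (N n) * (\<delta> / 8)" using \<delta> by (simp add: field_simps)
    then show ?thesis using N[of n] unfolding \<epsilon>_def by (simp add: divide_le_eq mult.commute)
  qed
  have time: "\<epsilon> n * real k \<le> h" if "k \<le> N n" for n k
    using mult_left_mono[of "real k" "real (N n)" "\<epsilon> n"] that \<epsilon>0[of n] by (simp add: \<epsilon>N)
  define y0 where "y0 = ln x / \<sigma>"
  define f where "f s b = ennreal (exp (- r * s) * (payoff (S x s b) + continuation (h - s) (S x s b)))" for s b
  define m where "m n k b = (if k \<le> N n then
      ennreal (exp (- r * (\<epsilon> n * real k)) * continuation (h - \<epsilon> n * real k) (S x (\<epsilon> n * real k) b)) +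
      ennreal (G.game_value (\<epsilon> n) (N n - k) (y0 + b)) else 0)" for n k b
  have "(\<integral>\<^sup>+\<omega>. f (\<tau> \<omega>) (B (\<tau> \<omega>) \<omega>) \<partial>M) \<le> liminf (\<lambda>n. m n 0 0)"
  proof (rule optional_stopping[OF h(1) \<tau> N])
    show "filterlim N at_top sequentially"
      unfolding N_def by (rule filterlim_subseq) (auto simp: strict_mono_def)
  next
    fix n k
    show "m n k \<in> borel_measurable borel"
    proof (cases "k \<le> N n")
      case True
      have "h - \<epsilon> n * real k \<ge> 0" using time[OF True] by simp
      note [measurable] = continuation_measurable[OF this x] G.game_value_measurable[OF \<epsilon>0]
      have "m n k = (\<lambda>b. ennreal (exp (- r * (\<epsilon> n * real k))) * ennreal (continuation (h - \<epsilon> n * real k) (S x (\<epsilon> n * real k) b)) +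
        ennreal (G.game_value (\<epsilon> n) (N n - k) (y0 + b)))"
        using True by (auto simp: m_def ennreal_mult')
      also have "\<dots> \<in> borel_measurable borel" by measurable
      finally show ?thesis .
    qed (simp add: m_def[abs_def])
  next
    fix n k b assume k: "k < N n"
    define s where "s = \<epsilon> n * real k"
    let ?e = "\<epsilon> n" and ?X = "S x s b"
    have s: "0 \<le> s" "s + ?e \<le> h"
      using time[of "Suc k" n] k \<epsilon>0[of n] by (auto simp: s_def algebra_simps)
    have sk: "?e * real (Suc k) = s + ?e" by (simp add: s_def algebra_simps)
    have Nk: "N n - k = Suc (N n - Suc k)" using k by simp
    define P where "P = exp (- r * \<delta>) * (1 - exp (- r * ?e)) * (K / 2) * measure (gauss \<delta>) {z. S ?X \<delta> z \<le> x_star}"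
    have P0: "P \<ge> 0" using K \<epsilon>0[of n] r by (simp add: P_def)
    have pen: "?e * cT T * G.penalty (y0 + b) \<le> exp (- r * s) * P"
      unfolding P_def G.penalty_def y0_def
      by (rule penalty_le_decrease[OF x]) (use s h \<epsilon>0[of n] \<delta> in auto)
    have meas1: "(\<lambda>z. ennreal (exp (- r * ?e) * continuation (h - s - ?e) (S ?X ?e z))) \<in> borel_measurable (gauss ?e)"
    proof -
      have "h - s - ?e \<ge> 0" using s by simp
      note [measurable] = continuation_measurable[OF this S_pos[OF x]]
      show ?thesis by (simp add: ennreal_mult')
    qed
    have meas2: "(\<lambda>z. ennreal (G.game_value ?e (N n - Suc k) (y0 + b + z))) \<in> borel_measurable (gauss ?e)"
      using G.game_value_measurable[OF \<epsilon>0[of n], of "N n - Suc k"] by measurable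
    have D_int: "(\<integral>\<^sup>+z. ennreal (G.game_value ?e (N n - Suc k) (y0 + b + z)) \<partial>gauss ?e) \<le>
      ennreal (G.game_value ?e (N n - k) (y0 + b)) + ennreal (exp (- r * s) * P)"
    proof -
      have "(\<integral>\<^sup>+z. ennreal (G.game_value ?e (N n - Suc k) (y0 + b + z)) \<partial>gauss ?e) =
        ennreal (\<integral>z. G.game_value ?e (N n - Suc k) (y0 + b + z) \<partial>gauss ?e)"
        by (rule nn_integral_eq_integral[OF G.game_value_integrable[OF \<epsilon>0]]) (simp add: G.game_value_nonneg)
      also have "\<dots> \<le> ennreal (G.game_value ?e (N n - k) (y0 + b) + exp (- r * s) * P)"
        using pen unfolding Nk G.game_value.simps(2) by (intro ennreal_leI) linarith
      also have "\<dots> = ennreal (G.game_value ?e (N n - k) (y0 + b)) + ennreal (exp (- r * s) * P)"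
        using P0 by (intro ennreal_plus) (auto simp: G.game_value_nonneg)
      finally show ?thesis .
    qed
    have "(\<integral>\<^sup>+z. m n (Suc k) (b + z) \<partial>gauss ?e) =
      (\<integral>\<^sup>+z. ennreal (exp (- r * s)) * ennreal (exp (- r * ?e) * continuation (h - s - ?e) (S ?X ?e z)) +
        ennreal (G.game_value ?e (N n - Suc k) (y0 + b + z)) \<partial>gauss ?e)"
    proof (rule nn_integral_cong)
      fix z
      have "m n (Suc k) (b + z) = ennreal (exp (- r * (s + ?e)) * continuation (h - (s + ?e)) (S x (s + ?e) (b + z))) +
          ennreal (G.game_value ?e (N n - Suc k) (y0 + b + z))"
        using k unfolding m_def sk by (simp add: add.assoc)
      moreover have "exp (- r * (s + ?e)) = exp (- r * s) * exp (- r * ?e)"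
        unfolding exp_add[symmetric] by (simp add: algebra_simps)
      moreover have "h - (s + ?e) = h - s - ?e" by simp
      ultimately show "m n (Suc k) (b + z) =
          ennreal (exp (- r * s)) * ennreal (exp (- r * ?e) * continuation (h - s - ?e) (S ?X ?e z)) +
          ennreal (G.game_value ?e (N n - Suc k) (y0 + b + z))"
        by (simp only: S_add mult.assoc ennreal_mult'[OF exp_ge_zero])
    qed
    also have "\<dots> = ennreal (exp (- r * s)) * (\<integral>\<^sup>+z. ennreal (exp (- r * ?e) * continuation (h - s - ?e) (S ?X ?e z)) \<partial>gauss ?e) +
        (\<integral>\<^sup>+z. ennreal (G.game_value ?e (N n - Suc k) (y0 + b + z)) \<partial>gauss ?e)"
      using meas1 meas2 by (subst nn_integral_add) (auto simp: nn_integral_cmult)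
    also have "\<dots> \<le> ennreal (exp (- r * s)) * (\<integral>\<^sup>+z. ennreal (exp (- r * ?e) * continuation (h - s - ?e) (S ?X ?e z)) \<partial>gauss ?e) +
        (ennreal (G.game_value ?e (N n - k) (y0 + b)) + ennreal (exp (- r * s) * P))"
      by (rule add_left_mono[OF D_int])
    also have "\<dots> = ennreal (exp (- r * s)) * ((\<integral>\<^sup>+z. ennreal (exp (- r * ?e) * continuation (h - s - ?e) (S ?X ?e z)) \<partial>gauss ?e) + ennreal P)
        + ennreal (G.game_value ?e (N n - k) (y0 + b))"
      by (simp add: ennreal_mult' distrib_left add_ac)
    also have "\<dots> \<le> ennreal (exp (- r * s)) * ennreal (continuation (h - s) ?X) + ennreal (G.game_value ?e (N n - k) (y0 + b))"
      unfolding P_def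
      by (intro add_right_mono mult_left_mono continuation_strict S_pos x) (use s \<epsilon>0[of n] in auto)
    also have "\<dots> = m n k b"
      using k by (simp add: m_def s_def ennreal_mult')
    finally show "(\<integral>\<^sup>+z. m n (Suc k) (b + z) \<partial>gauss (h / real (N n))) \<le> m n k b"
      by (simp add: \<epsilon>_def)
  next
    fix n k b assume k: "k \<le> N n"
    define s where "s = \<epsilon> n * real k"
    have s: "0 \<le> s" "s \<le> h" using time[OF k] \<epsilon>0[of n] by (auto simp: s_def)
    have R0: "0 \<le> continuation (h - s) (S x s b)" by (rule continuation_nonneg[OF _ S_pos[OF x]]) (use s in simp)
    have "exp (- r * s) * payoff (S x s b) \<le> 1 * payoff (S x s b)"
      using s r by (intro mult_right_mono) (auto simp: payoff_bounds)
    also have "\<dots> \<le> G.claim (y0 + b)"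
      unfolding G.claim_def y0_def using payoff_le_claim[OF x s(1), of T b] s h \<delta> by simp
    also have "\<dots> \<le> G.game_value (\<epsilon> n) (N n - k) (y0 + b)"
      by (cases "N n - k") auto
    finally have "exp (- r * s) * (payoff (S x s b) + continuation (h - s) (S x s b)) \<le>
      exp (- r * s) * continuation (h - s) (S x s b) + G.game_value (\<epsilon> n) (N n - k) (y0 + b)"
      by (simp add: distrib_left)
    then have "f s b \<le> ennreal (exp (- r * s) * continuation (h - s) (S x s b)) + ennreal (G.game_value (\<epsilon> n) (N n - k) (y0 + b))"
      unfolding f_def using R0
      by (subst ennreal_plus[symmetric]) (auto simp only: G.game_value_nonneg zero_le_mult_iff exp_ge_zero intro: ennreal_leI)
    then show "f (h / real (N n) * real k) b \<le> m n k b"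
      using k by (simp add: m_def s_def \<epsilon>_def)
  next
    fix s b :: real and Sq b' :: "nat \<Rightarrow> real"
    assume s: "0 \<le> s" "\<And>n. s \<le> Sq n \<and> Sq n \<le> h" and lim: "Sq \<longlonglongrightarrow> s" "b' \<longlonglongrightarrow> b"
    have "ennreal (continuation (h - s) (S x s b)) \<le> liminf (\<lambda>n. ennreal (continuation (h - Sq n) (S x (Sq n) (b' n))))"
      by (rule continuation_lsc) (use s in \<open>auto intro!: S_pos x tendsto_intros lim\<close>)
    moreover have "0 \<le> continuation (h - s) (S x s b)" "\<And>n. 0 \<le> continuation (h - Sq n) (S x (Sq n) (b' n))"
      using s order_trans[OF conjunct1[OF s(2)] conjunct2[OF s(2)]] by (auto intro!: continuation_nonneg S_pos x)
    ultimately show "f s b \<le> liminf (\<lambda>n. f (Sq n) (b' n))"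
      unfolding f_def
      by (intro lsc_real_affine tendsto_intros lim) (auto simp: payoff_bounds)
  qed
  also have "(\<lambda>n. m n 0 0) = (\<lambda>n. ennreal (continuation h x))"
  proof
    fix n
    have "G.game_value (\<epsilon> n) (N n) y0 = 0"
      unfolding y0_def by (rule D0) (use \<epsilon>0 \<epsilon>8 \<epsilon>N h \<delta> in auto)
    then show "m n 0 0 = ennreal (continuation h x)" by (simp add: m_def)
  qed
  finally show ?thesis by (simp add: f_def Liminf_const)
qed

lemma V2_le_G:
  assumes T: "\<delta> \<le> T" and t: "0 \<le> t" "t < T - \<delta>" and x: "x > 0"
    and D0: "\<And>\<epsilon> j. 0 < \<epsilon> \<Longrightarrow> \<epsilon> \<le> \<delta> / 8 \<Longrightarrow> \<epsilon> * real j \<le> T \<Longrightarrow>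
      penalised.game_value K (\<kappa>T T) (\<beta>T T) (cT T) \<delta> \<epsilon> j (ln x / \<sigma>) = 0"
  shows "V2 M B r \<sigma> K \<delta> T t x \<le> G M B r \<sigma> K \<delta> T t x"
proof -
  define h where "h = (T - \<delta>) - t"
  have h: "0 < h" "h \<le> T - \<delta>" using t by (auto simp: h_def)
  have R0: "0 \<le> continuation h x" using h x by (simp add: continuation_nonneg)
  have "V2 M B r \<sigma> K \<delta> T t x \<le> continuation h x"
    unfolding V2_def h_def[symmetric]
  proof (rule cSUP_least)
    show "stopping_times_upto M B h \<noteq> {}" using zero_stopping[of h] h by auto
    fix \<tau> assume \<tau>: "\<tau> \<in> stopping_times_upto M B h"
    have G: "G M B r \<sigma> K \<delta> T (t + \<tau> \<omega>) (gbm B r \<sigma> x (\<tau> \<omega>) \<omega>) =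
      payoff (S x (\<tau> \<omega>) (B (\<tau> \<omega>) \<omega>)) + continuation (h - \<tau> \<omega>) (S x (\<tau> \<omega>) (B (\<tau> \<omega>) \<omega>))" if "\<omega> \<in> space M" for \<omega>
      using stopping_timesD(3)[OF \<tau> that]
      by (simp add: G_def payoff_def gbm_S R_continuation S_pos x h_def algebra_simps)
    have "(\<integral>\<omega>. exp (- r * \<tau> \<omega>) * G M B r \<sigma> K \<delta> T (t + \<tau> \<omega>) (gbm B r \<sigma> x (\<tau> \<omega>) \<omega>) \<partial>M) =
      (\<integral>\<omega>. exp (- r * \<tau> \<omega>) * (payoff (S x (\<tau> \<omega>) (B (\<tau> \<omega>) \<omega>)) + continuation (h - \<tau> \<omega>) (S x (\<tau> \<omega>) (B (\<tau> \<omega>) \<omega>))) \<partial>M)"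
      by (intro Bochner_Integration.integral_cong) (auto simp: G)
    also have "\<dots> \<le> continuation h x"
    proof (rule integral_le_of_nn_integral_le[OF _ immediate_exercise_optimal[OF T h x D0 \<tau>] R0])
      fix \<omega> assume "\<omega> \<in> space M"
      then have "0 \<le> continuation (h - \<tau> \<omega>) (S x (\<tau> \<omega>) (B (\<tau> \<omega>) \<omega>))"
        using stopping_timesD(3)[OF \<tau>] by (intro continuation_nonneg S_pos x) simp
      then show "0 \<le> exp (- r * \<tau> \<omega>) * (payoff (S x (\<tau> \<omega>) (B (\<tau> \<omega>) \<omega>)) + continuation (h - \<tau> \<omega>) (S x (\<tau> \<omega>) (B (\<tau> \<omega>) \<omega>)))"
        by (simp add: payoff_bounds)
    qed
    finally show "(\<integral>\<omega>. exp (- r * \<tau> \<omega>) * G M B r \<sigma> K \<delta> T (t + \<tau> \<omega>) (gbm B r \<sigma> x (\<tau> \<omega>) \<omega>) \<partial>M) \<le> continuation h x" .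
  qed
  also have "continuation h x = R M B r \<sigma> K \<delta> T t x"
    unfolding h_def by (rule R_continuation[symmetric]) (use t x in auto)
  also have "\<dots> \<le> G M B r \<sigma> K \<delta> T t x" by (simp add: G_def)
  finally show ?thesis .
qed

lemma C2_bounded:
  assumes T: "\<delta> \<le> T"
  shows "\<exists>x1. \<forall>t. 0 \<le> t \<and> t < T - \<delta> \<longrightarrow> C2 M B r \<sigma> K \<delta> T t \<subseteq> {..x1}"
proof -
  interpret G: penalised K "\<kappa>T T" "\<beta>T T" "cT T" \<delta>
    by unfold_locales (use K cT_pos \<delta> in auto)
  obtain l where l: "\<And>\<epsilon> j y. 0 < \<epsilon> \<Longrightarrow> \<epsilon> \<le> \<delta> / 8 \<Longrightarrow> \<epsilon> * real j \<le> T \<Longrightarrow> l \<le> y \<Longrightarrow> G.game_value \<epsilon> j y = 0"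
    using G.game_value_vanishes[of T] by blast
  have "x \<le> exp (\<sigma> * l)" if t: "0 \<le> t" "t < T - \<delta>" and x: "x \<in> C2 M B r \<sigma> K \<delta> T t" for t x
  proof (rule ccontr)
    assume "\<not> x \<le> exp (\<sigma> * l)"
    then have "exp (\<sigma> * l) < x" by simp
    moreover have x0: "x > 0" using x by (simp add: C2_def)
    ultimately have "\<sigma> * l < ln x" by (simp add: ln_less_cancel_iff[symmetric] del: ln_less_cancel_iff)
    then have "l \<le> ln x / \<sigma>" using \<sigma> by (simp add: pos_le_divide_eq mult.commute)
    then have "V2 M B r \<sigma> K \<delta> T t x \<le> G M B r \<sigma> K \<delta> T t x"
      by (intro V2_le_G T t x0 l)
    then show False using x by (simp add: C2_def)
  qed
  then show ?thesis by (intro exI[of _ "exp (\<sigma> * l)"]) auto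
qed

end

theorem proposition3p10:
  fixes M :: "'a measure" and B :: "real \<Rightarrow> 'a \<Rightarrow> real" and r \<sigma> K \<delta> T :: real
  assumes "r > 0" and "\<sigma> > 0" and "K > 0" and "\<delta> > 0" and "T \<ge> \<delta>"
    and "prob_space M" and "complete_measure M"
    and "standard_brownian_motion M B"
  shows "(\<forall>t\<in>{0..T - \<delta>}. c2 M B r \<sigma> K \<delta> T t < \<infinity>) \<and>
         (SUP t\<in>{0..T - \<delta>}. c2 M B r \<sigma> K \<delta> T t) < \<infinity>"
proof -
  interpret swing M B r \<sigma> K \<delta>
    by (intro swing.intro market.intro brownian.intro brownian_axioms.intro market_axioms.intro swing_axioms.intro)
      (fact assms)+
  obtain x1 where x1: "\<And>t x. 0 \<le> t \<Longrightarrow> t < T - \<delta> \<Longrightarrow> x \<in> C2 M B r \<sigma> K \<delta> T t \<Longrightarrow> x \<le> x1"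
    using C2_bounded[OF assms(5)] by blast
  have le: "c2 M B r \<sigma> K \<delta> T t \<le> ereal (max K x1)" if "t \<in> {0..T - \<delta>}" for t
  proof (cases "t < T - \<delta>")
    case True
    then have "c2 M B r \<sigma> K \<delta> T t = (SUP x\<in>C2 M B r \<sigma> K \<delta> T t. ereal x)"
      by (simp add: c2_def)
    also have "\<dots> \<le> ereal (max K x1)"
    proof (rule SUP_least)
      fix x assume "x \<in> C2 M B r \<sigma> K \<delta> T t"
      then have "x \<le> x1" using x1[OF _ True] that by simp
      then show "ereal x \<le> ereal (max K x1)" by (simp only: ereal_less_eq max.coboundedI2)
    qed
    finally show ?thesis .
  qed (simp add: c2_def)
  then have "(SUP t\<in>{0..T - \<delta>}. c2 M B r \<sigma> K \<delta> T t) \<le> ereal (max K x1)"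
    by (rule SUP_least)
  moreover have "ereal (max K x1) < \<infinity>" by (rule less_ereal.simps(4)[THEN iffD2, OF TrueI])
  ultimately show ?thesis using le le_less_trans by blast
qed

end
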